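(* Let $1<r\le p<\infty$ and let $X$ be a real Banach space. Then the following are equivalent: (1) $X$ admits a uniformly $H^r$-smooth bump function; (2) $L_p(X)$ admits a uniformly $H^r$-smooth bump function; (3) $L_p(X)$ admits an $H^r$-smooth bump function.
   Context: $(\Omega,\mu)$ is a measure space with $L_p(\Omega,\mu)$ infinite-dimensional, and $L_p(X)$ is the Lebesgue–Bochner space of measurable $u:\Omega\to X$ with $(\int_\Omega\|u(s)\|^p d\mu)^{1/p}<\infty$. A bump function is a real-valued function with bounded nonempty support. For real $s>1$, with $n$ the largest integer strictly less than $s$: $g$ is $H^s$-smooth if it is $C^n$ and $g^{(n)}$ is locally uniformly $(s-n)$-Hölder (for every $x$ there are $\delta,M>0$ with $\|g^{(n)}(y)-g^{(n)}(z)\|\le M\|y-z\|^{s-n}$ for $y,z\in B(x,\delta)$); $g$ is uniformly $H^s$-smooth if this inequality holds for all $y,z$ in the whole space with one constant $M$. *)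

theory Defs
  imports "HOL-Analysis.Analysis" "HOL-Library.Function_Algebras"
begin

instantiation "fun" :: (type, real_vector) real_vector
begin
definition scaleR_fun :: "real \<Rightarrow> ('a \<Rightarrow> 'b) \<Rightarrow> 'a \<Rightarrow> 'b" where
  "scaleR_fun c f = (\<lambda>x. c *\<^sub>R f x)"
instance by standard (auto simp: scaleR_fun_def fun_eq_iff scaleR_add_right scaleR_add_left)
end

text \<open>We work with a real vector space presented as a carrier set V (a linear
subspace of some real vector type) together with a seminorm N.  For a Banach
space X this is (UNIV, norm); for the Lebesgue-Bochner space L_p(X) it is the set
of p-integrable strongly measurable representatives with the L_p seminorm (so the
quotient by null functions is handled implicitly: every continuous function on
representatives is constant on a.e.-classes).\<close>

text \<open>k-linear real forms are represented as functions of a vector family vs,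
depending only on vs 0, ..., vs (k-1).  The bound below says the operator norm of
T is at most C.\<close>

definition mbound :: "'a set \<Rightarrow> ('a \<Rightarrow> real) \<Rightarrow> nat \<Rightarrow> ((nat \<Rightarrow> 'a) \<Rightarrow> real) \<Rightarrow> real \<Rightarrow> bool" where
  "mbound V N k T C \<longleftrightarrow>
     (\<forall>vs. (\<forall>i<k. vs i \<in> V) \<longrightarrow> \<bar>T vs\<bar> \<le> C * (\<Prod>i<k. N (vs i)))"

definition mlin :: "'a::real_vector set \<Rightarrow> ('a \<Rightarrow> real) \<Rightarrow> nat \<Rightarrow> ((nat \<Rightarrow> 'a) \<Rightarrow> real) \<Rightarrow> bool" where
  "mlin V N k T \<longleftrightarrow>
     (\<forall>vs ws. (\<forall>i<k. vs i = ws i) \<longrightarrow> T vs = T ws) \<and>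
     (\<forall>vs i a b u w. i < k \<longrightarrow> (\<forall>j<k. vs j \<in> V) \<longrightarrow> u \<in> V \<longrightarrow> w \<in> V \<longrightarrow>
        T (vs(i := a *\<^sub>R u + b *\<^sub>R w)) = a * T (vs(i := u)) + b * T (vs(i := w))) \<and>
     (\<exists>C. mbound V N k T C)"

text \<open>D is a family of Frechet derivatives of g up to order n: D 0 x = g x,
each D k x is a bounded k-linear form, and D (k+1) x is the Frechet derivative at x
of y \<mapsto> D k y (w.r.t. the operator norm), for k < n; the new direction h
is placed in the last slot.\<close>
definition derivs_upto :: "'a::real_vector set \<Rightarrow> ('a \<Rightarrow> real) \<Rightarrow> ('a \<Rightarrow> real) \<Rightarrow> nat
    \<Rightarrow> (nat \<Rightarrow> 'a \<Rightarrow> (nat \<Rightarrow> 'a) \<Rightarrow> real) \<Rightarrow> bool" where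
  "derivs_upto V N g n D \<longleftrightarrow>
     (\<forall>x\<in>V. \<forall>vs. D 0 x vs = g x) \<and>
     (\<forall>k\<le>n. \<forall>x\<in>V. mlin V N k (D k x)) \<and>
     (\<forall>k<n. \<forall>x\<in>V. \<forall>\<epsilon>>0. \<exists>\<delta>>0. \<forall>h\<in>V. N h < \<delta> \<longrightarrow>
        mbound V N k (\<lambda>vs. D k (x + h) vs - D k x vs - D (Suc k) x (vs(k := h))) (\<epsilon> * N h))"

definition horder :: "real \<Rightarrow> nat" where
  "horder s = nat (\<lceil>s\<rceil> - 1)"

definition H_smooth :: "'a::real_vector set \<Rightarrow> ('a \<Rightarrow> real) \<Rightarrow> real \<Rightarrow> ('a \<Rightarrow> real) \<Rightarrow> bool" where
  "H_smooth V N s g \<longleftrightarrow> (\<exists>D. derivs_upto V N g (horder s) D \<and>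
     (\<forall>x\<in>V. \<exists>\<delta>>0. \<exists>M. \<forall>y\<in>V. \<forall>z\<in>V. N (y - x) < \<delta> \<longrightarrow> N (z - x) < \<delta> \<longrightarrow>
        mbound V N (horder s) (\<lambda>vs. D (horder s) y vs - D (horder s) z vs)
          (M * N (y - z) powr (s - real (horder s)))))"

definition uniformly_H_smooth :: "'a::real_vector set \<Rightarrow> ('a \<Rightarrow> real) \<Rightarrow> real \<Rightarrow> ('a \<Rightarrow> real) \<Rightarrow> bool" where
  "uniformly_H_smooth V N s g \<longleftrightarrow> (\<exists>D. derivs_upto V N g (horder s) D \<and>
     (\<exists>M. \<forall>y\<in>V. \<forall>z\<in>V.
        mbound V N (horder s) (\<lambda>vs. D (horder s) y vs - D (horder s) z vs)
          (M * N (y - z) powr (s - real (horder s)))))"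

definition bump :: "'a set \<Rightarrow> ('a \<Rightarrow> real) \<Rightarrow> ('a \<Rightarrow> real) \<Rightarrow> bool" where
  "bump V N g \<longleftrightarrow> (\<exists>x\<in>V. g x \<noteq> 0) \<and> (\<exists>R. \<forall>x\<in>V. g x \<noteq> 0 \<longrightarrow> N x \<le> R)"

definition strongly_measurable :: "'s measure \<Rightarrow> ('s \<Rightarrow> 'x::real_normed_vector) \<Rightarrow> bool" where
  "strongly_measurable M u \<longleftrightarrow>
     (\<exists>F. (\<forall>i. simple_function M (F i)) \<and> (AE s in M. (\<lambda>i. F i s) \<longlonglongrightarrow> u s))"

definition Lp_space :: "'s measure \<Rightarrow> real \<Rightarrow> ('s \<Rightarrow> 'x::real_normed_vector) set" where
  "Lp_space M p = {u. strongly_measurable M u \<and>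
      (\<integral>\<^sup>+ s. ennreal (norm (u s) powr p) \<partial>M) < \<infinity>}"

definition Lp_norm :: "'s measure \<Rightarrow> real \<Rightarrow> ('s \<Rightarrow> 'x::real_normed_vector) \<Rightarrow> real" where
  "Lp_norm M p u = enn2real (\<integral>\<^sup>+ s. ennreal (norm (u s) powr p) \<partial>M) powr (1 / p)"

definition Lp_infinite_dim :: "'s measure \<Rightarrow> real \<Rightarrow> bool" where
  "Lp_infinite_dim M p \<longleftrightarrow> (\<forall>n. \<exists>f :: nat \<Rightarrow> 's \<Rightarrow> real.
     (\<forall>i<n. f i \<in> Lp_space M p) \<and>
     (\<forall>c. Lp_norm M p (\<lambda>s. \<Sum>i<n. c i * f i s) = 0 \<longrightarrow> (\<forall>i<n. c i = 0)))"

end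

(* A jet is a family of multilinear forms D k, all of them bounded and \<alpha>-Hoelder for k \<le> n, such that
   D (k+1) is the derivative of D k along lines; by the mean value theorem, jets are the same as
   H\<^sup>r-smooth functions on balls, up to the size of the ball. If b is a uniformly smooth bump on X, a
   plateau function built from b gives an annular bump \<psi>, and G(x) = \<Sum>j. 2^(jp) \<psi>(x / 2^j), summed over the
   integers, is comparable to \<parallel>x\<parallel>^p with derivatives that scale accordingly. Hoelder's inequality
   then makes F(u) = \<integral> G(u(s)) a function on L\<^sub>p(X) with a jet on every ball, and (1 - F)\<^sub>+^(n+2) is a
   uniformly smooth bump.

   Conversely, L\<^sub>p(X) contains copies of X carried by disjoint sets. Starting from a point where the
   smooth bump g is nonzero, move within the k-th copy at step k, as far as possible subject to g
   decreasing by at most \<epsilon>/2^k. As g has bounded support, the steps are p-summable and the walk converges.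
   Near the limit the Hoelder estimate is uniform while the steps become short, so that at a late step
   g decreases by more than \<epsilon>/2^k outside a small ball of the copy of X; composing with
   t\<^sub>+^(n+2) gives a uniformly smooth bump on X. *)

theory Submission
  imports Defs
begin

subsection \<open>Multilinear forms in given slots\<close>

text \<open>All derivatives in a jet are taken along lines, so one-variable calculus suffices; the
  uniform Frechet remainder comes back from the Hoelder bound (\<open>jet_taylor\<close>). The
  hypothesis r \<le> p enters as p - k - \<alpha> \<ge> 0 for k \<le> n: these are exponents of norm
  x in the estimates for G, and together with those of the increment and of the k directions they
  add up to p, as Hoelder's inequality demands. The dyadic sum replaces the p-th power of the norm
  because the norm of X itself need not be smooth. The power n + 2 leaves a continuous derivative of
  order n + 1 after cutting off. In the converse the obstacle is that (3) gives a Hoelder bound only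
  on a ball of unknown radius about each point. The walk ends where such a ball meets almost maximal
  moves: once the chosen move is short, every clearly longer move in the same copy costs more than
  the allowance, so g cut off at that level is a bump within the ball. A jet on a ball that is
  constant outside half of it extends to the whole space with one constant
  (\<open>jet_extend\<close>); this turns local into uniform.\<close>

definition slotlin :: "'a::real_vector set \<Rightarrow> nat set \<Rightarrow> ((nat \<Rightarrow> 'a) \<Rightarrow> real) \<Rightarrow> bool" where
  "slotlin V S T \<longleftrightarrow>
     (\<forall>vs ws. (\<forall>i\<in>S. vs i = ws i) \<longrightarrow> T vs = T ws) \<and>
     (\<forall>vs i a b u w. i \<in> S \<longrightarrow> (\<forall>j\<in>S. vs j \<in> V) \<longrightarrow> u \<in> V \<longrightarrow> w \<in> V \<longrightarrow>
        T (vs(i := a *\<^sub>R u + b *\<^sub>R w)) = a * T (vs(i := u)) + b * T (vs(i := w)))"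

text \<open>Slots form an arbitrary set, and not an initial segment as in \<open>mbound\<close>,
  because the product rule distributes the directions of a higher derivative over several
  factors.\<close>

definition sbound :: "'a set \<Rightarrow> ('a \<Rightarrow> real) \<Rightarrow> nat set \<Rightarrow> ((nat \<Rightarrow> 'a) \<Rightarrow> real) \<Rightarrow> real \<Rightarrow> bool" where
  "sbound V N S T C \<longleftrightarrow> (\<forall>vs. (\<forall>i\<in>S. vs i \<in> V) \<longrightarrow> \<bar>T vs\<bar> \<le> C * (\<Prod>i\<in>S. N (vs i)))"

lemma mbound_iff_sbound: "mbound V N k T C \<longleftrightarrow> sbound V N {..<k} T C"
  by (auto simp: mbound_def sbound_def)

lemma mboundD:
  "mbound V N k T C \<Longrightarrow> (\<And>i. i < k \<Longrightarrow> vs i \<in> V) \<Longrightarrow> \<bar>T vs\<bar> \<le> C * (\<Prod>i<k. N (vs i))"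
  unfolding mbound_def by blast

lemma mlin_iff_slotlin: "mlin V N k T \<longleftrightarrow> slotlin V {..<k} T \<and> (\<exists>C. mbound V N k T C)"
  by (auto simp: mlin_def slotlin_def)

lemma slotlinI:
  assumes "\<And>vs ws. (\<And>i. i \<in> S \<Longrightarrow> vs i = ws i) \<Longrightarrow> T vs = T ws"
    and "\<And>vs i a b u w. i \<in> S \<Longrightarrow> (\<And>j. j \<in> S \<Longrightarrow> vs j \<in> V) \<Longrightarrow> u \<in> V \<Longrightarrow> w \<in> V \<Longrightarrow>
        T (vs(i := a *\<^sub>R u + b *\<^sub>R w)) = a * T (vs(i := u)) + b * T (vs(i := w))"
  shows "slotlin V S T"
  using assms unfolding slotlin_def by blast

lemma slotlin_cong:
  "slotlin V S T \<Longrightarrow> (\<And>i. i \<in> S \<Longrightarrow> vs i = ws i) \<Longrightarrow> T vs = T ws"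
  unfolding slotlin_def by blast

lemma slotlin_lin:
  "slotlin V S T \<Longrightarrow> i \<in> S \<Longrightarrow> (\<And>j. j \<in> S \<Longrightarrow> vs j \<in> V) \<Longrightarrow> u \<in> V \<Longrightarrow> w \<in> V \<Longrightarrow>
     T (vs(i := a *\<^sub>R u + b *\<^sub>R w)) = a * T (vs(i := u)) + b * T (vs(i := w))"
  unfolding slotlin_def by blast

lemma slotlin_const: "slotlin V {} (\<lambda>vs. c)"
  by (simp add: slotlin_def)

lemma slotlin_zero: "slotlin V S (\<lambda>vs. 0)"
  by (simp add: slotlin_def)

lemma slotlin_sum:
  fixes V :: "'a::real_vector set"
  assumes "\<And>a. a \<in> A \<Longrightarrow> slotlin V S (T a)"
  shows "slotlin V S (\<lambda>vs. \<Sum>a\<in>A. T a vs)"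
proof (rule slotlinI)
  fix vs ws :: "nat \<Rightarrow> 'a" assume "\<And>i. i \<in> S \<Longrightarrow> vs i = ws i"
  then show "(\<Sum>a\<in>A. T a vs) = (\<Sum>a\<in>A. T a ws)"
    by (intro sum.cong refl slotlin_cong[OF assms]) auto
next
  fix vs :: "nat \<Rightarrow> 'a" and i a b u w
  assume *: "i \<in> S" "\<And>j. j \<in> S \<Longrightarrow> vs j \<in> V" "u \<in> V" "w \<in> V"
  then show "(\<Sum>x\<in>A. T x (vs(i := a *\<^sub>R u + b *\<^sub>R w)))
      = a * (\<Sum>x\<in>A. T x (vs(i := u))) + b * (\<Sum>x\<in>A. T x (vs(i := w)))"
    by (simp add: slotlin_lin[OF assms *] sum.distrib sum_distrib_left cong: sum.cong)
qed

lemma slotlin_cmult: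
  fixes V :: "'a::real_vector set"
  assumes "slotlin V S T"
  shows "slotlin V S (\<lambda>vs. c * T vs)"
proof (rule slotlinI)
  fix vs ws :: "nat \<Rightarrow> 'a" assume "\<And>i. i \<in> S \<Longrightarrow> vs i = ws i"
  then show "c * T vs = c * T ws"
    using slotlin_cong[OF assms] by metis
next
  fix vs :: "nat \<Rightarrow> 'a" and i a b u w
  assume *: "i \<in> S" "\<And>j. j \<in> S \<Longrightarrow> vs j \<in> V" "u \<in> V" "w \<in> V"
  then show "c * T (vs(i := a *\<^sub>R u + b *\<^sub>R w)) = a * (c * T (vs(i := u))) + b * (c * T (vs(i := w)))"
    by (simp add: slotlin_lin[OF assms *] algebra_simps)
qed

lemma slotlin_diff:
  fixes V :: "'a::real_vector set"
  assumes "slotlin V S T" "slotlin V S U"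
  shows "slotlin V S (\<lambda>vs. T vs - U vs)"
proof (rule slotlinI)
  fix vs ws :: "nat \<Rightarrow> 'a" assume "\<And>i. i \<in> S \<Longrightarrow> vs i = ws i"
  then show "T vs - U vs = T ws - U ws"
    using slotlin_cong[OF assms(1)] slotlin_cong[OF assms(2)] by metis
next
  fix vs :: "nat \<Rightarrow> 'a" and i a b u w
  assume *: "i \<in> S" "\<And>j. j \<in> S \<Longrightarrow> vs j \<in> V" "u \<in> V" "w \<in> V"
  then show "T (vs(i := a *\<^sub>R u + b *\<^sub>R w)) - U (vs(i := a *\<^sub>R u + b *\<^sub>R w))
      = a * (T (vs(i := u)) - U (vs(i := u))) + b * (T (vs(i := w)) - U (vs(i := w)))"
    by (simp add: slotlin_lin[OF assms(1) *] slotlin_lin[OF assms(2) *] algebra_simps)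
qed

lemma slotlin_mult:
  fixes V :: "'a::real_vector set"
  assumes T: "slotlin V A T" and U: "slotlin V B U" and "A \<inter> B = {}"
  shows "slotlin V (A \<union> B) (\<lambda>vs. T vs * U vs)"
proof (rule slotlinI)
  fix vs ws :: "nat \<Rightarrow> 'a" assume *: "\<And>i. i \<in> A \<union> B \<Longrightarrow> vs i = ws i"
  then have "T vs = T ws" "U vs = U ws"
    by (auto intro: slotlin_cong[OF T] slotlin_cong[OF U])
  then show "T vs * U vs = T ws * U ws" by simp
next
  fix vs :: "nat \<Rightarrow> 'a" and i a b u w
  assume *: "i \<in> A \<union> B" "\<And>j. j \<in> A \<union> B \<Longrightarrow> vs j \<in> V" "u \<in> V" "w \<in> V"
  show "T (vs(i := a *\<^sub>R u + b *\<^sub>R w)) * U (vs(i := a *\<^sub>R u + b *\<^sub>R w))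
      = a * (T (vs(i := u)) * U (vs(i := u))) + b * (T (vs(i := w)) * U (vs(i := w)))"
  proof (cases "i \<in> A")
    case True
    then have "i \<notin> B" using assms by auto
    then have "U (vs(i := x)) = U vs" for x by (intro slotlin_cong[OF U]) auto
    then show ?thesis using slotlin_lin[OF T True _ *(3,4)] *(2) by (simp add: algebra_simps)
  next
    case False
    then have "T (vs(i := x)) = T vs" for x by (intro slotlin_cong[OF T]) auto
    then show ?thesis using slotlin_lin[OF U _ _ *(3,4), of i] *(1,2) False by (simp add: algebra_simps)
  qed
qed

lemma slotlin_scale:
  fixes V :: "'a::real_vector set" and s :: real
  assumes "slotlin V S T" "i \<in> S" "\<And>j. j \<in> S \<Longrightarrow> vs j \<in> V" "h \<in> V"
  shows "T (vs(i := s *\<^sub>R h)) = s * T (vs(i := h))"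
  using slotlin_lin[OF assms(1-3) assms(4) assms(4), where a = s and b = 0] by simp

subsection \<open>Jets on seminormed spaces\<close>

text \<open>Both spaces of the theorem are instances: \<open>UNIV\<close> with the norm, and the
  p-integrable representatives, among which null functions have seminorm 0.\<close>

locale seminormed =
  fixes V :: "'a::real_vector set" and N :: "'a \<Rightarrow> real"
  assumes subspace: "subspace V"
    and nonneg: "x \<in> V \<Longrightarrow> 0 \<le> N x"
    and triangle: "x \<in> V \<Longrightarrow> y \<in> V \<Longrightarrow> N (x + y) \<le> N x + N y"
    and scale: "x \<in> V \<Longrightarrow> N (c *\<^sub>R x) = \<bar>c\<bar> * N x"
begin

lemma V_closed [simp, intro]:
  "0 \<in> V" "x \<in> V \<Longrightarrow> y \<in> V \<Longrightarrow> x + y \<in> V" "x \<in> V \<Longrightarrow> c *\<^sub>R x \<in> V"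
  "x \<in> V \<Longrightarrow> y \<in> V \<Longrightarrow> x - y \<in> V" "x \<in> V \<Longrightarrow> - x \<in> V"
  using subspace by (auto simp: subspace_def subspace_diff subspace_neg)

lemma N_zero [simp]: "N 0 = 0"
  using scale[of 0 0] by simp

lemma N_minus: "x \<in> V \<Longrightarrow> N (- x) = N x"
  using scale[of x "-1"] by simp

lemma N_commute: "x \<in> V \<Longrightarrow> y \<in> V \<Longrightarrow> N (x - y) = N (y - x)"
  using N_minus[of "x - y"] by simp

lemma N_triangle3: "x \<in> V \<Longrightarrow> y \<in> V \<Longrightarrow> z \<in> V \<Longrightarrow> N (x - z) \<le> N (x - y) + N (y - z)"
  using triangle[of "x - y" "y - z"] by simp

lemma N_prod_nonneg: "(\<And>i. i \<in> S \<Longrightarrow> vs i \<in> V) \<Longrightarrow> 0 \<le> (\<Prod>i\<in>S. N (vs i))"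
  by (intro prod_nonneg) (auto simp: nonneg)

lemma sbound_mono:
  assumes "sbound V N S T C" "C \<le> C'"
  shows "sbound V N S T C'"
  unfolding sbound_def
proof (intro allI impI)
  fix vs :: "nat \<Rightarrow> 'a" assume "\<forall>i\<in>S. vs i \<in> V"
  then show "\<bar>T vs\<bar> \<le> C' * (\<Prod>i\<in>S. N (vs i))"
    using assms N_prod_nonneg[of S vs] mult_right_mono[OF assms(2), of "\<Prod>i\<in>S. N (vs i)"]
    unfolding sbound_def by fastforce
qed

lemma mbound_mono: "mbound V N k T C \<Longrightarrow> C \<le> C' \<Longrightarrow> mbound V N k T C'"
  unfolding mbound_iff_sbound by (rule sbound_mono)

text \<open>The differentiability clause fixes the directions and a line, which is weaker than the
  clause of \<open>derivs_upto\<close>; the Hoelder clause at all levels compensates for it. One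
  constant for all levels keeps the class stable under products and composition.\<close>

definition jet :: "'a set \<Rightarrow> nat \<Rightarrow> real \<Rightarrow> real \<Rightarrow> ('a \<Rightarrow> real) \<Rightarrow>
    (nat \<Rightarrow> 'a \<Rightarrow> (nat \<Rightarrow> 'a) \<Rightarrow> real) \<Rightarrow> bool" where
  "jet B n \<alpha> C g D \<longleftrightarrow>
     B \<subseteq> V \<and> 0 \<le> C \<and>
     (\<forall>x\<in>V. \<forall>vs. D 0 x vs = g x) \<and>
     (\<forall>k\<le>n. \<forall>x\<in>B. slotlin V {..<k} (D k x) \<and> mbound V N k (D k x) C) \<and>
     (\<forall>k\<le>n. \<forall>x\<in>B. \<forall>y\<in>B. mbound V N k (\<lambda>vs. D k x vs - D k y vs) (C * N (x - y) powr \<alpha>)) \<and>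
     (\<forall>k<n. \<forall>x\<in>B. \<forall>vs. \<forall>h\<in>V. (\<forall>i<k. vs i \<in> V) \<longrightarrow>
        ((\<lambda>t. D k (x + t *\<^sub>R h) vs) has_real_derivative D (Suc k) x (vs(k := h))) (at 0))"

lemma jetD:
  assumes "jet B n \<alpha> C g D"
  shows "B \<subseteq> V" "0 \<le> C" "x \<in> V \<Longrightarrow> D 0 x vs = g x"
    "k \<le> n \<Longrightarrow> x \<in> B \<Longrightarrow> slotlin V {..<k} (D k x)"
    "k \<le> n \<Longrightarrow> x \<in> B \<Longrightarrow> mbound V N k (D k x) C"
    "k \<le> n \<Longrightarrow> x \<in> B \<Longrightarrow> y \<in> B \<Longrightarrow>
       mbound V N k (\<lambda>vs. D k x vs - D k y vs) (C * N (x - y) powr \<alpha>)"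
    "k < n \<Longrightarrow> x \<in> B \<Longrightarrow> h \<in> V \<Longrightarrow> (\<And>i. i < k \<Longrightarrow> vs i \<in> V) \<Longrightarrow>
       ((\<lambda>t. D k (x + t *\<^sub>R h) vs) has_real_derivative D (Suc k) x (vs(k := h))) (at 0)"
  using assms unfolding jet_def by (simp_all add: Ball_def)

lemma segment_mvt:
  fixes \<phi> \<psi> :: "'a \<Rightarrow> real"
  assumes "\<And>t. 0 \<le> t \<Longrightarrow> t \<le> 1 \<Longrightarrow>
      ((\<lambda>s. \<phi> ((x + t *\<^sub>R h) + s *\<^sub>R h)) has_real_derivative \<psi> (x + t *\<^sub>R h)) (at 0)"
  obtains t where "0 < t" "t < 1" "\<phi> (x + h) - \<phi> x = \<psi> (x + t *\<^sub>R h)"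
proof -
  have der: "((\<lambda>s. \<phi> (x + s *\<^sub>R h)) has_real_derivative \<psi> (x + t *\<^sub>R h)) (at t)"
    if "0 \<le> t" "t \<le> 1" for t
  proof -
    have "((\<lambda>s. \<phi> (x + (s + t) *\<^sub>R h)) has_real_derivative \<psi> (x + t *\<^sub>R h)) (at 0)"
      using assms[OF that] by (simp add: algebra_simps)
    then have "((\<lambda>s. \<phi> (x + s *\<^sub>R h)) has_real_derivative \<psi> (x + t *\<^sub>R h)) (at (0 + t))"
      unfolding DERIV_shift by simp
    then show ?thesis by simp
  qed
  from MVT2[of 0 1 "\<lambda>s. \<phi> (x + s *\<^sub>R h)" "\<lambda>t. \<psi> (x + t *\<^sub>R h)"] der
  obtain t where "0 < t" "t < 1" "\<phi> (x + 1 *\<^sub>R h) - \<phi> (x + 0 *\<^sub>R h) = (1 - 0) * \<psi> (x + t *\<^sub>R h)"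
    by auto
  with that show ?thesis by simp
qed

lemma jet_mvt:
  assumes j: "jet B n \<alpha> C g D" and "k < n" "h \<in> V" "\<And>i. i < k \<Longrightarrow> vs i \<in> V"
    and seg: "\<And>t. 0 \<le> t \<Longrightarrow> t \<le> 1 \<Longrightarrow> x + t *\<^sub>R h \<in> B"
  obtains t where "0 < t" "t < 1"
    "D k (x + h) vs - D k x vs = D (Suc k) (x + t *\<^sub>R h) (vs(k := h))"
proof (rule segment_mvt[of "\<lambda>y. D k y vs" x h "\<lambda>y. D (Suc k) y (vs(k := h))"])
  show "((\<lambda>s. D k (x + t *\<^sub>R h + s *\<^sub>R h) vs) has_real_derivative
      D (Suc k) (x + t *\<^sub>R h) (vs(k := h))) (at 0)" if "0 \<le> t" "t \<le> 1" for t
    by (rule jetD(7)[OF j \<open>k < n\<close> seg[OF that] \<open>h \<in> V\<close>]) (rule assms(4))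
qed (rule that)

lemma prod_fun_upd: "(\<Prod>i<Suc k. N ((vs(k := h)) i)) = (\<Prod>i<k. N (vs i)) * N h"
proof -
  have "(\<Prod>i<k. N ((vs(k := h)) i)) = (\<Prod>i<k. N (vs i))" by (intro prod.cong) auto
  then show ?thesis by simp
qed

text \<open>The mean value theorem turns the increment into \<open>D (Suc k)\<close> at an
  intermediate point, and the Hoelder bound compares that point with \<open>x\<close>. The estimate
  is uniform in \<open>vs\<close>, which recovers the Frechet derivative from derivatives along
  lines.\<close>

lemma jet_taylor:
  assumes j: "jet B n \<alpha> C g D" and "k < n" "h \<in> V" and vs: "\<And>i. i < k \<Longrightarrow> vs i \<in> V"
    and seg: "\<And>t. 0 \<le> t \<Longrightarrow> t \<le> 1 \<Longrightarrow> x + t *\<^sub>R h \<in> B" and "0 < \<alpha>"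
  shows "\<bar>D k (x + h) vs - D k x vs - D (Suc k) x (vs(k := h))\<bar>
    \<le> C * N h powr \<alpha> * N h * (\<Prod>i<k. N (vs i))"
proof -
  obtain t where t: "0 < t" "t < 1"
    "D k (x + h) vs - D k x vs = D (Suc k) (x + t *\<^sub>R h) (vs(k := h))"
    by (rule jet_mvt[OF j \<open>k < n\<close> \<open>h \<in> V\<close>, of vs x]) (use vs seg in blast)+
  have xB: "x \<in> B" "x + t *\<^sub>R h \<in> B" using seg[of 0] seg[of t] t by auto
  have "\<bar>D (Suc k) (x + t *\<^sub>R h) (vs(k := h)) - D (Suc k) x (vs(k := h))\<bar>
      \<le> C * N (x + t *\<^sub>R h - x) powr \<alpha> * (\<Prod>i<Suc k. N ((vs(k := h)) i))"
    using \<open>k < n\<close> vs \<open>h \<in> V\<close>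
    by (intro mboundD[OF jetD(6)[OF j _ xB(2,1)]]) (auto simp: less_Suc_eq)
  also have "\<dots> \<le> C * N h powr \<alpha> * (\<Prod>i<Suc k. N ((vs(k := h)) i))"
  proof (intro mult_right_mono mult_left_mono powr_mono2)
    show "N (x + t *\<^sub>R h - x) \<le> N h"
      using t mult_right_mono[of t 1 "N h", OF _ nonneg[OF \<open>h \<in> V\<close>]]
      by (simp add: scale[OF \<open>h \<in> V\<close>])
    show "0 \<le> (\<Prod>i<Suc k. N ((vs(k := h)) i))"
      using vs \<open>h \<in> V\<close> by (intro N_prod_nonneg) auto
    show "0 \<le> C" by (rule jetD(2)[OF j])
    show "0 \<le> N (x + t *\<^sub>R h - x)" using \<open>h \<in> V\<close> by (auto intro: nonneg)
  qed (use \<open>0 < \<alpha>\<close> in simp)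
  finally show ?thesis by (simp only: t(3) prod_fun_upd mult_ac)
qed

lemma jet_imp_uniformly_H_smooth:
  assumes j: "jet V n \<alpha> C g D" and n: "horder r = n" and a: "\<alpha> = r - real n" "0 < \<alpha>"
  shows "uniformly_H_smooth V N r g"
  unfolding uniformly_H_smooth_def derivs_upto_def mlin_iff_slotlin
proof (intro exI[of _ D] conjI allI impI ballI)
  show "\<exists>M. \<forall>y\<in>V. \<forall>z\<in>V. mbound V N (horder r) (\<lambda>vs. D (horder r) y vs - D (horder r) z vs)
      (M * N (y - z) powr (r - real (horder r)))"
    using jetD(6)[OF j] n a by auto
  fix k x \<epsilon>
  assume k: "k < horder r" "x \<in> V" and e: "(0::real) < \<epsilon>"
  \<comment> \<open>Solves \<open>(C + 1) * \<delta> powr \<alpha> = \<epsilon>\<close>; the summand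
    1 avoids division by 0 for \<open>C = 0\<close>.\<close>
  define \<delta> where "\<delta> = (\<epsilon> / (C + 1)) powr (1 / \<alpha>)"
  have C: "0 \<le> C" by (rule jetD(2)[OF j])
  have "\<delta> > 0" using e C by (simp add: \<delta>_def)
  moreover have "mbound V N k (\<lambda>vs. D k (x + h) vs - D k x vs - D (Suc k) x (vs(k := h))) (\<epsilon> * N h)"
    if h: "h \<in> V" "N h < \<delta>" for h
    unfolding mbound_def
  proof (intro allI impI)
    fix vs assume vs: "\<forall>i<k. vs i \<in> V"
    have "N h powr \<alpha> \<le> \<delta> powr \<alpha>" using h a nonneg[of h] by (intro powr_mono2) auto
    also have "\<dots> = \<epsilon> / (C + 1)" using e C a by (simp add: \<delta>_def powr_powr)
    finally have "(C + 1) * N h powr \<alpha> \<le> \<epsilon>" using C by (simp add: field_simps)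
    then have "C * N h powr \<alpha> \<le> \<epsilon>"
      using powr_ge_zero[of "N h" \<alpha>] by (auto simp: distrib_right simp del: powr_ge_zero)
    then have "C * N h powr \<alpha> * (N h * (\<Prod>i<k. N (vs i))) \<le> \<epsilon> * (N h * (\<Prod>i<k. N (vs i)))"
      using h vs by (intro mult_right_mono mult_nonneg_nonneg nonneg N_prod_nonneg) auto
    moreover have "\<bar>D k (x + h) vs - D k x vs - D (Suc k) x (vs(k := h))\<bar>
      \<le> C * N h powr \<alpha> * N h * (\<Prod>i<k. N (vs i))"
      using k vs h n a by (intro jet_taylor[OF j]) auto
    ultimately show "\<bar>D k (x + h) vs - D k x vs - D (Suc k) x (vs(k := h))\<bar>
      \<le> \<epsilon> * N h * (\<Prod>i<k. N (vs i))"
      by (simp add: mult_ac)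
  qed
  ultimately show "\<exists>\<delta>>0. \<forall>h\<in>V. N h < \<delta> \<longrightarrow>
    mbound V N k (\<lambda>vs. D k (x + h) vs - D k x vs - D (Suc k) x (vs(k := h))) (\<epsilon> * N h)"
    by blast
next
  show "\<exists>C. mbound V N k (D k x) C" if "k \<le> horder r" "x \<in> V" for k x
    using jetD(5)[OF j] that n by blast
qed (use jetD(3,4)[OF j] n in auto)

end

subsection \<open>Composition of jets with functions of a real variable\<close>

text \<open>Transports a form in the slots 0, ..., card S - 1 to the slots \<open>S\<close> along
  the increasing enumeration. The order matters because a new direction always belongs in the last
  slot.\<close>

definition slots :: "((nat \<Rightarrow> 'a) \<Rightarrow> real) \<Rightarrow> nat set \<Rightarrow> (nat \<Rightarrow> 'a) \<Rightarrow> real" where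
  "slots T S vs = T (\<lambda>i. vs (sorted_list_of_set S ! i))"

lemma bij_betw_sorted_nth:
  "finite (S :: nat set) \<Longrightarrow> bij_betw (\<lambda>i. sorted_list_of_set S ! i) {..<card S} S"
  by (intro bij_betw_nth) auto

lemma slotlin_slots:
  fixes V :: "'a::real_vector set"
  assumes T: "slotlin V {..<card S} T" and fin: "finite S"
  shows "slotlin V S (slots T S)"
proof (rule slotlinI)
  note bij = bij_betw_sorted_nth[OF fin]
  have mem: "sorted_list_of_set S ! l \<in> S" if "l < card S" for l
    using bij that by (auto simp: bij_betw_def)
  fix vs ws :: "nat \<Rightarrow> 'a" assume "\<And>i. i \<in> S \<Longrightarrow> vs i = ws i"
  then show "slots T S vs = slots T S ws"
    unfolding slots_def using mem by (intro slotlin_cong[OF T]) auto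
next
  note bij = bij_betw_sorted_nth[OF fin]
  have mem: "sorted_list_of_set S ! l \<in> S" if "l < card S" for l
    using bij that by (auto simp: bij_betw_def)
  fix vs :: "nat \<Rightarrow> 'a" and i a b u w
  assume *: "i \<in> S" "\<And>j. j \<in> S \<Longrightarrow> vs j \<in> V" "u \<in> V" "w \<in> V"
  obtain m where m: "m < card S" "i = sorted_list_of_set S ! m"
    using bij *(1) by (auto simp: bij_betw_def)
  have upd: "slots T S (vs(i := x)) = T ((\<lambda>l. vs (sorted_list_of_set S ! l))(m := x))" for x
    unfolding slots_def
  proof (rule slotlin_cong[OF T])
    fix l assume "l \<in> {..<card S}"
    then show "(vs(i := x)) (sorted_list_of_set S ! l)
        = ((\<lambda>l. vs (sorted_list_of_set S ! l))(m := x)) l"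
      using bij m by (auto simp: bij_betw_def inj_on_def)
  qed
  show "slots T S (vs(i := a *\<^sub>R u + b *\<^sub>R w)) = a * slots T S (vs(i := u)) + b * slots T S (vs(i := w))"
    unfolding upd using m *(2-) mem by (intro slotlin_lin[OF T]) auto
qed

lemma sbound_slots:
  assumes T: "mbound V N (card S) T C" and fin: "finite S"
  shows "sbound V N S (slots T S) C"
  unfolding sbound_def
proof (intro allI impI)
  fix vs assume vs: "\<forall>i\<in>S. vs i \<in> V"
  note bij = bij_betw_sorted_nth[OF fin]
  have "\<bar>slots T S vs\<bar> \<le> C * (\<Prod>i<card S. N (vs (sorted_list_of_set S ! i)))"
    unfolding slots_def using bij vs by (intro mboundD[OF T]) (auto simp: bij_betw_def)
  also have "(\<Prod>i<card S. N (vs (sorted_list_of_set S ! i))) = (\<Prod>i\<in>S. N (vs i))"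
    by (rule prod.reindex_bij_betw[OF bij])
  finally show "\<bar>slots T S vs\<bar> \<le> C * (\<Prod>i\<in>S. N (vs i))" .
qed

text \<open>As \<open>m\<close> exceeds all of \<open>S\<close>, it comes last in the sorted list
  and has index \<open>card S\<close>, the slot in which the next derivative expects the new
  direction.\<close>

lemma slots_insert:
  assumes fin: "finite S" and m: "\<And>i. i \<in> S \<Longrightarrow> i < m" and T: "slotlin V {..<Suc (card S)} T"
  shows "slots T (insert m S) (vs(m := h)) = T ((\<lambda>i. vs (sorted_list_of_set S ! i))(card S := h))"
  unfolding slots_def
proof (rule slotlin_cong[OF T])
  fix i assume i: "i \<in> {..<Suc (card S)}"
  have "m \<notin> S" using m by auto
  then have "sorted_list_of_set (insert m S) = sorted_list_of_set S @ [m]"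
    using fin m by (subst sorted_list_of_set_insert) (auto intro!: sorted_insort_is_snoc less_imp_le)
  moreover have "sorted_list_of_set S ! i \<noteq> m" if "i < card S"
    using bij_betw_sorted_nth[OF fin] that \<open>m \<notin> S\<close> by (auto simp: bij_betw_def)
  ultimately show "(vs(m := h)) (sorted_list_of_set (insert m S) ! i)
      = ((\<lambda>i. vs (sorted_list_of_set S ! i))(card S := h)) i"
    using i fin by (auto simp: nth_append less_Suc_eq)
qed

text \<open>The derivatives of \<open>\<theta> 0 \<circ> g\<close>, where \<open>\<theta> (Suc j)\<close> is the derivative of \<open>\<theta> j\<close> and \<open>P S\<close> is
  the derivative of \<open>g\<close> in the directions of the slots \<open>S\<close>. Differentiating \<open>\<theta> j \<circ> g\<close> in the first
  slot gives \<open>\<theta> (Suc j) \<circ> g\<close> times the first derivative of \<open>g\<close>, and the Leibniz rule distributes the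
  remaining slots. The first argument only bounds the recursion depth.\<close>

primrec faa :: "(nat \<Rightarrow> real \<Rightarrow> real) \<Rightarrow> ('a \<Rightarrow> real) \<Rightarrow> (nat set \<Rightarrow> 'a \<Rightarrow> (nat \<Rightarrow> 'a) \<Rightarrow> real) \<Rightarrow>
    nat \<Rightarrow> nat \<Rightarrow> nat set \<Rightarrow> 'a \<Rightarrow> (nat \<Rightarrow> 'a) \<Rightarrow> real" where
  "faa \<theta> g P 0 j S x vs = \<theta> j (g x)"
| "faa \<theta> g P (Suc k) j S x vs = (if S = {} then \<theta> j (g x) else
     (\<Sum>A\<in>Pow (S - {Min S}). faa \<theta> g P k (Suc j) A x vs * P (S - A) x vs))"

lemma faa_empty: "faa \<theta> g P k j {} x vs = \<theta> j (g x)"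
  by (cases k) auto

section \<open>Product and chain rule for jets\<close>

context seminormed
begin

definition bounded_hoelder :: "'a set \<Rightarrow> real \<Rightarrow> nat set \<Rightarrow> ('a \<Rightarrow> (nat \<Rightarrow> 'a) \<Rightarrow> real) \<Rightarrow> real \<Rightarrow> bool" where
  "bounded_hoelder B \<alpha> S f C \<longleftrightarrow> (\<forall>x\<in>B. sbound V N S (f x) C) \<and>
     (\<forall>x\<in>B. \<forall>y\<in>B. sbound V N S (\<lambda>vs. f x vs - f y vs) (C * N (x - y) powr \<alpha>))"

lemma bounded_hoelder_mono: "bounded_hoelder B \<alpha> S f C \<Longrightarrow> C \<le> C' \<Longrightarrow> bounded_hoelder B \<alpha> S f C'"
  unfolding bounded_hoelder_def by (meson mult_right_mono powr_ge_zero sbound_mono)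

text \<open>A difference of products splits as \<open>(f x - f y) * g x + f y * (g x - g y)\<close>;
  each half contributes \<open>C1 * C2\<close>, hence the factor 2.\<close>

lemma bounded_hoelder_mult:
  assumes f: "bounded_hoelder B \<alpha> A f C1" and g: "bounded_hoelder B \<alpha> A' g C2"
    and fin: "finite A" "finite A'" and dis: "A \<inter> A' = {}" and C: "0 \<le> C1" "0 \<le> C2"
  shows "bounded_hoelder B \<alpha> (A \<union> A') (\<lambda>x vs. f x vs * g x vs) (2 * C1 * C2)"
proof -
  have bd: "\<bar>f x vs * g x vs\<bar> \<le> C1 * C2 * (\<Prod>i\<in>A\<union>A'. N (vs i))"
    if "x \<in> B" "\<forall>i\<in>A\<union>A'. vs i \<in> V" for x vs
  proof -
    have "\<bar>f x vs\<bar> * \<bar>g x vs\<bar> \<le> (C1 * (\<Prod>i\<in>A. N (vs i))) * (C2 * (\<Prod>i\<in>A'. N (vs i)))"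
      using f g that C unfolding bounded_hoelder_def sbound_def
      by (intro mult_mono mult_nonneg_nonneg N_prod_nonneg) auto
    then show ?thesis by (simp add: abs_mult prod.union_disjoint[OF fin dis] mult_ac)
  qed
  show ?thesis unfolding bounded_hoelder_def sbound_def
  proof (intro conjI ballI allI impI)
    fix x vs assume x: "x \<in> B" and vs: "\<forall>i\<in>A\<union>A'. vs i \<in> V"
    have "0 \<le> C1 * C2 * (\<Prod>i\<in>A\<union>A'. N (vs i))"
      using C vs by (intro mult_nonneg_nonneg N_prod_nonneg) auto
    then show "\<bar>f x vs * g x vs\<bar> \<le> 2 * C1 * C2 * (\<Prod>i\<in>A\<union>A'. N (vs i))"
      using bd[OF x vs] by simp
    fix y assume y: "y \<in> B"
    let ?p = "\<Prod>i\<in>A. N (vs i)" and ?q = "\<Prod>i\<in>A'. N (vs i)" and ?e = "N (x - y) powr \<alpha>"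
    have "f x vs * g x vs - f y vs * g y vs = (f x vs - f y vs) * g x vs + f y vs * (g x vs - g y vs)"
      by (simp add: algebra_simps)
    also have "\<bar>\<dots>\<bar> \<le> \<bar>f x vs - f y vs\<bar> * \<bar>g x vs\<bar> + \<bar>f y vs\<bar> * \<bar>g x vs - g y vs\<bar>"
      by (metis abs_mult abs_triangle_ineq)
    also have "\<dots> \<le> (C1 * ?e * ?p) * (C2 * ?q) + (C1 * ?p) * (C2 * ?e * ?q)"
      using f g x y vs C unfolding bounded_hoelder_def sbound_def
      by (intro add_mono mult_mono mult_nonneg_nonneg N_prod_nonneg) auto
    also have "\<dots> = 2 * C1 * C2 * ?e * (\<Prod>i\<in>A\<union>A'. N (vs i))"
      by (simp add: prod.union_disjoint[OF fin dis])
    finally show "\<bar>f x vs * g x vs - f y vs * g y vs\<bar> \<le> 2 * C1 * C2 * ?e * (\<Prod>i\<in>A\<union>A'. N (vs i))" .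
  qed
qed

lemma bounded_hoelder_sum:
  assumes "\<And>a. a \<in> I \<Longrightarrow> bounded_hoelder B \<alpha> S (f a) C"
  shows "bounded_hoelder B \<alpha> S (\<lambda>x vs. \<Sum>a\<in>I. f a x vs) (real (card I) * C)"
  unfolding bounded_hoelder_def sbound_def
proof (intro conjI ballI allI impI)
  fix x vs assume x: "x \<in> B" and vs: "\<forall>i\<in>S. vs i \<in> V"
  have "\<bar>\<Sum>a\<in>I. f a x vs\<bar> \<le> (\<Sum>a\<in>I. C * (\<Prod>i\<in>S. N (vs i)))"
    using assms x vs unfolding bounded_hoelder_def sbound_def
    by (intro order_trans[OF sum_abs] sum_mono) auto
  then show "\<bar>\<Sum>a\<in>I. f a x vs\<bar> \<le> real (card I) * C * (\<Prod>i\<in>S. N (vs i))" by simp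
  fix y assume y: "y \<in> B"
  have "\<bar>(\<Sum>a\<in>I. f a x vs) - (\<Sum>a\<in>I. f a y vs)\<bar> \<le> (\<Sum>a\<in>I. C * N (x - y) powr \<alpha> * (\<Prod>i\<in>S. N (vs i)))"
    using assms x y vs unfolding bounded_hoelder_def sbound_def sum_subtractf[symmetric]
    by (intro order_trans[OF sum_abs] sum_mono) auto
  then show "\<bar>(\<Sum>a\<in>I. f a x vs) - (\<Sum>a\<in>I. f a y vs)\<bar>
      \<le> real (card I) * C * N (x - y) powr \<alpha> * (\<Prod>i\<in>S. N (vs i))" by (simp add: mult_ac)
qed

lemma bounded_hoelder_slots:
  assumes j: "jet B n \<alpha> C g D" and S: "finite S" "card S \<le> n"
  shows "bounded_hoelder B \<alpha> S (\<lambda>x. slots (D (card S) x) S) C"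
proof -
  have *: "(\<lambda>vs. slots T S vs - slots U S vs) = slots (\<lambda>vs. T vs - U vs) S" for T U :: "(nat \<Rightarrow> 'a) \<Rightarrow> real"
    by (simp add: slots_def fun_eq_iff)
  show ?thesis
    unfolding bounded_hoelder_def * using jetD(5,6)[OF j S(2)] S(1) by (auto intro!: sbound_slots)
qed

text \<open>The recursion \<open>faa\<close> splits off the least slot first. A new largest slot
  leaves this choice unchanged, so the expansions for \<open>S\<close> and for
  \<open>insert m S\<close> can be compared term by term.\<close>

lemma min_insert_greater:
  fixes m :: nat
  assumes "finite S" "S \<noteq> {}" "\<And>i. i \<in> S \<Longrightarrow> i < m"
  shows "Min (insert m S) = Min S" "insert m S - {Min S} = insert m (S - {Min S})" "m \<notin> S"
proof -
  have "Min S < m" using assms by auto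
  then show "Min (insert m S) = Min S" using assms(1,2) by (intro Min_eqI) auto
  show "insert m S - {Min S} = insert m (S - {Min S})" using \<open>Min S < m\<close> by auto
  show "m \<notin> S" using assms by auto
qed

lemma faa_slotlin:
  assumes P: "\<And>S. finite S \<Longrightarrow> card S \<le> n \<Longrightarrow> slotlin V S (P S x)"
  shows "finite S \<Longrightarrow> card S \<le> k \<Longrightarrow> k \<le> n \<Longrightarrow> slotlin V S (faa \<theta> g P k j S x)"
proof (induction k arbitrary: j S)
  case 0
  then show ?case by (simp add: slotlin_def)
next
  case (Suc k)
  show ?case
  proof (cases "S = {}")
    case True
    then show ?thesis by (simp add: slotlin_def)
  next
    case False
    then have mS: "Min S \<in> S" using Suc by simp
    have "slotlin V S (\<lambda>vs. faa \<theta> g P k (Suc j) A x vs * P (S - A) x vs)"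
      if A: "A \<in> Pow (S - {Min S})" for A
    proof -
      have "card A \<le> card (S - {Min S})" using A Suc by (intro card_mono) auto
      then have "card A \<le> k" using mS Suc by simp
      moreover have "finite A" using A Suc finite_subset[of A S] by auto
      moreover have "card (S - A) \<le> n" using Suc card_mono[of S "S - A"] by auto
      ultimately have "slotlin V (A \<union> (S - A)) (\<lambda>vs. faa \<theta> g P k (Suc j) A x vs * P (S - A) x vs)"
        using Suc by (intro slotlin_mult P) auto
      moreover have "A \<union> (S - A) = S" using A by auto
      ultimately show ?thesis by simp
    qed
    then have "slotlin V S (\<lambda>vs. \<Sum>A\<in>Pow (S - {Min S}). faa \<theta> g P k (Suc j) A x vs * P (S - A) x vs)"
      by (rule slotlin_sum)
    then show ?thesis using False by simp
  qed
qed

lemma faa_hb: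
  assumes P: "\<And>S. finite S \<Longrightarrow> card S \<le> n \<Longrightarrow> bounded_hoelder B \<alpha> S (P S) C" and C: "0 \<le> C"
    and \<theta>: "\<And>j. j \<le> n \<Longrightarrow> bounded_hoelder B \<alpha> {} (\<lambda>x vs. \<theta> j (g x)) K" and K: "0 \<le> K"
  shows "k \<le> n \<Longrightarrow> \<exists>K'\<ge>0. \<forall>j S. j + k \<le> n \<longrightarrow> finite S \<longrightarrow> card S \<le> k \<longrightarrow> bounded_hoelder B \<alpha> S (faa \<theta> g P k j S) K'"
proof (induction k)
  case 0
  then show ?case using \<theta> K by auto
next
  case (Suc k)
  then obtain K1 where K1: "0 \<le> K1"
    "\<And>j S. j + k \<le> n \<Longrightarrow> finite S \<Longrightarrow> card S \<le> k \<Longrightarrow> bounded_hoelder B \<alpha> S (faa \<theta> g P k j S) K1"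
    by auto
  \<comment> \<open>\<open>K\<close> covers the empty set of slots. Otherwise there are at most 2^k
    subsets, each giving a term with constant \<open>2 * K1 * C\<close> by the product rule.\<close>
  let ?K = "K + 2 ^ k * (2 * K1 * C)"
  have "bounded_hoelder B \<alpha> S (faa \<theta> g P (Suc k) j S) ?K" if j: "j + Suc k \<le> n" and S: "finite S" "card S \<le> Suc k" for j S
  proof (cases "S = {}")
    case True
    then have "faa \<theta> g P (Suc k) j S = (\<lambda>x vs. \<theta> j (g x))" by (intro ext) simp
    then show ?thesis using bounded_hoelder_mono[OF \<theta>[of j], of ?K] j C K K1(1) True by simp
  next
    case False
    then have mS: "Min S \<in> S" using S by simp
    have "bounded_hoelder B \<alpha> S (\<lambda>x vs. faa \<theta> g P k (Suc j) A x vs * P (S - A) x vs) (2 * K1 * C)"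
      if A: "A \<in> Pow (S - {Min S})" for A
    proof -
      have "card A \<le> card (S - {Min S})" using A S by (intro card_mono) auto
      then have "card A \<le> k" using mS S by simp
      moreover have "finite A" using A S finite_subset[of A S] by auto
      moreover have "card (S - A) \<le> n" using S j card_mono[of S "S - A"] by auto
      ultimately have "bounded_hoelder B \<alpha> (A \<union> (S - A)) (\<lambda>x vs. faa \<theta> g P k (Suc j) A x vs * P (S - A) x vs) (2 * K1 * C)"
        using S j C K1(1) by (intro bounded_hoelder_mult P K1(2)) auto
      moreover have "A \<union> (S - A) = S" using A by auto
      ultimately show ?thesis by simp
    qed
    then have "bounded_hoelder B \<alpha> S (\<lambda>x vs. \<Sum>A\<in>Pow (S - {Min S}). faa \<theta> g P k (Suc j) A x vs * P (S - A) x vs)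
        (real (card (Pow (S - {Min S}))) * (2 * K1 * C))"
      by (rule bounded_hoelder_sum)
    moreover have "faa \<theta> g P (Suc k) j S =
        (\<lambda>x vs. \<Sum>A\<in>Pow (S - {Min S}). faa \<theta> g P k (Suc j) A x vs * P (S - A) x vs)"
      using False by (intro ext) simp
    ultimately have "bounded_hoelder B \<alpha> S (faa \<theta> g P (Suc k) j S) (real (card (Pow (S - {Min S}))) * (2 * K1 * C))"
      by simp
    moreover have "real (card (Pow (S - {Min S}))) \<le> 2 ^ k"
    proof -
      have "card (S - {Min S}) \<le> k" using S mS by simp
      then show ?thesis using S by (simp add: card_Pow)
    qed
    then have "real (card (Pow (S - {Min S}))) * (2 * K1 * C) \<le> ?K"
      using K K1(1) C mult_right_mono[of _ _ "2 * K1 * C"] by (simp add: add_increasing)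
    ultimately show ?thesis by (rule bounded_hoelder_mono)
  qed
  moreover have "0 \<le> ?K" using C K K1(1) by simp
  ultimately show ?case by blast
qed

text \<open>Induction on the depth. For empty \<open>S\<close> this is the chain rule. Otherwise the
  product rule puts the new slot \<open>m\<close> either into \<open>A\<close> or into its
  complement, and the two alternatives together enumerate the subsets of
  \<open>insert m (S - {Min S})\<close>.\<close>

lemma faa_deriv:
  assumes P0: "\<And>y vs. y \<in> V \<Longrightarrow> P {} y vs = g y" and x: "x \<in> V" "h \<in> V"
    and P: "\<And>S m. finite S \<Longrightarrow> card S < n \<Longrightarrow> (\<And>i. i \<in> S \<Longrightarrow> i < m) \<Longrightarrow> (\<And>i. i \<in> S \<Longrightarrow> vs i \<in> V) \<Longrightarrow>
      ((\<lambda>t. P S (x + t *\<^sub>R h) vs) has_real_derivative P (insert m S) x (vs(m := h))) (at 0)"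
    and Pl: "\<And>S. finite S \<Longrightarrow> card S \<le> n \<Longrightarrow> slotlin V S (P S x)"
    and \<theta>: "\<And>j t. j < n \<Longrightarrow> (\<theta> j has_real_derivative \<theta> (Suc j) t) (at t)"
  shows "finite S \<Longrightarrow> card S < k \<Longrightarrow> j + k \<le> n \<Longrightarrow> (\<And>i. i \<in> S \<Longrightarrow> i < m) \<Longrightarrow> (\<And>i. i \<in> S \<Longrightarrow> vs i \<in> V) \<Longrightarrow>
    ((\<lambda>t. faa \<theta> g P k j S (x + t *\<^sub>R h) vs) has_real_derivative faa \<theta> g P k j (insert m S) x (vs(m := h))) (at 0)"
proof (induction k arbitrary: j S)
  case 0
  then show ?case by simp
next
  case (Suc k)
  show ?case
  proof (cases "S = {}")
    case True
    have "((\<lambda>t. P {} (x + t *\<^sub>R h) vs) has_real_derivative P {m} x (vs(m := h))) (at 0)"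
      using Suc.prems by (intro P) auto
    then have "((\<lambda>t. g (x + t *\<^sub>R h)) has_real_derivative P {m} x (vs(m := h))) (at 0)"
      using P0 x by simp
    then have "((\<lambda>t. \<theta> j (g (x + t *\<^sub>R h))) has_real_derivative
        \<theta> (Suc j) (g (x + 0 *\<^sub>R h)) * P {m} x (vs(m := h))) (at 0)"
      using Suc.prems by (intro DERIV_chain2[OF \<theta>]) auto
    then show ?thesis using True by (simp add: faa_empty fun_upd_def)
  next
    case False
    note M = min_insert_greater[OF Suc.prems(1) False Suc.prems(4)]
    have mS: "Min S \<in> S" using Suc.prems False by simp
    let ?R = "S - {Min S}" and ?vs = "vs(m := h)"
    have "((\<lambda>t. \<Sum>A\<in>Pow ?R. faa \<theta> g P k (Suc j) A (x + t *\<^sub>R h) vs * P (S - A) (x + t *\<^sub>R h) vs)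
       has_real_derivative (\<Sum>A\<in>Pow ?R. faa \<theta> g P k (Suc j) (insert m A) x ?vs * P (S - A) x vs
          + P (insert m (S - A)) x ?vs * faa \<theta> g P k (Suc j) A x vs)) (at 0)"
    proof (rule DERIV_sum)
      fix A assume A: "A \<in> Pow ?R"
      have "card A \<le> card ?R" using A Suc.prems by (intro card_mono) auto
      then have "card A < k" using mS Suc.prems card_gt_0_iff[of S] by auto
      moreover have fA: "finite A" using A Suc.prems finite_subset[of A S] by auto
      ultimately have "((\<lambda>t. faa \<theta> g P k (Suc j) A (x + t *\<^sub>R h) vs) has_real_derivative
          faa \<theta> g P k (Suc j) (insert m A) x ?vs) (at 0)"
        using Suc.prems A by (intro Suc.IH) auto
      moreover have "card (S - A) < n" using Suc.prems card_mono[of S "S - A"] by auto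
      then have "((\<lambda>t. P (S - A) (x + t *\<^sub>R h) vs) has_real_derivative P (insert m (S - A)) x ?vs) (at 0)"
        using Suc.prems by (intro P) auto
      ultimately show "((\<lambda>t. faa \<theta> g P k (Suc j) A (x + t *\<^sub>R h) vs * P (S - A) (x + t *\<^sub>R h) vs)
         has_real_derivative (faa \<theta> g P k (Suc j) (insert m A) x ?vs * P (S - A) x vs
          + P (insert m (S - A)) x ?vs * faa \<theta> g P k (Suc j) A x vs)) (at 0)"
        using DERIV_mult by fastforce
    qed
    also have "(\<Sum>A\<in>Pow ?R. faa \<theta> g P k (Suc j) (insert m A) x ?vs * P (S - A) x vs
          + P (insert m (S - A)) x ?vs * faa \<theta> g P k (Suc j) A x vs)
        = (\<Sum>A\<in>Pow ?R. faa \<theta> g P k (Suc j) (insert m A) x ?vs * P (S - A) x vs)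
        + (\<Sum>A\<in>Pow ?R. faa \<theta> g P k (Suc j) A x vs * P (insert m (S - A)) x ?vs)"
      by (simp add: sum.distrib mult.commute)
    \<comment> \<open>The terms in which \<open>m\<close> joins \<open>A\<close>. The other factor
      lacks slot \<open>m\<close>, so there \<open>vs\<close> may be replaced by
      \<open>?vs\<close>.\<close>
    also have "(\<Sum>A\<in>Pow ?R. faa \<theta> g P k (Suc j) (insert m A) x ?vs * P (S - A) x vs)
        = (\<Sum>A\<in>insert m ` Pow ?R. faa \<theta> g P k (Suc j) A x ?vs * P (insert m S - A) x ?vs)"
    proof (subst sum.reindex)
      show "inj_on (insert m) (Pow ?R)" using M(3) by (auto simp: inj_on_def)
      have "P (S - A) x vs = P (insert m S - insert m A) x ?vs" if "A \<in> Pow ?R" for A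
      proof -
        have "insert m S - insert m A = S - A" using M(3) that by auto
        moreover have "card (S - A) \<le> n" using Suc.prems card_mono[of S "S - A"] by auto
        ultimately show ?thesis
          using M(3) Suc.prems(1) by (auto intro!: slotlin_cong[OF Pl])
      qed
      then show "(\<Sum>A\<in>Pow ?R. faa \<theta> g P k (Suc j) (insert m A) x ?vs * P (S - A) x vs)
        = sum ((\<lambda>A. faa \<theta> g P k (Suc j) A x ?vs * P (insert m S - A) x ?vs) \<circ> insert m) (Pow ?R)"
        by simp
    qed
    \<comment> \<open>The terms in which \<open>m\<close> joins the complement; here it is the
      \<open>faa\<close> factor that ignores slot \<open>m\<close>.\<close>
    also have "(\<Sum>A\<in>Pow ?R. faa \<theta> g P k (Suc j) A x vs * P (insert m (S - A)) x ?vs)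
        = (\<Sum>A\<in>Pow ?R. faa \<theta> g P k (Suc j) A x ?vs * P (insert m S - A) x ?vs)"
    proof (intro sum.cong refl arg_cong2[where f = "(*)"])
      fix A assume A: "A \<in> Pow ?R"
      have fA: "finite A" using A Suc.prems finite_subset[of A S] by auto
      have "card A \<le> card ?R" using A Suc.prems by (intro card_mono) auto
      then have "card A \<le> k" using mS Suc.prems by auto
      then show "faa \<theta> g P k (Suc j) A x vs = faa \<theta> g P k (Suc j) A x ?vs"
        using A M(3) Suc.prems fA by (intro slotlin_cong[OF faa_slotlin[where P = P and x = x and n = n, OF Pl]]) auto
      have "insert m (S - A) = insert m S - A" using M(3) A by auto
      then show "P (insert m (S - A)) x ?vs = P (insert m S - A) x ?vs" by simp
    qed
    also have "(\<Sum>A\<in>insert m ` Pow ?R. faa \<theta> g P k (Suc j) A x ?vs * P (insert m S - A) x ?vs)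
        + (\<Sum>A\<in>Pow ?R. faa \<theta> g P k (Suc j) A x ?vs * P (insert m S - A) x ?vs)
        = (\<Sum>A\<in>Pow (insert m ?R). faa \<theta> g P k (Suc j) A x ?vs * P (insert m S - A) x ?vs)"
      unfolding Pow_insert using Suc.prems(1) M(3)
      by (subst sum.union_disjoint) (auto simp: add.commute)
    finally show ?thesis using False M by (simp add: fun_upd_def)
  qed
qed

theorem jet_compose:
  assumes j: "jet B n \<alpha> C g D"
    and \<theta>: "\<And>j t. j \<le> n \<Longrightarrow> (\<theta> j has_real_derivative \<theta> (Suc j) t) (at t)"
    and cont: "continuous_on UNIV (\<theta> (Suc n))"
  obtains C' E where "jet B n \<alpha> C' (\<lambda>x. \<theta> 0 (g x)) E"
proof -
  have C: "0 \<le> C" and BV: "B \<subseteq> V" by (rule jetD[OF j])+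
  define P where "P = (\<lambda>S x. slots (D (card S) x) S)"
  have gC: "\<bar>g x\<bar> \<le> C" if "x \<in> B" for x
    using mboundD[OF jetD(5)[OF j, of 0 x], of undefined] jetD(3)[OF j] that BV by (simp add: subset_iff)
  have gH: "\<bar>g x - g y\<bar> \<le> C * N (x - y) powr \<alpha>" if "x \<in> B" "y \<in> B" for x y
    using mboundD[OF jetD(6)[OF j, of 0 x y], of undefined] jetD(3)[OF j] that BV by (simp add: subset_iff)
  \<comment> \<open>On \<open>B\<close> the values of \<open>g\<close> lie in the compact interval
    from -C to C, so all \<open>\<theta> i\<close> up to order n + 1 are bounded where they are
    evaluated.\<close>
  have "\<exists>b\<ge>0. \<forall>t\<in>{-C..C}. \<bar>\<theta> i t\<bar> \<le> b" if "i \<le> Suc n" for i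
  proof -
    have "continuous_on {-C..C} (\<theta> i)"
    proof (cases "i = Suc n")
      case True
      then show ?thesis using cont continuous_on_subset by blast
    next
      case False
      then have "i \<le> n" using that by simp
      then show ?thesis by (intro DERIV_continuous_on[OF has_field_derivative_at_within[OF \<theta>]])
    qed
    then have "bounded (\<theta> i ` {-C..C})" by (intro compact_imp_bounded compact_continuous_image) auto
    then obtain b where "b > 0" "\<forall>t\<in>{-C..C}. \<bar>\<theta> i t\<bar> \<le> b"
      unfolding bounded_pos by auto
    then show ?thesis by (intro exI[of _ b]) auto
  qed
  then obtain b where b0: "\<And>i. i \<le> Suc n \<Longrightarrow> 0 \<le> b i"
    and b: "\<And>i t. i \<le> Suc n \<Longrightarrow> t \<in> {-C..C} \<Longrightarrow> \<bar>\<theta> i t\<bar> \<le> b i"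
    by metis
  define b' where "b' = (\<Sum>i\<le>Suc n. b i)"
  have b': "b i \<le> b'" if "i \<le> Suc n" for i
    unfolding b'_def using that b0 by (intro member_le_sum) auto
  have b'0: "0 \<le> b'" using b0[of 0] b'[of 0] by linarith
  \<comment> \<open>\<open>b'\<close> bounds the values. It also bounds
    \<open>\<theta> (Suc i)\<close>, so it is a Lipschitz constant of \<open>\<theta> i\<close>, and
    \<open>b' * C\<close> is a Hoelder constant of the composition. The factor \<open>1 + C\<close>
    dominates both.\<close>
  have \<theta>hb: "bounded_hoelder B \<alpha> {} (\<lambda>x vs. \<theta> i (g x)) (b' * (1 + C))" if i: "i \<le> n" for i
    unfolding bounded_hoelder_def sbound_def
  proof (intro conjI ballI allI impI)
    fix x and vs :: "nat \<Rightarrow> 'a" assume x: "x \<in> B"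
    have "\<bar>\<theta> i (g x)\<bar> \<le> b'" using b[of i "g x"] b'[of i] i gC[OF x] by fastforce
    also have "\<dots> \<le> b' * (1 + C)" using b'0 C by (simp add: distrib_left)
    finally show "\<bar>\<theta> i (g x)\<bar> \<le> b' * (1 + C) * (\<Prod>i\<in>{}. N (vs i))" by simp
    fix y assume y: "y \<in> B"
    have "norm (\<theta> i (g x) - \<theta> i (g y)) \<le> b' * norm (g x - g y)"
    proof (rule field_differentiable_bound[of "{-C..C}" "\<theta> i" "\<theta> (Suc i)"])
      fix t assume "t \<in> {-C..C}"
      then show "norm (\<theta> (Suc i) t) \<le> b'" using b[of "Suc i" t] b'[of "Suc i"] i by fastforce
      show "(\<theta> i has_real_derivative \<theta> (Suc i) t) (at t within {-C..C})"
        by (rule has_field_derivative_at_within[OF \<theta>[OF i]])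
    qed (use gC[OF x] gC[OF y] in auto)
    also have "\<dots> \<le> b' * (C * N (x - y) powr \<alpha>)"
      using gH[OF x y] b'0 by (intro mult_left_mono) auto
    also have "\<dots> \<le> b' * ((1 + C) * N (x - y) powr \<alpha>)"
      using b'0 by (intro mult_left_mono mult_right_mono) auto
    finally show "\<bar>\<theta> i (g x) - \<theta> i (g y)\<bar> \<le> b' * (1 + C) * N (x - y) powr \<alpha> * (\<Prod>i\<in>{}. N (vs i))"
      by (simp add: mult_ac)
  qed
  have P0: "P {} y vs = g y" if "y \<in> V" for y vs
    using jetD(3)[OF j that] by (simp add: P_def slots_def)
  have Pl: "slotlin V S (P S x)" if "x \<in> B" "finite S" "card S \<le> n" for S x
    unfolding P_def using jetD(4)[OF j] that by (intro slotlin_slots) auto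
  have Pd: "((\<lambda>t. P S (x + t *\<^sub>R h) vs) has_real_derivative P (insert m S) x (vs(m := h))) (at 0)"
    if x: "x \<in> B" "h \<in> V" and S: "finite S" "card S < n" "\<And>i. i \<in> S \<Longrightarrow> i < m" and vs: "\<And>i. i \<in> S \<Longrightarrow> vs i \<in> V"
    for x h S m vs
  proof -
    have "m \<notin> S" using S by auto
    then have card: "card (insert m S) = Suc (card S)" using S by simp
    have *: "P (insert m S) x (vs(m := h)) = D (Suc (card S)) x ((\<lambda>i. vs (sorted_list_of_set S ! i))(card S := h))"
      unfolding P_def card using S x by (intro slots_insert[of S m V] jetD(4)[OF j]) auto
    show ?thesis
      unfolding * unfolding P_def slots_def
      using S x vs bij_betw_sorted_nth[OF S(1)]
      by (intro jetD(7)[OF j]) (auto simp: bij_betw_def)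
  qed
  have "\<exists>K'\<ge>0. \<forall>i S. i + n \<le> n \<longrightarrow> finite S \<longrightarrow> card S \<le> n \<longrightarrow> bounded_hoelder B \<alpha> S (faa \<theta> g P n i S) K'"
    unfolding P_def
    by (rule faa_hb[where n = n and C = C and K = "b' * (1 + C)"])
       (use \<theta>hb C b'0 bounded_hoelder_slots[OF j] in auto)
  then obtain K where K: "0 \<le> K" "\<And>S. finite S \<Longrightarrow> card S \<le> n \<Longrightarrow> bounded_hoelder B \<alpha> S (faa \<theta> g P n 0 S) K"
    by auto
  have "jet B n \<alpha> K (\<lambda>x. \<theta> 0 (g x)) (\<lambda>k. faa \<theta> g P n 0 {..<k})"
    unfolding jet_def
  proof (intro conjI ballI allI impI)
    fix k x assume k: "k \<le> n" and x: "x \<in> B"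
    show "slotlin V {..<k} (faa \<theta> g P n 0 {..<k} x)"
      using k by (intro faa_slotlin[of n] Pl x) auto
    show "mbound V N k (faa \<theta> g P n 0 {..<k} x) K"
      using K(2)[of "{..<k}"] k x unfolding bounded_hoelder_def mbound_iff_sbound by auto
    fix y assume y: "y \<in> B"
    show "mbound V N k (\<lambda>vs. faa \<theta> g P n 0 {..<k} x vs - faa \<theta> g P n 0 {..<k} y vs) (K * N (x - y) powr \<alpha>)"
      using K(2)[of "{..<k}"] k x y unfolding bounded_hoelder_def mbound_iff_sbound by auto
  next
    fix k x vs h assume k: "k < n" and x: "x \<in> B" and h: "h \<in> V" and vs: "\<forall>i<k. vs i \<in> V"
    have "((\<lambda>t. faa \<theta> g P n 0 {..<k} (x + t *\<^sub>R h) vs) has_real_derivative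
        faa \<theta> g P n 0 (insert k {..<k}) x (vs(k := h))) (at 0)"
      using k x h vs BV by (intro faa_deriv[of P g x h n]) (auto intro!: P0 Pd Pl \<theta>)
    then show "((\<lambda>t. faa \<theta> g P n 0 {..<k} (x + t *\<^sub>R h) vs) has_real_derivative
        faa \<theta> g P n 0 {..<Suc k} x (vs(k := h))) (at 0)"
      by (simp add: lessThan_Suc)
  qed (use BV K in \<open>simp_all add: faa_empty\<close>)
  then show ?thesis by (rule that)
qed

end

subsection \<open>Localisation and extension of jets\<close>

text \<open>Away from 0 the function is locally zero or a monomial. At 0 the exponent is at least 2,
  so the difference quotient is at most \<open>\<bar>h\<bar> ^ (q + 1)\<close> and tends to
  0.\<close>

lemma DERIV_pos_part_power:
  "((\<lambda>t::real. (max 0 t) ^ (q + 2)) has_real_derivative real (q + 2) * (max 0 t) ^ (q + 1)) (at t)"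
proof -
  consider "t < 0" | "t > 0" | "t = 0" by linarith
  then show ?thesis
  proof cases
    case 1
    then have ev: "\<forall>\<^sub>F s in nhds t. (max 0 s) ^ (q + 2) = 0"
      by (auto intro!: eventually_mono[OF order_tendstoD(2)[OF tendsto_ident_at[of t UNIV, THEN tendsto_at_iff_tendsto_nhds[THEN iffD1]], of 0]])
    show ?thesis
      by (subst DERIV_cong_ev[OF refl ev refl]) (use 1 in simp)
  next
    case 2
    then have ev: "\<forall>\<^sub>F s in nhds t. (max 0 s) ^ (q + 2) = s ^ (q + 2)"
      by (auto intro!: eventually_mono[OF order_tendstoD(1)[OF tendsto_ident_at[of t UNIV, THEN tendsto_at_iff_tendsto_nhds[THEN iffD1]], of 0]])
    show ?thesis
      by (subst DERIV_cong_ev[OF refl ev refl]) (use 2 DERIV_pow[of "q + 2" t] in simp)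
  next
    case 3
    have "((\<lambda>h. (max 0 h) ^ (q + 2) / h) \<longlongrightarrow> 0) (at (0::real))"
    proof (rule Lim_null_comparison)
      show "((\<lambda>h. \<bar>h\<bar> ^ (q + 1)) \<longlongrightarrow> 0) (at (0::real))"
        by (auto intro!: tendsto_eq_intros)
      have "norm ((max 0 h) ^ (q + 2) / h) \<le> \<bar>h\<bar> ^ (q + 1)" for h :: real
      proof (cases "h \<le> 0")
        case False
        then show ?thesis by (simp add: max_def)
      next
        case True
        then have "(max 0 h) ^ (q + 2) = 0" by simp
        then show ?thesis by (simp only: div_0 norm_zero zero_le_power abs_ge_zero)
      qed
      then show "\<forall>\<^sub>F h in at 0. norm ((max 0 h) ^ (q + 2) / h) \<le> \<bar>h\<bar> ^ (q + 1)" for h :: real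
        by simp
    qed
    then show ?thesis using 3 by (simp add: DERIV_def)
  qed
qed

lemma derivs_uptoD:
  assumes "derivs_upto V N g n D"
  shows "x \<in> V \<Longrightarrow> D 0 x vs = g x"
    "k \<le> n \<Longrightarrow> x \<in> V \<Longrightarrow> mlin V N k (D k x)"
    "k < n \<Longrightarrow> x \<in> V \<Longrightarrow> 0 < \<epsilon> \<Longrightarrow> \<exists>\<delta>>0. \<forall>h\<in>V. N h < \<delta> \<longrightarrow>
        mbound V N k (\<lambda>vs. D k (x + h) vs - D k x vs - D (Suc k) x (vs(k := h))) (\<epsilon> * N h)"
  using assms unfolding derivs_upto_def by (simp_all add: Ball_def)

context seminormed
begin

text \<open>The cut-off used throughout: the result vanishes where \<open>a + b * g x\<close> is not
  positive. After n + 1 differentiations one factor of the positive part is left, so the last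
  derivative is still continuous, as \<open>jet_compose\<close> requires.\<close>

lemma jet_pos_part_power:
  assumes "jet B n \<alpha> C g D"
  obtains C' E where "jet B n \<alpha> C' (\<lambda>x. (max 0 (a + b * g x)) ^ (n + 2)) E"
proof -
  \<comment> \<open>The j-th derivative: the inner derivative \<open>b\<close> to the power j times
    a falling factorial of n + 2.\<close>
  define \<theta> where "\<theta> = (\<lambda>j t. b ^ j * (\<Prod>i<j. real (n + 2 - i)) * (max 0 (a + b * t)) ^ (n + 2 - j))"
  have "jet B n \<alpha> C g D" by fact
  moreover have "(\<theta> j has_real_derivative \<theta> (Suc j) t) (at t)" if "j \<le> n" for j t
  proof -
    define q where "q = n - j"
    have q: "n + 2 - j = q + 2" "n + 2 - Suc j = q + 1" using that by (auto simp: q_def)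
    have "((\<lambda>t. a + b * t) has_real_derivative b) (at t)"
      by (auto intro!: derivative_eq_intros)
    from DERIV_chain2[OF DERIV_pos_part_power[of q "a + b * t"] this]
    have "((\<lambda>t. (max 0 (a + b * t)) ^ (q + 2)) has_real_derivative
       (real (q + 2) * (max 0 (a + b * t)) ^ (q + 1)) * b) (at t)" .
    from DERIV_cmult[OF this, of "b ^ j * (\<Prod>i<j. real (n + 2 - i))"]
    moreover have "real (n + 2 - j) = real (q + 2)" by (simp only: q)
    ultimately show ?thesis
      unfolding \<theta>_def q prod.lessThan_Suc by (simp only: power_Suc mult_ac)
  qed
  moreover have "continuous_on UNIV (\<theta> (Suc n))"
    unfolding \<theta>_def by (intro continuous_intros)
  ultimately obtain C' E where "jet B n \<alpha> C' (\<lambda>x. \<theta> 0 (g x)) E"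
    by (rule jet_compose)
  then show ?thesis by (intro that) (simp add: \<theta>_def)
qed

section \<open>Jets on balls and their extension to the whole space\<close>

lemma N_line_tendsto:
  assumes "x \<in> V" "h \<in> V"
  shows "((\<lambda>t. N (x + t *\<^sub>R h)) \<longlongrightarrow> N x) (nhds 0)"
proof -
  have "((\<lambda>t. N (x + t *\<^sub>R h) - N x) \<longlongrightarrow> 0) (nhds 0)"
  proof (rule Lim_null_comparison)
    show "\<forall>\<^sub>F t in nhds 0. norm (N (x + t *\<^sub>R h) - N x) \<le> \<bar>t\<bar> * N h"
    proof (intro always_eventually allI)
      fix t
      have "N (x + t *\<^sub>R h) \<le> N x + \<bar>t\<bar> * N h"
        using triangle[of x "t *\<^sub>R h"] assms by (simp add: scale)
      moreover have "N x \<le> N (x + t *\<^sub>R h) + \<bar>t\<bar> * N h"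
        using triangle[of "x + t *\<^sub>R h" "(- t) *\<^sub>R h"] scale[of h "- t"] assms by simp
      ultimately show "norm (N (x + t *\<^sub>R h) - N x) \<le> \<bar>t\<bar> * N h" by (simp add: abs_le_iff)
    qed
    have "((\<lambda>t::real. t) \<longlongrightarrow> 0) (nhds 0)" by (simp add: filterlim_def)
    from tendsto_mult[OF tendsto_rabs[OF this] tendsto_const[of "N h"]]
    show "((\<lambda>t. \<bar>t\<bar> * N h) \<longlongrightarrow> 0) (nhds 0)" by simp
  qed
  then show ?thesis by (rule Lim_null[THEN iffD2])
qed

definition nball :: "'a \<Rightarrow> real \<Rightarrow> 'a set" where
  "nball c \<rho> = {x \<in> V. N (x - c) < \<rho>}"

lemma eventually_line_nball:
  assumes "x \<in> V" "h \<in> V" "c \<in> V" "N (x - c) < \<rho>"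
  shows "\<forall>\<^sub>F t in nhds 0. N (x + t *\<^sub>R h - c) < \<rho>"
  using order_tendstoD(2)[OF N_line_tendsto[of "x - c" h] assms(4)] assms
  by (simp add: algebra_simps)

lemma eventually_line_outside:
  assumes "x \<in> V" "h \<in> V" "c \<in> V" "\<rho> < N (x - c)"
  shows "\<forall>\<^sub>F t in nhds 0. \<rho> < N (x + t *\<^sub>R h - c)"
  using order_tendstoD(1)[OF N_line_tendsto[of "x - c" h] assms(4)] assms
  by (simp add: algebra_simps)

lemma nball_segment:
  assumes "x \<in> nball c \<rho>" "x + h \<in> nball c \<rho>" "c \<in> V" "h \<in> V" "0 \<le> t" "t \<le> 1"
  shows "x + t *\<^sub>R h \<in> nball c \<rho>"
proof -
  have x: "x \<in> V" using assms by (simp add: nball_def)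
  have "x + t *\<^sub>R h - c = (1 - t) *\<^sub>R (x - c) + t *\<^sub>R (x + h - c)"
    by (simp add: algebra_simps)
  also have "N \<dots> \<le> (1 - t) * N (x - c) + t * N (x + h - c)"
    using triangle[of "(1 - t) *\<^sub>R (x - c)" "t *\<^sub>R (x + h - c)"] x assms(3-) by (simp add: scale)
  also have "\<dots> < \<rho>"
    using convex_bound_lt[of "N (x - c)" \<rho> "N (x + h - c)" "1 - t" t] assms by (simp add: nball_def)
  finally show ?thesis using x assms by (simp add: nball_def)
qed

lemma derivs_upto_line:
  assumes d: "derivs_upto V N g n D" and k: "k < n" and x: "x \<in> V" and h: "h \<in> V"
    and vs: "\<And>i. i < k \<Longrightarrow> vs i \<in> V"
  shows "((\<lambda>t. D k (x + t *\<^sub>R h) vs) has_real_derivative D (Suc k) x (vs(k := h))) (at 0)"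
  unfolding DERIV_def
proof (rule LIM_I)
  fix \<epsilon> :: real assume e: "0 < \<epsilon>"
  define pr where "pr = (\<Prod>i<k. N (vs i))"
  have pr: "0 \<le> N h * pr" unfolding pr_def using vs h by (intro mult_nonneg_nonneg N_prod_nonneg nonneg) auto
  \<comment> \<open>Absorbs the factor \<open>N h * pr\<close> of the remainder; the summand 1 keeps
    the denominator positive.\<close>
  define \<epsilon>' where "\<epsilon>' = \<epsilon> / (N h * pr + 1)"
  have e': "0 < \<epsilon>'" "\<epsilon>' * (N h * pr) < \<epsilon>" using e pr by (auto simp: \<epsilon>'_def field_simps)
  obtain \<delta> where \<delta>: "\<delta> > 0" "\<And>h. h \<in> V \<Longrightarrow> N h < \<delta> \<Longrightarrow>
      mbound V N k (\<lambda>vs. D k (x + h) vs - D k x vs - D (Suc k) x (vs(k := h))) (\<epsilon>' * N h)"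
    using derivs_uptoD(3)[OF d k x e'(1)] by auto
  have sl: "slotlin V {..<Suc k} (D (Suc k) x)"
    using derivs_uptoD(2)[OF d _ x, of "Suc k"] k unfolding mlin_iff_slotlin by auto
  have "norm ((D k (x + (0 + t) *\<^sub>R h) vs - D k (x + 0 *\<^sub>R h) vs) / t - D (Suc k) x (vs(k := h))) < \<epsilon>"
    if t: "t \<noteq> 0" "norm (t - 0) < \<delta> / (N h + 1)" for t
  proof -
    have "\<bar>t\<bar> * (N h + 1) < \<delta>" using t nonneg[OF h] by (simp add: pos_less_divide_eq)
    then have "N (t *\<^sub>R h) < \<delta>" using scale[OF h, of t] by (simp add: distrib_left)
    then have "\<bar>D k (x + t *\<^sub>R h) vs - D k x vs - D (Suc k) x (vs(k := t *\<^sub>R h))\<bar> \<le> \<epsilon>' * N (t *\<^sub>R h) * pr"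
      unfolding pr_def using vs h by (intro mboundD[OF \<delta>(2)]) auto
    moreover have "D (Suc k) x (vs(k := t *\<^sub>R h)) = t * D (Suc k) x (vs(k := h))"
    proof -
      \<comment> \<open>Slot k of \<open>vs\<close> may hold a vector outside \<open>V\<close>. It
        is overwritten anyway, so it is set to 0 before linearity is used.\<close>
      have "D (Suc k) x ((vs(k := 0))(k := t *\<^sub>R h)) = t * D (Suc k) x ((vs(k := 0))(k := h))"
        by (rule slotlin_scale[OF sl]) (use vs h in \<open>auto simp: less_Suc_eq\<close>)
      then show ?thesis by simp
    qed
    ultimately have *: "\<bar>D k (x + t *\<^sub>R h) vs - D k x vs - t * D (Suc k) x (vs(k := h))\<bar> \<le> \<bar>t\<bar> * (\<epsilon>' * (N h * pr))"
      using scale[OF h, of t] by (simp add: mult_ac)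
    have "(D k (x + t *\<^sub>R h) vs - D k x vs) / t - D (Suc k) x (vs(k := h))
        = (D k (x + t *\<^sub>R h) vs - D k x vs - t * D (Suc k) x (vs(k := h))) / t"
      using t by (simp add: field_simps)
    also have "\<bar>\<dots>\<bar> \<le> \<epsilon>' * (N h * pr)"
      using * t by (simp add: divide_le_eq mult_ac)
    finally show ?thesis using e' by simp
  qed
  moreover have "\<delta> / (N h + 1) > 0" using \<delta> nonneg[OF h] by simp
  ultimately show "\<exists>s>0. \<forall>t. t \<noteq> 0 \<and> norm (t - 0) < s \<longrightarrow>
      norm ((D k (x + (0 + t) *\<^sub>R h) vs - D k (x + 0 *\<^sub>R h) vs) / t - D (Suc k) x (vs(k := h))) < \<epsilon>"
    by blast
qed

lemma derivs_upto_ball_lipschitz: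
  assumes d: "derivs_upto V N g n D" and k: "k < n" and c: "c \<in> V"
    and K: "\<And>z. z \<in> nball c \<rho> \<Longrightarrow> mbound V N (Suc k) (D (Suc k) z) K"
    and x: "x \<in> nball c \<rho>" and y: "y \<in> nball c \<rho>"
  shows "mbound V N k (\<lambda>vs. D k x vs - D k y vs) (K * N (x - y))"
  unfolding mbound_def
proof (intro allI impI)
  fix vs assume vs: "\<forall>i<k. vs i \<in> V"
  have xy: "x \<in> V" "y \<in> V" using x y by (auto simp: nball_def)
  have seg: "y + t *\<^sub>R (x - y) \<in> nball c \<rho>" if "0 \<le> t" "t \<le> 1" for t
    using nball_segment[OF y _ c _ that, of "x - y"] x xy by simp
  obtain t where t: "0 < t" "t < 1"
    "D k (y + (x - y)) vs - D k y vs = D (Suc k) (y + t *\<^sub>R (x - y)) (vs(k := x - y))"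
  proof (rule segment_mvt[of "\<lambda>z. D k z vs" y "x - y" "\<lambda>z. D (Suc k) z (vs(k := x - y))"])
    show "((\<lambda>s. D k (y + t *\<^sub>R (x - y) + s *\<^sub>R (x - y)) vs) has_real_derivative
        D (Suc k) (y + t *\<^sub>R (x - y)) (vs(k := x - y))) (at 0)" if "0 \<le> t" "t \<le> 1" for t
      using vs xy by (intro derivs_upto_line[OF d k]) auto
  qed
  have "\<bar>D (Suc k) (y + t *\<^sub>R (x - y)) (vs(k := x - y))\<bar> \<le> K * (\<Prod>i<Suc k. N ((vs(k := x - y)) i))"
    using vs xy t by (intro mboundD[OF K] seg) (auto simp: less_Suc_eq)
  then show "\<bar>D k x vs - D k y vs\<bar> \<le> K * N (x - y) * (\<Prod>i<k. N (vs i))"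
    using t(3) by (simp only: prod_fun_upd) (simp add: mult_ac)
qed

text \<open>Works downwards from level n. The Hoelder bound on a ball bounds \<open>D n\<close>
  through its value at the centre; a bound for \<open>D (Suc k)\<close> makes \<open>D k\<close>
  Lipschitz on the convex ball, hence bounded; and on a bounded set Lipschitz implies Hoelder
  because \<alpha> \<le> 1.\<close>

lemma jet_ball:
  assumes d: "derivs_upto V N g n D" and c: "c \<in> V" and \<rho>: "0 < \<rho>" and \<alpha>: "0 < \<alpha>" "\<alpha> \<le> 1"
    and H: "\<And>y z. y \<in> nball c \<rho> \<Longrightarrow> z \<in> nball c \<rho> \<Longrightarrow>
      mbound V N n (\<lambda>vs. D n y vs - D n z vs) (M * N (y - z) powr \<alpha>)"
  obtains C where "jet (nball c \<rho>) n \<alpha> C g D"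
proof -
  have D0: "\<And>k x. k \<le> n \<Longrightarrow> x \<in> V \<Longrightarrow> mlin V N k (D k x)"
    by (rule derivs_uptoD(2)[OF d])
  have cB: "c \<in> nball c \<rho>" using c \<rho> by (simp add: nball_def)
  have from_center: "mbound V N k (D k x) (K + L)"
    if "mbound V N k (D k c) K" "mbound V N k (\<lambda>vs. D k x vs - D k c vs) L" for k x K L
    unfolding mbound_def
  proof (intro allI impI)
    fix vs assume "\<forall>i<k. vs i \<in> V"
    then have "\<bar>D k c vs\<bar> \<le> K * (\<Prod>i<k. N (vs i))" "\<bar>D k x vs - D k c vs\<bar> \<le> L * (\<Prod>i<k. N (vs i))"
      using that unfolding mbound_def by auto
    then show "\<bar>D k x vs\<bar> \<le> (K + L) * (\<Prod>i<k. N (vs i))" by (simp add: distrib_right)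
  qed
  \<comment> \<open>Induction on i = n - k, so that the top level comes first.\<close>
  have bound: "i \<le> n \<Longrightarrow> \<exists>K\<ge>0. \<forall>x\<in>nball c \<rho>. mbound V N (n - i) (D (n - i) x) K" for i
  proof (induction i)
    case 0
    obtain K where K: "mbound V N n (D n c) K"
      using D0[of n c] c unfolding mlin_iff_slotlin by auto
    have "mbound V N n (D n x) (\<bar>K\<bar> + \<bar>M\<bar> * \<rho> powr \<alpha>)" if x: "x \<in> nball c \<rho>" for x
    proof (rule from_center)
      show "mbound V N n (D n c) \<bar>K\<bar>" by (rule mbound_mono[OF K]) simp
      have "M * N (x - c) powr \<alpha> \<le> \<bar>M\<bar> * \<rho> powr \<alpha>"
        using x c \<alpha> nonneg[of "x - c"] by (intro mult_mono powr_mono2) (auto simp: nball_def)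
      then show "mbound V N n (\<lambda>vs. D n x vs - D n c vs) (\<bar>M\<bar> * \<rho> powr \<alpha>)"
        by (rule mbound_mono[OF H[OF x cB]])
    qed
    then show ?case by (intro exI[of _ "\<bar>K\<bar> + \<bar>M\<bar> * \<rho> powr \<alpha>"]) auto
  next
    case (Suc i)
    define k where "k = n - Suc i"
    have k: "k < n" "n - i = Suc k" using Suc.prems by (auto simp: k_def)
    obtain K where K: "0 \<le> K" "\<And>x. x \<in> nball c \<rho> \<Longrightarrow> mbound V N (Suc k) (D (Suc k) x) K"
      using Suc k by auto
    obtain K' where K': "mbound V N k (D k c) K'"
      using D0[of k c] c k unfolding mlin_iff_slotlin by auto
    have "mbound V N k (D k x) (\<bar>K'\<bar> + K * \<rho>)" if x: "x \<in> nball c \<rho>" for x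
    proof (rule from_center)
      show "mbound V N k (D k c) \<bar>K'\<bar>" by (rule mbound_mono[OF K']) simp
      have "K * N (x - c) \<le> K * \<rho>" using x K by (intro mult_left_mono) (auto simp: nball_def)
      moreover have "mbound V N k (\<lambda>vs. D k x vs - D k c vs) (K * N (x - c))"
        by (rule derivs_upto_ball_lipschitz[OF d k(1) c _ x cB]) (rule K(2))
      ultimately show "mbound V N k (\<lambda>vs. D k x vs - D k c vs) (K * \<rho>)"
        by (rule mbound_mono[rotated])
    qed
    then show ?case unfolding k_def[symmetric]
      using K \<rho> by (intro exI[of _ "\<bar>K'\<bar> + K * \<rho>"]) auto
  qed
  have "\<exists>K\<ge>0. \<forall>x\<in>nball c \<rho>. mbound V N k (D k x) K" if "k \<le> n" for k
    using bound[of "n - k"] that by simp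
  then obtain K where K: "\<And>k. k \<le> n \<Longrightarrow> 0 \<le> K k"
    "\<And>k x. k \<le> n \<Longrightarrow> x \<in> nball c \<rho> \<Longrightarrow> mbound V N k (D k x) (K k)"
    by metis
  define K' where "K' = (\<Sum>k\<le>n. K k)"
  have K': "K k \<le> K'" if "k \<le> n" for k
    unfolding K'_def using that K by (intro member_le_sum) auto
  have K'0: "0 \<le> K'" using K(1)[of 0] K'[of 0] by linarith
  \<comment> \<open>The parts serve the Hoelder bound at level n, the bounds at all levels, and the
    passage from Lipschitz to Hoelder at distances below \<open>2 * \<rho>\<close>.\<close>
  define C where "C = \<bar>M\<bar> + K' * (1 + (2 * \<rho>) powr (1 - \<alpha>))"
  have C: "\<bar>M\<bar> \<le> C" "K' \<le> C" "K' * (2 * \<rho>) powr (1 - \<alpha>) \<le> C"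
    using K'0 by (auto simp: C_def distrib_left)
  have "jet (nball c \<rho>) n \<alpha> C g D"
    unfolding jet_def
  proof (intro conjI ballI allI impI)
    show "nball c \<rho> \<subseteq> V" by (auto simp: nball_def)
    show "0 \<le> C" using C by linarith
    show "D 0 x vs = g x" if "x \<in> V" for x vs by (rule derivs_uptoD(1)[OF d that])
    fix k x assume k: "k \<le> n" and x: "x \<in> nball c \<rho>"
    show "slotlin V {..<k} (D k x)" using D0[OF k, of x] x by (auto simp: mlin_iff_slotlin nball_def)
    show "mbound V N k (D k x) C"
      using K' K k x C by (meson mbound_mono order_trans)
    fix y assume y: "y \<in> nball c \<rho>"
    have xy: "x \<in> V" "y \<in> V" using x y by (auto simp: nball_def)
    show "mbound V N k (\<lambda>vs. D k x vs - D k y vs) (C * N (x - y) powr \<alpha>)"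
    proof (cases "k = n")
      case True
      have "M * N (x - y) powr \<alpha> \<le> C * N (x - y) powr \<alpha>" using C by (intro mult_right_mono) auto
      then show ?thesis using mbound_mono[OF H[OF x y]] True by simp
    next
      case False
      then have k: "k < n" using k by simp
      have "K (Suc k) \<le> K'" using k by (intro K') simp
      then have "mbound V N k (\<lambda>vs. D k x vs - D k y vs) (K' * N (x - y))"
        using k by (intro derivs_upto_ball_lipschitz[OF d k c _ x y] mbound_mono[OF K(2)]) auto
      moreover have "K' * N (x - y) \<le> C * N (x - y) powr \<alpha>"
      proof (cases "N (x - y) = 0")
        case True
        then show ?thesis by simp
      next
        case False
        then have pos: "N (x - y) > 0" using nonneg[of "x - y"] xy by auto
        have "N (x - y) < 2 * \<rho>"
          using N_triangle3[of x c y] N_commute[of c y] x y c xy by (simp add: nball_def)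
        then have "N (x - y) powr (1 - \<alpha>) \<le> (2 * \<rho>) powr (1 - \<alpha>)"
          using pos \<alpha> by (intro powr_mono2) auto
        then have "K' * N (x - y) powr (1 - \<alpha>) \<le> C"
          using mult_left_mono[OF _ K'0] C(3) by fastforce
        then have "K' * N (x - y) powr (1 - \<alpha>) * N (x - y) powr \<alpha> \<le> C * N (x - y) powr \<alpha>"
          by (intro mult_right_mono) auto
        then show ?thesis using pos by (simp add: mult.assoc powr_add[symmetric])
      qed
      ultimately show ?thesis by (rule mbound_mono)
    qed
  next
    show "((\<lambda>t. D k (x + t *\<^sub>R h) vs) has_real_derivative D (Suc k) x (vs(k := h))) (at 0)"
      if "k < n" "x \<in> nball c \<rho>" "h \<in> V" "\<forall>i<k. vs i \<in> V" for k x vs h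
      using that by (intro derivs_upto_line[OF d]) (auto simp: nball_def)
  qed
  then show ?thesis by (rule that)
qed

text \<open>\<open>U\<close> is open along lines, so on each line through a point of
  \<open>U\<close> the function is constant near that point and its derivative is 0; the induction
  repeats this with the derivatives.\<close>

lemma jet_const_on:
  assumes j: "jet B n \<alpha> C g D" and U: "U \<subseteq> B"
    and op: "\<And>x h. x \<in> U \<Longrightarrow> h \<in> V \<Longrightarrow> \<forall>\<^sub>F t in nhds 0. x + t *\<^sub>R h \<in> U"
    and g: "\<And>x. x \<in> U \<Longrightarrow> g x = \<kappa>"
  shows "Suc k \<le> n \<Longrightarrow> x \<in> U \<Longrightarrow> (\<And>i. i < Suc k \<Longrightarrow> vs i \<in> V) \<Longrightarrow> D (Suc k) x vs = 0"
proof (induction k arbitrary: x vs)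
  case (0 x vs)
  \<comment> \<open>The direction is the content of slot 0 itself, so the update
    \<open>vs(0 := vs 0)\<close> is just \<open>vs\<close>.\<close>
  have "((\<lambda>t. D 0 (x + t *\<^sub>R vs 0) vs) has_real_derivative D (Suc 0) x (vs(0 := vs 0))) (at 0)"
    using 0 U by (intro jetD(7)[OF j]) auto
  moreover have ev: "\<forall>\<^sub>F t in nhds 0. D 0 (x + t *\<^sub>R vs 0) vs = \<kappa>"
    using op[OF 0(2), of "vs 0"] 0(3)[of 0] U jetD(1)[OF j]
    by (auto elim!: eventually_mono simp: jetD(3)[OF j] g subset_iff)
  then have "((\<lambda>t. D 0 (x + t *\<^sub>R vs 0) vs) has_real_derivative 0) (at 0)"
    by (subst DERIV_cong_ev[OF refl ev refl]) simp
  ultimately show ?case using DERIV_unique by fastforce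
next
  case (Suc k x vs)
  have "((\<lambda>t. D (Suc k) (x + t *\<^sub>R vs (Suc k)) vs) has_real_derivative
      D (Suc (Suc k)) x (vs(Suc k := vs (Suc k)))) (at 0)"
    using Suc.prems U by (intro jetD(7)[OF j]) auto
  moreover have ev: "\<forall>\<^sub>F t in nhds 0. D (Suc k) (x + t *\<^sub>R vs (Suc k)) vs = 0"
    using op[OF Suc.prems(2), of "vs (Suc k)"] Suc.prems
    by (auto elim!: eventually_mono intro!: Suc.IH)
  then have "((\<lambda>t. D (Suc k) (x + t *\<^sub>R vs (Suc k)) vs) has_real_derivative 0) (at 0)"
    by (subst DERIV_cong_ev[OF refl ev refl]) simp
  ultimately show ?case using DERIV_unique by fastforce
qed

text \<open>The derivatives vanish where \<open>\<rho> / 2 < N (x - c)\<close>, so continuing them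
  by 0 across the sphere of radius \<rho> creates no jump. For the Hoelder bound between a point
  inside and one outside, either the inner point lies in the annulus and the two values agree, or
  the points are at least \<rho> / 2 apart and boundedness suffices.\<close>

lemma jet_extend:
  assumes j: "jet (nball c \<rho>) n \<alpha> C f E" and c: "c \<in> V" and \<rho>: "0 < \<rho>" and \<alpha>: "0 < \<alpha>"
    and f: "\<And>x. x \<in> V \<Longrightarrow> \<rho> / 2 \<le> N (x - c) \<Longrightarrow> f x = \<kappa>"
  obtains C' E' where "jet V n \<alpha> C' f E'"
proof -
  \<comment> \<open>Level 0 keeps \<open>E 0\<close>, which equals \<open>f\<close> on all of
    \<open>V\<close>; only the higher levels are set to 0 outside the ball.\<close>
  define E' where "E' = (\<lambda>k x vs. if k = 0 \<or> N (x - c) < \<rho> then E k x vs else 0)"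
  note C = jetD(2)[OF j]
  have in_ball: "x \<in> nball c \<rho> \<longleftrightarrow> x \<in> V \<and> N (x - c) < \<rho>" for x by (auto simp: nball_def)
  have zero: "E' (Suc k) x vs = 0"
    if "Suc k \<le> n" "x \<in> V" "\<rho> / 2 < N (x - c)" "\<And>i. i < Suc k \<Longrightarrow> vs i \<in> V" for k x vs
  proof (cases "N (x - c) < \<rho>")
    case True
    have "E (Suc k) x vs = 0"
    proof (rule jet_const_on[OF j, where U = "{x \<in> nball c \<rho>. \<rho> / 2 < N (x - c)}" and \<kappa> = \<kappa>])
      fix y h assume "y \<in> {x \<in> nball c \<rho>. \<rho> / 2 < N (x - c)}" "h \<in> V"
      then have ev: "\<forall>\<^sub>F t in nhds 0. N (y + t *\<^sub>R h - c) < \<rho>" "\<forall>\<^sub>F t in nhds 0. \<rho> / 2 < N (y + t *\<^sub>R h - c)"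
        and yh: "y \<in> V" "h \<in> V"
        using c eventually_line_nball[of y h c \<rho>] eventually_line_outside[of y h c "\<rho> / 2"]
        by (simp_all add: in_ball)
      from ev show "\<forall>\<^sub>F t in nhds 0. y + t *\<^sub>R h \<in> {x \<in> nball c \<rho>. \<rho> / 2 < N (x - c)}"
        by eventually_elim (use yh in \<open>auto simp: in_ball\<close>)
    qed (use that True f in \<open>auto simp: in_ball\<close>)
    then show ?thesis by (simp add: E'_def)
  qed (simp add: E'_def)
  have E'0: "E' 0 x vs = f x" if "x \<in> V" for x vs
    using jetD(3)[OF j that] by (simp add: E'_def)
  \<comment> \<open>\<open>C\<close> bounds the jet inside the ball,
    \<open>\<bar>\<kappa>\<bar>\<close> the value outside.\<close>
  define C1 where "C1 = C + \<bar>\<kappa>\<bar>"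
  have C1: "0 \<le> C1" "C \<le> C1" "\<bar>\<kappa>\<bar> \<le> C1" using C by (auto simp: C1_def)
  have bd: "\<bar>E' k x vs\<bar> \<le> C1 * (\<Prod>i<k. N (vs i))" if "k \<le> n" "x \<in> V" "\<And>i. i < k \<Longrightarrow> vs i \<in> V" for k x vs
  proof (cases "N (x - c) < \<rho>")
    case True
    then have "mbound V N k (E k x) C1"
      using that C1 by (intro mbound_mono[OF jetD(5)[OF j]]) (auto simp: in_ball)
    then show ?thesis using mboundD[of V N k _ C1 vs] that True by (simp add: E'_def)
  next
    case False
    moreover have "0 \<le> C1 * (\<Prod>i<k. N (vs i))"
      using C1 that by (intro mult_nonneg_nonneg N_prod_nonneg) auto
    ultimately show ?thesis using f[of x] \<rho> that C1 E'0[of x vs] zero[of "k - 1" x vs]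
      by (cases k) auto
  qed
  \<comment> \<open>Makes \<open>q * d powr \<alpha>\<close> at least 1 for every distance d from
    \<rho> / 2 on, which converts a bound into a Hoelder bound.\<close>
  define q where "q = (2 / \<rho>) powr \<alpha>"
  have q: "1 \<le> q * d powr \<alpha>" if "\<rho> / 2 \<le> d" for d
  proof -
    have "1 \<le> 2 / \<rho> * d" using that \<rho> by (simp add: field_simps)
    with \<rho> have "1 \<le> (2 / \<rho> * d) powr \<alpha>" using \<alpha> by (simp add: ge_one_powr_ge_zero)
    also have "(2 / \<rho> * d) powr \<alpha> = q * d powr \<alpha>"
      unfolding q_def by (rule powr_mult)
    finally show ?thesis .
  qed
  have q0: "0 \<le> q" by (simp add: q_def)
  define C' where "C' = C1 + 2 * C1 * q"
  have "0 \<le> C1 * q" using C1 q0 by simp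
  then have C': "C1 \<le> C'" "2 * C1 * q \<le> C'" "C \<le> C'" using C1 by (simp_all add: C'_def)
  have C'0: "0 \<le> C' * d powr \<alpha> * (\<Prod>i<k. N (vs i))" if "\<And>i. i < k \<Longrightarrow> vs i \<in> V" for d k vs
    using that C1 C' by (intro mult_nonneg_nonneg N_prod_nonneg) auto
  have mixed: "\<bar>E' k x vs - E' k y vs\<bar> \<le> C' * N (x - y) powr \<alpha> * (\<Prod>i<k. N (vs i))"
    if k: "k \<le> n" and xy: "x \<in> V" "y \<in> V" and x: "N (x - c) < \<rho>" and y: "\<not> N (y - c) < \<rho>"
      and vs: "\<And>i. i < k \<Longrightarrow> vs i \<in> V" for k x y vs
  proof (cases "N (x - c) \<le> \<rho> / 2")
    case True
    have P: "0 \<le> (\<Prod>i<k. N (vs i))" using vs by (intro N_prod_nonneg) auto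
    have "N (y - c) \<le> N (y - x) + N (x - c)" using N_triangle3[of y x c] xy c by simp
    then have "\<rho> / 2 \<le> N (x - y)" using True y N_commute[of x y] xy by simp
    then have "2 * C1 * 1 \<le> 2 * C1 * (q * N (x - y) powr \<alpha>)"
      using C1 by (intro mult_left_mono q) auto
    also have "\<dots> \<le> C' * N (x - y) powr \<alpha>"
      using C'(2) mult_right_mono[OF C'(2), of "N (x - y) powr \<alpha>"] by (simp add: mult_ac)
    finally have "2 * C1 * (\<Prod>i<k. N (vs i)) \<le> C' * N (x - y) powr \<alpha> * (\<Prod>i<k. N (vs i))"
      using P by (intro mult_right_mono) auto
    moreover have "\<bar>E' k x vs - E' k y vs\<bar> \<le> 2 * C1 * (\<Prod>i<k. N (vs i))"
      using bd[OF k xy(1), of vs] bd[OF k xy(2), of vs] vs by fastforce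
    ultimately show ?thesis by linarith
  next
    case False
    have "E' k x vs = E' k y vs"
    proof (cases k)
      case 0
      then show ?thesis using E'0 f[of x] f[of y] xy False y \<rho> by simp
    next
      case (Suc i)
      then show ?thesis using zero[of i x vs] zero[of i y vs] k xy False y \<rho> vs by simp
    qed
    then show ?thesis using C'0[of k vs] vs by simp
  qed
  have "jet V n \<alpha> C' f E'"
    unfolding jet_def
  proof (intro conjI ballI allI impI)
    show "0 \<le> C'" using C1 C' by linarith
    fix k x assume k: "k \<le> n" and x: "x \<in> V"
    show "slotlin V {..<k} (E' k x)"
    proof (cases "k = 0 \<or> N (x - c) < \<rho>")
      case True
      then have "k = 0 \<or> x \<in> nball c \<rho>" using x by (simp add: in_ball)
      moreover have "slotlin V {..<k} (E' k x)" if "k = 0"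
      proof -
        have "E' k x = (\<lambda>_. f x)" using E'0 x that by auto
        then show ?thesis using that by (simp add: slotlin_const)
      qed
      moreover have "slotlin V {..<k} (E' k x)" if "x \<in> nball c \<rho>"
      proof -
        have "E' k x = E k x" using that by (simp add: E'_def in_ball fun_eq_iff)
        then show ?thesis using jetD(4)[OF j k that] by simp
      qed
      ultimately show ?thesis by blast
    next
      case False
      then have "E' k x = (\<lambda>_. 0)" by (auto simp: E'_def)
      then show ?thesis by (simp add: slotlin_zero)
    qed
    show "mbound V N k (E' k x) C'"
      using bd[OF k x] by (intro mbound_mono[OF _ C'(1)]) (simp add: mbound_def)
    fix y assume y: "y \<in> V"
    show "mbound V N k (\<lambda>vs. E' k x vs - E' k y vs) (C' * N (x - y) powr \<alpha>)"
      unfolding mbound_def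
    proof (intro allI impI)
      fix vs assume vs: "\<forall>i<k. vs i \<in> V"
      consider "N (x - c) < \<rho>" "N (y - c) < \<rho>" | "N (x - c) < \<rho>" "\<not> N (y - c) < \<rho>"
        | "\<not> N (x - c) < \<rho>" "N (y - c) < \<rho>" | "\<not> N (x - c) < \<rho>" "\<not> N (y - c) < \<rho>" by blast
      then show "\<bar>E' k x vs - E' k y vs\<bar> \<le> C' * N (x - y) powr \<alpha> * (\<Prod>i<k. N (vs i))"
      proof cases
        case 1
        have "C * N (x - y) powr \<alpha> \<le> C' * N (x - y) powr \<alpha>"
          using C'(3) by (intro mult_right_mono) auto
        then have "mbound V N k (\<lambda>vs. E k x vs - E k y vs) (C' * N (x - y) powr \<alpha>)"
          using 1 x y k by (intro mbound_mono[OF jetD(6)[OF j]]) (auto simp: in_ball)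
        from mboundD[OF this, of vs] show ?thesis using vs 1 by (simp add: E'_def)
      next
        case 2
        then show ?thesis using mixed[OF k x y] vs by blast
      next
        case 3
        then show ?thesis using mixed[OF k y x] vs N_commute[OF x y] by (simp add: abs_minus_commute)
      next
        case 4
        have "E' k x vs = E' k y vs"
          using 4 E'0 f[of x] f[of y] x y \<rho> by (cases k) (auto simp: E'_def)
        then show ?thesis using C'0[of k vs] vs by simp
      qed
    qed
  next
    fix k x vs h assume k: "k < n" and x: "x \<in> V" and h: "h \<in> V" and vs: "\<forall>i<k. vs i \<in> V"
    show "((\<lambda>t. E' k (x + t *\<^sub>R h) vs) has_real_derivative E' (Suc k) x (vs(k := h))) (at 0)"
    proof (cases "N (x - c) < \<rho>")
      case True
      have ev: "\<forall>\<^sub>F t in nhds 0. E' k (x + t *\<^sub>R h) vs = E k (x + t *\<^sub>R h) vs"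
        using eventually_line_nball[OF x h c True] by eventually_elim (simp add: E'_def)
      show ?thesis
        using jetD(7)[OF j k _ h, of x vs] True x vs
        by (subst DERIV_cong_ev[OF refl ev refl]) (simp add: E'_def in_ball)
    next
      case False
      then have out: "\<rho> / 2 < N (x - c)" using \<rho> by simp
      have ev: "\<forall>\<^sub>F t in nhds 0. E' k (x + t *\<^sub>R h) vs = (if k = 0 then \<kappa> else 0)"
        using eventually_line_outside[OF x h c out]
      proof eventually_elim
        case (elim t)
        have "x + t *\<^sub>R h \<in> V" using x h by blast
        then show ?case using zero[of "k - 1" "x + t *\<^sub>R h" vs] E'0[of "x + t *\<^sub>R h"]
            f[of "x + t *\<^sub>R h"] elim k vs by (cases k) auto
      qed
      have "E' (Suc k) x (vs(k := h)) = 0" using False by (simp add: E'_def)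
      then show ?thesis by (subst DERIV_cong_ev[OF refl ev refl]) simp
    qed
  qed (use E'0 in simp_all)
  then show ?thesis by (rule that)
qed

lemma jet_diff:
  assumes j1: "jet B n \<alpha> C1 g1 D1" and j2: "jet B n \<alpha> C2 g2 D2"
  shows "jet B n \<alpha> (C1 + C2) (\<lambda>x. g1 x - g2 x) (\<lambda>k x vs. D1 k x vs - D2 k x vs)"
  unfolding jet_def
proof (intro conjI ballI allI impI)
  show "B \<subseteq> V" by (rule jetD(1)[OF j1])
  show "0 \<le> C1 + C2" using jetD(2)[OF j1] jetD(2)[OF j2] by simp
  show "D1 0 x vs - D2 0 x vs = g1 x - g2 x" if "x \<in> V" for x vs
    using jetD(3)[OF j1 that] jetD(3)[OF j2 that] by simp
  fix k x assume k: "k \<le> n" and x: "x \<in> B"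
  show "slotlin V {..<k} (\<lambda>vs. D1 k x vs - D2 k x vs)"
    by (intro slotlin_diff jetD(4)[OF j1 k x] jetD(4)[OF j2 k x])
  show "mbound V N k (\<lambda>vs. D1 k x vs - D2 k x vs) (C1 + C2)"
    unfolding mbound_def
  proof (intro allI impI)
    fix vs assume "\<forall>i<k. vs i \<in> V"
    then have "\<bar>D1 k x vs\<bar> \<le> C1 * (\<Prod>i<k. N (vs i))" "\<bar>D2 k x vs\<bar> \<le> C2 * (\<Prod>i<k. N (vs i))"
      using mboundD[OF jetD(5)[OF j1 k x]] mboundD[OF jetD(5)[OF j2 k x]] by auto
    then show "\<bar>D1 k x vs - D2 k x vs\<bar> \<le> (C1 + C2) * (\<Prod>i<k. N (vs i))"
      by (simp add: distrib_right)
  qed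
  fix y assume y: "y \<in> B"
  show "mbound V N k (\<lambda>vs. D1 k x vs - D2 k x vs - (D1 k y vs - D2 k y vs)) ((C1 + C2) * N (x - y) powr \<alpha>)"
    unfolding mbound_def
  proof (intro allI impI)
    fix vs assume "\<forall>i<k. vs i \<in> V"
    then have "\<bar>D1 k x vs - D1 k y vs\<bar> \<le> C1 * N (x - y) powr \<alpha> * (\<Prod>i<k. N (vs i))"
      "\<bar>D2 k x vs - D2 k y vs\<bar> \<le> C2 * N (x - y) powr \<alpha> * (\<Prod>i<k. N (vs i))"
      using mboundD[OF jetD(6)[OF j1 k x y]] mboundD[OF jetD(6)[OF j2 k x y]] by auto
    then show "\<bar>D1 k x vs - D2 k x vs - (D1 k y vs - D2 k y vs)\<bar>
        \<le> (C1 + C2) * N (x - y) powr \<alpha> * (\<Prod>i<k. N (vs i))"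
      by (simp add: distrib_right)
  qed
next
  fix k x vs h assume k: "k < n" and x: "x \<in> B" and h: "h \<in> V" and vs: "\<forall>i<k. vs i \<in> V"
  show "((\<lambda>t. D1 k (x + t *\<^sub>R h) vs - D2 k (x + t *\<^sub>R h) vs) has_real_derivative
      D1 (Suc k) x (vs(k := h)) - D2 (Suc k) x (vs(k := h))) (at 0)"
    using vs by (intro DERIV_diff jetD(7)[OF j1 k x h] jetD(7)[OF j2 k x h]) auto
qed

end

text \<open>Serves the translations and dilations of X as well as the isometric copies of X inside
  the Lebesgue-Bochner space. The power of \<open>1 + s\<close> dominates both \<open>s ^ k\<close>
  and \<open>s ^ k * s powr \<alpha>\<close> for k \<le> n.\<close>

lemma jet_pullback:
  fixes \<iota> :: "'b::real_vector \<Rightarrow> 'a::real_vector"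
  assumes V: "seminormed V N" and W: "seminormed W N'"
    and j: "seminormed.jet V N B n \<alpha> C g D"
    and lin: "\<And>a b x y. \<iota> (a *\<^sub>R x + b *\<^sub>R y) = a *\<^sub>R \<iota> x + b *\<^sub>R \<iota> y"
    and \<iota>: "\<And>x. x \<in> W \<Longrightarrow> \<iota> x \<in> V" "\<And>x. x \<in> W \<Longrightarrow> N (\<iota> x) = s * N' x" and s: "0 < s"
    and \<alpha>: "0 < \<alpha>" "\<alpha> \<le> 1" and c: "c \<in> V" and B': "B' \<subseteq> W" "\<And>x. x \<in> B' \<Longrightarrow> c + \<iota> x \<in> B"
  shows "seminormed.jet W N' B' n \<alpha> (C * (1 + s) ^ (n + 1)) (\<lambda>x. g (c + \<iota> x))
    (\<lambda>k x vs. D k (c + \<iota> x) (\<lambda>i. \<iota> (vs i)))"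
proof -
  interpret V: seminormed V N by (rule V)
  interpret W: seminormed W N' by (rule W)
  have add: "\<iota> (x + t *\<^sub>R h) = \<iota> x + t *\<^sub>R \<iota> h" for x h t using lin[of 1 x t h] by simp
  have sub: "\<iota> (x - y) = \<iota> x - \<iota> y" for x y using lin[of 1 x "-1" y] by simp
  have upd: "(\<lambda>i. \<iota> ((vs(k := h)) i)) = (\<lambda>i. \<iota> (vs i))(k := \<iota> h)" for vs k h by auto
  have C: "0 \<le> C" by (rule V.jetD(2)[OF j])
  have pr: "(\<Prod>i<k. N (\<iota> (vs i))) = s ^ k * (\<Prod>i<k. N' (vs i))" if "\<And>i. i < k \<Longrightarrow> vs i \<in> W" for k vs
    using that by (simp add: \<iota> prod.distrib)
  have sk: "s ^ k \<le> (1 + s) ^ n" if "k \<le> n" for k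
    using s that by (intro order_trans[OF power_mono[of s "1 + s"] power_increasing]) auto
  have sa: "s powr \<alpha> \<le> 1 + s"
    using s \<alpha> by (intro order_trans[OF powr_mono2[of \<alpha> s "1 + s"] order_trans[OF powr_mono[of \<alpha> 1]]]) auto
  show ?thesis
    unfolding W.jet_def
  proof (intro conjI ballI allI impI)
    show "B' \<subseteq> W" by fact
    show "0 \<le> C * (1 + s) ^ (n + 1)" using C s by simp
    show "D 0 (c + \<iota> x) (\<lambda>i. \<iota> (vs i)) = g (c + \<iota> x)" if "x \<in> W" for x vs
      using that c \<iota> by (intro V.jetD(3)[OF j]) auto
    fix k x assume k: "k \<le> n" and x: "x \<in> B'"
    note sl = V.jetD(4)[OF j k B'(2)[OF x]]
    show "slotlin W {..<k} (\<lambda>vs. D k (c + \<iota> x) (\<lambda>i. \<iota> (vs i)))"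
    proof (rule slotlinI)
      fix vs ws :: "nat \<Rightarrow> 'b" assume "\<And>i. i \<in> {..<k} \<Longrightarrow> vs i = ws i"
      then show "D k (c + \<iota> x) (\<lambda>i. \<iota> (vs i)) = D k (c + \<iota> x) (\<lambda>i. \<iota> (ws i))"
        by (intro slotlin_cong[OF sl]) auto
    next
      fix vs :: "nat \<Rightarrow> 'b" and i a b u w
      assume "i \<in> {..<k}" "\<And>j. j \<in> {..<k} \<Longrightarrow> vs j \<in> W" "u \<in> W" "w \<in> W"
      then show "D k (c + \<iota> x) (\<lambda>j. \<iota> ((vs(i := a *\<^sub>R u + b *\<^sub>R w)) j))
        = a * D k (c + \<iota> x) (\<lambda>j. \<iota> ((vs(i := u)) j)) + b * D k (c + \<iota> x) (\<lambda>j. \<iota> ((vs(i := w)) j))"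
        unfolding upd lin by (intro slotlin_lin[OF sl]) (auto simp: \<iota>)
    qed
    show "mbound W N' k (\<lambda>vs. D k (c + \<iota> x) (\<lambda>i. \<iota> (vs i))) (C * (1 + s) ^ (n + 1))"
      unfolding mbound_def
    proof (intro allI impI)
      fix vs assume vs: "\<forall>i<k. vs i \<in> W"
      have "\<bar>D k (c + \<iota> x) (\<lambda>i. \<iota> (vs i))\<bar> \<le> C * (\<Prod>i<k. N (\<iota> (vs i)))"
        using vs \<iota> by (intro mboundD[OF V.jetD(5)[OF j k B'(2)[OF x]]]) auto
      also have "\<dots> = C * s ^ k * (\<Prod>i<k. N' (vs i))" using pr vs by simp
      also have "\<dots> \<le> C * (1 + s) ^ (n + 1) * (\<Prod>i<k. N' (vs i))"
      proof (intro mult_right_mono mult_left_mono C W.N_prod_nonneg)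
        show "s ^ k \<le> (1 + s) ^ (n + 1)"
          using s by (intro order_trans[OF sk[OF k] power_increasing]) auto
      qed (use vs in auto)
      finally show "\<bar>D k (c + \<iota> x) (\<lambda>i. \<iota> (vs i))\<bar> \<le> C * (1 + s) ^ (n + 1) * (\<Prod>i<k. N' (vs i))" .
    qed
    fix y assume y: "y \<in> B'"
    show "mbound W N' k (\<lambda>vs. D k (c + \<iota> x) (\<lambda>i. \<iota> (vs i)) - D k (c + \<iota> y) (\<lambda>i. \<iota> (vs i)))
        (C * (1 + s) ^ (n + 1) * N' (x - y) powr \<alpha>)"
      unfolding mbound_def
    proof (intro allI impI)
      fix vs assume vs: "\<forall>i<k. vs i \<in> W"
      have xy: "x \<in> W" "y \<in> W" using x y B' by auto
      have d: "N (c + \<iota> x - (c + \<iota> y)) powr \<alpha> = s powr \<alpha> * N' (x - y) powr \<alpha>"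
        using s xy \<iota>(2)[of "x - y"] W.nonneg[of "x - y"] by (simp add: sub powr_mult)
      have "\<bar>D k (c + \<iota> x) (\<lambda>i. \<iota> (vs i)) - D k (c + \<iota> y) (\<lambda>i. \<iota> (vs i))\<bar>
          \<le> C * N (c + \<iota> x - (c + \<iota> y)) powr \<alpha> * (\<Prod>i<k. N (\<iota> (vs i)))"
        using vs \<iota> by (intro mboundD[OF V.jetD(6)[OF j k B'(2)[OF x] B'(2)[OF y]]]) auto
      also have "\<dots> = C * (s ^ k * s powr \<alpha>) * (N' (x - y) powr \<alpha> * (\<Prod>i<k. N' (vs i)))"
        using pr[of k vs] vs unfolding d by (simp add: mult_ac)
      also have "\<dots> \<le> C * (1 + s) ^ (n + 1) * (N' (x - y) powr \<alpha> * (\<Prod>i<k. N' (vs i)))"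
      proof (intro mult_right_mono mult_left_mono C mult_nonneg_nonneg W.N_prod_nonneg)
        show "s ^ k * s powr \<alpha> \<le> (1 + s) ^ (n + 1)"
          using mult_mono[OF sk[OF k] sa] s by (simp add: mult.commute)
      qed (use vs in auto)
      finally show "\<bar>D k (c + \<iota> x) (\<lambda>i. \<iota> (vs i)) - D k (c + \<iota> y) (\<lambda>i. \<iota> (vs i))\<bar>
          \<le> C * (1 + s) ^ (n + 1) * N' (x - y) powr \<alpha> * (\<Prod>i<k. N' (vs i))" by (simp add: mult_ac)
    qed
  next
    fix k x vs h assume k: "k < n" and x: "x \<in> B'" and h: "h \<in> W" and vs: "\<forall>i<k. vs i \<in> W"
    show "((\<lambda>t. D k (c + \<iota> (x + t *\<^sub>R h)) (\<lambda>i. \<iota> (vs i))) has_real_derivative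
        D (Suc k) (c + \<iota> x) (\<lambda>i. \<iota> ((vs(k := h)) i))) (at 0)"
      unfolding upd add add.assoc[symmetric]
      using vs h \<iota> by (intro V.jetD(7)[OF j k B'(2)[OF x]]) auto
  qed
qed

subsection \<open>The seminorm and Hoelder inequality of the Lebesgue--Bochner space\<close>

text \<open>Convexity of exp at the points \<open>p * ln (x i)\<close> with weights
  \<open>w i / p\<close>; a zero among the \<open>x i\<close> makes the left side 0.\<close>

lemma weighted_arith_geom_mean:
  fixes x w :: "'i \<Rightarrow> real"
  assumes fin: "finite I" and w: "\<And>i. i \<in> I \<Longrightarrow> 0 \<le> w i" "(\<Sum>i\<in>I. w i) = p" and p: "0 < p"
    and x: "\<And>i. i \<in> I \<Longrightarrow> 0 \<le> x i"
  shows "(\<Prod>i\<in>I. x i powr w i) \<le> (\<Sum>i\<in>I. w i / p * x i powr p)"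
proof (cases "\<exists>i\<in>I. x i = 0")
  case True
  then have "(\<Prod>i\<in>I. x i powr w i) = 0" using fin by (auto intro!: prod_zero)
  then show ?thesis using w p by (auto intro!: sum_nonneg)
next
  case False
  then have x: "0 < x i" if "i \<in> I" for i using x[OF that] that by force
  have "(\<Prod>i\<in>I. x i powr w i) = exp (\<Sum>i\<in>I. w i / p * (p * ln (x i)))"
  proof -
    have "(\<Prod>i\<in>I. x i powr w i) = (\<Prod>i\<in>I. exp (w i / p * (p * ln (x i))))"
      using x p by (intro prod.cong refl) (auto simp: powr_def dest!: x)
    then show ?thesis by (simp add: exp_sum[OF fin])
  qed
  also have "\<dots> \<le> (\<Sum>i\<in>I. w i / p * exp (p * ln (x i)))"
  proof -
    have "I \<noteq> {}" using w(2) p by auto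
    moreover have "(\<Sum>i\<in>I. w i / p) = 1" using w(2) p by (simp add: sum_divide_distrib[symmetric])
    ultimately show ?thesis
      using convex_on_sum[OF fin _ exp_convex, of "\<lambda>i. w i / p" "\<lambda>i. p * ln (x i)"] w(1) p by simp
  qed
  also have "\<dots> = (\<Sum>i\<in>I. w i / p * x i powr p)"
    using x by (intro sum.cong refl) (auto simp: powr_def dest!: x)
  finally show ?thesis .
qed

text \<open>Strong measurability speaks of limits almost everywhere, so in general it yields
  measurability only for the completed measure, in which changes inside a null set are
  harmless.\<close>

lemma AE_eq_measurable_completion:
  fixes f g :: "'s \<Rightarrow> 'x::topological_space"
  assumes f: "f \<in> borel_measurable (completion M)" and eq: "AE s in M. f s = g s"
  shows "g \<in> borel_measurable (completion M)"
proof (rule measurableI)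
  fix A :: "'x set" assume A: "A \<in> sets borel"
  obtain E where E: "E \<in> null_sets M" "{s \<in> space M. f s \<noteq> g s} \<subseteq> E"
    using eq by (auto elim!: AE_E)
  have E': "E \<in> sets (completion M)" using E by auto
  have "g -` A \<inter> space (completion M) = (f -` A \<inter> space (completion M) - E) \<union> (g -` A \<inter> space M \<inter> E)"
    using E by auto
  moreover have "g -` A \<inter> space M \<inter> E \<in> null_sets (completion M)"
    by (rule null_sets_completion_subset[of _ E]) (use E null_sets_completionI in auto)
  ultimately show "g -` A \<inter> space (completion M) \<in> sets (completion M)"
    using measurable_sets[OF f A] E' by (metis null_setsD2 sets.Diff sets.Un)
qed simp

text \<open>Bundling finitely many simple functions into one list-valued simple function lets a
  function of all of them be treated as a composition with a single map.\<close>

lemma simple_function_map: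
  assumes "\<And>i. i < m \<Longrightarrow> simple_function M (F i)"
  shows "simple_function M (\<lambda>s. map (\<lambda>i. F i s) [0..<m])"
  using assms
proof (induction m)
  case 0
  then show ?case by simp
next
  case (Suc m)
  have "simple_function M (\<lambda>s. map (\<lambda>i. F i s) [0..<m] @ [F m s])"
    using Suc by (intro simple_function_compose2[of M _ _ "\<lambda>xs x. xs @ [x]"]) auto
  then show ?case by simp
qed

text \<open>The range of the \<open>w i\<close> need not be separable, so joint measurability is obtained from the
  approximating simple functions and not from the product of the Borel algebras.\<close>

lemma strongly_measurable_compose:
  fixes \<Phi> :: "(nat \<Rightarrow> 'x::real_normed_vector) \<Rightarrow> 'y::real_normed_vector"
  assumes w: "\<And>i. i < m \<Longrightarrow> strongly_measurable M (w i)"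
    and \<Phi>: "\<And>a b. (\<And>i. i < m \<Longrightarrow> (\<lambda>j. a j i) \<longlonglongrightarrow> b i) \<Longrightarrow> (\<lambda>j. \<Phi> (a j)) \<longlonglongrightarrow> \<Phi> b"
  shows "strongly_measurable M (\<lambda>s. \<Phi> (\<lambda>i. w i s))"
proof -
  have "\<exists>F. \<forall>i<m. (\<forall>j. simple_function M (F i j)) \<and> (AE s in M. (\<lambda>j. F i j s) \<longlonglongrightarrow> w i s)"
    using w unfolding strongly_measurable_def by metis
  then obtain F where F: "\<And>i j. i < m \<Longrightarrow> simple_function M (F i j)"
    "\<And>i. i < m \<Longrightarrow> AE s in M. (\<lambda>j. F i j s) \<longlonglongrightarrow> w i s"
    by auto
  \<comment> \<open>Continuity along constant sequences already shows that \<open>\<Phi>\<close>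
    depends on its first m coordinates only.\<close>
  have cong: "\<Phi> a = \<Phi> b" if "\<And>i. i < m \<Longrightarrow> a i = b i" for a b
  proof -
    have "(\<lambda>j::nat. \<Phi> a) \<longlonglongrightarrow> \<Phi> b" by (rule \<Phi>) (simp add: that)
    then show ?thesis using LIMSEQ_unique by blast
  qed
  have "simple_function M (\<lambda>s. \<Phi> (\<lambda>i. F i j s))" for j
  proof -
    have "simple_function M (\<lambda>s. map (\<lambda>i. F i j s) [0..<m])"
      by (rule simple_function_map) (rule F(1))
    then have "simple_function M (\<lambda>s. \<Phi> (\<lambda>i. map (\<lambda>i. F i j s) [0..<m] ! i))"
      by (rule simple_function_compose1[where g = "\<lambda>xs. \<Phi> (\<lambda>i. xs ! i)"])
    moreover have "\<Phi> (\<lambda>i. map (\<lambda>i. F i j s) [0..<m] ! i) = \<Phi> (\<lambda>i. F i j s)" for s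
      by (rule cong) simp
    ultimately show ?thesis by simp
  qed
  moreover have "AE s in M. \<forall>i\<in>{..<m}. (\<lambda>j. F i j s) \<longlonglongrightarrow> w i s"
    using F(2) by (intro AE_finite_allI) auto
  then have "AE s in M. (\<lambda>j. \<Phi> (\<lambda>i. F i j s)) \<longlonglongrightarrow> \<Phi> (\<lambda>i. w i s)"
    by eventually_elim (auto intro!: \<Phi>)
  ultimately show ?thesis
    unfolding strongly_measurable_def by (intro exI[of _ "\<lambda>j s. \<Phi> (\<lambda>i. F i j s)"]) auto
qed

lemma strongly_measurable_imp_measurable:
  fixes f :: "'s \<Rightarrow> 'x::real_normed_vector"
  assumes "strongly_measurable M f"
  shows "f \<in> borel_measurable (completion M)"
proof -
  obtain F where F: "\<And>i. simple_function M (F i)" "AE s in M. (\<lambda>i. F i s) \<longlonglongrightarrow> f s"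
    using assms unfolding strongly_measurable_def by auto
  obtain E where E: "E \<in> null_sets M" "{s \<in> space M. \<not> (\<lambda>i. F i s) \<longlonglongrightarrow> f s} \<subseteq> E"
    using F(2) by (auto elim!: AE_E)
  have "(\<lambda>s. if s \<in> E then 0 else f s) \<in> borel_measurable M"
  proof (rule borel_measurable_LIMSEQ_metric)
    fix i
    have "simple_function M (\<lambda>s. if s \<in> E then 0 else F i s)"
      using E F(1) by (intro simple_function_If_set) auto
    then show "(\<lambda>s. if s \<in> E then 0 else F i s) \<in> borel_measurable M"
      by (rule borel_measurable_simple_function)
  next
    fix s assume "s \<in> space M"
    then show "(\<lambda>i. if s \<in> E then 0 else F i s) \<longlonglongrightarrow> (if s \<in> E then 0 else f s)"
      using E by auto
  qed
  then have "(\<lambda>s. if s \<in> E then 0 else f s) \<in> borel_measurable (completion M)"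
    by (rule measurable_completion)
  moreover have "AE s in M. (if s \<in> E then 0 else f s) = f s"
    using AE_not_in[OF E(1)] by eventually_elim simp
  ultimately show ?thesis by (rule AE_eq_measurable_completion)
qed

lemma strongly_measurable_compose1:
  fixes f :: "'x::real_normed_vector \<Rightarrow> 'y::real_normed_vector"
  assumes "strongly_measurable M u" "continuous_on UNIV f"
  shows "strongly_measurable M (\<lambda>s. f (u s))"
proof (rule strongly_measurable_compose[where \<Phi> = "\<lambda>a. f (a 0)" and m = 1 and w = "\<lambda>_. u"])
  fix a :: "nat \<Rightarrow> nat \<Rightarrow> 'x" and b assume "\<And>i. i < 1 \<Longrightarrow> (\<lambda>j. a j i) \<longlonglongrightarrow> b i"
  then show "(\<lambda>j. f (a j 0)) \<longlonglongrightarrow> f (b 0)"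
    using assms(2) by (auto simp: continuous_on_eq_continuous_at intro: isCont_tendsto_compose)
qed (use assms in auto)

lemma strongly_measurable_add:
  fixes u v :: "'s \<Rightarrow> 'x::real_normed_vector"
  assumes "strongly_measurable M u" "strongly_measurable M v"
  shows "strongly_measurable M (\<lambda>s. u s + v s)"
proof -
  define \<Phi> :: "(nat \<Rightarrow> 'x) \<Rightarrow> 'x" where "\<Phi> = (\<lambda>a. a 0 + a 1)"
  have "strongly_measurable M (\<lambda>s. \<Phi> (\<lambda>i. (if i = 0 then u else v) s))"
  proof (rule strongly_measurable_compose[where m = 2 and \<Phi> = \<Phi> and w = "\<lambda>i. if i = 0 then u else v"])
    show "strongly_measurable M (if i = 0 then u else v)" for i :: nat using assms by simp
    fix a :: "nat \<Rightarrow> nat \<Rightarrow> 'x" and b assume "\<And>i. i < 2 \<Longrightarrow> (\<lambda>j. a j i) \<longlonglongrightarrow> b i"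
    then show "(\<lambda>j. \<Phi> (a j)) \<longlonglongrightarrow> \<Phi> b" unfolding \<Phi>_def by (intro tendsto_add) auto
  qed
  then show ?thesis by (simp add: \<Phi>_def)
qed

lemma strongly_measurable_norm:
  "strongly_measurable M u \<Longrightarrow> strongly_measurable M (\<lambda>s. norm (u s))"
  by (rule strongly_measurable_compose1[where f = norm]) (auto intro: continuous_intros)

text \<open>Completing the measure leaves the integral unchanged and makes the integrand measurable
  for every strongly measurable \<open>u\<close>.\<close>

definition Lp_int :: "'s measure \<Rightarrow> real \<Rightarrow> ('s \<Rightarrow> 'x::real_normed_vector) \<Rightarrow> ennreal" where
  "Lp_int M p u = (\<integral>\<^sup>+ s. ennreal (norm (u s) powr p) \<partial>(completion M))"

lemma Lp_space_iff: "u \<in> Lp_space M p \<longleftrightarrow> strongly_measurable M u \<and> Lp_int M p u < \<infinity>"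
  by (simp add: Lp_space_def Lp_int_def nn_integral_completion)

lemma Lp_norm_eq: "Lp_norm M p u = enn2real (Lp_int M p u) powr (1 / p)"
  by (simp add: Lp_norm_def Lp_int_def nn_integral_completion)

lemma Lp_norm_nonneg: "0 \<le> Lp_norm M p u"
  by (simp add: Lp_norm_def)

lemma Lp_int_eq:
  assumes "u \<in> Lp_space M p" "0 < p"
  shows "Lp_int M p u = ennreal (Lp_norm M p u powr p)"
  using assms by (simp add: Lp_space_iff Lp_norm_eq powr_powr)

lemma Lp_norm_leI:
  assumes "Lp_int M p u \<le> ennreal (c powr p)" "0 \<le> c" "0 < p"
  shows "Lp_norm M p u \<le> c"
proof -
  have "enn2real (Lp_int M p u) \<le> c powr p"
    by (intro enn2real_leI assms(1)) simp
  then have "Lp_norm M p u \<le> (c powr p) powr (1 / p)"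
    unfolding Lp_norm_eq using assms by (intro powr_mono2) auto
  then show ?thesis using assms by (simp add: powr_powr)
qed

lemma measurable_powr_norm:
  assumes "strongly_measurable M u"
  shows "(\<lambda>s. norm (u s) powr p) \<in> borel_measurable (completion M)"
    "(\<lambda>s. ennreal (norm (u s) powr p)) \<in> borel_measurable (completion M)"
proof -
  have [measurable]: "u \<in> borel_measurable (completion M)"
    by (rule strongly_measurable_imp_measurable[OF assms])
  show "(\<lambda>s. norm (u s) powr p) \<in> borel_measurable (completion M)"
    "(\<lambda>s. ennreal (norm (u s) powr p)) \<in> borel_measurable (completion M)"
    by measurable
qed

lemma Lp_norm_zero_AE:
  assumes u: "u \<in> Lp_space M p" "0 < p" and 0: "Lp_norm M p u = 0"
  shows "AE s in completion M. u s = 0"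
proof -
  have "Lp_int M p u = 0" using Lp_int_eq[OF u] 0 by simp
  then have "AE s in completion M. ennreal (norm (u s) powr p) = 0"
    unfolding Lp_int_def using u
    by (subst (asm) nn_integral_0_iff_AE) (auto simp: Lp_space_iff intro!: measurable_powr_norm)
  then show ?thesis by eventually_elim (auto simp: ennreal_eq_0_iff powr_nonneg_iff)
qed

text \<open>Convexity of the p-th power at x / a and y / b with weights a / (a + b) and b / (a + b).
  With a and b close to the two norms this is the usual proof of Minkowski's inequality.\<close>

lemma convex_powr_sum:
  fixes x y a b p :: real
  assumes "0 \<le> x" "0 \<le> y" "0 < a" "0 < b" "1 \<le> p"
  shows "(x + y) powr p \<le> (a + b) powr p * (a / (a + b) * (x / a) powr p + b / (a + b) * (y / b) powr p)"
proof -
  have conv: "(t * x + u * y) powr p \<le> t * x powr p + u * y powr p"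
    if h: "0 \<le> x" "0 \<le> y" "0 \<le> t" "0 \<le> u" "t + u = 1" for t u x y :: real
  proof -
    \<comment> \<open>Handles arguments equal to 0: there convexity reduces to this inequality for a
      weight c.\<close>
    have le: "c powr p \<le> c" if "0 \<le> c" "c \<le> 1" for c :: real
      using powr_le_one_le[of c p] that assms by (cases "c = 0") auto
    consider "x = 0" | "y = 0" | "0 < x" "0 < y" by (metis h(1,2) less_le)
    then show ?thesis
    proof cases
      case 1
      then show ?thesis using le[of u] h mult_right_mono[of "u powr p" u "y powr p"] by (simp add: powr_mult)
    next
      case 2
      then show ?thesis using le[of t] h mult_right_mono[of "t powr p" t "x powr p"] by (simp add: powr_mult)
    next
      case 3
      then show ?thesis using powr_convex[OF assms(5)] h unfolding convex_on_def by auto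
    qed
  qed
  have "a / (a + b) * (x / a) = x / (a + b)" "b / (a + b) * (y / b) = y / (a + b)" "a + b \<noteq> 0"
    using assms by simp_all
  then have "(x + y) powr p = ((a + b) * (a / (a + b) * (x / a) + b / (a + b) * (y / b))) powr p"
    by (simp only: add_divide_distrib[symmetric]) simp
  also have "\<dots> = (a + b) powr p * (a / (a + b) * (x / a) + b / (a + b) * (y / b)) powr p"
    by (rule powr_mult)
  also have "\<dots> \<le> (a + b) powr p * (a / (a + b) * (x / a) powr p + b / (a + b) * (y / b) powr p)"
    using assms by (intro mult_left_mono conv) (auto simp: add_divide_distrib[symmetric])
  finally show ?thesis .
qed

lemma Lp_add:
  fixes u v :: "'s \<Rightarrow> 'x::real_normed_vector"
  assumes u: "u \<in> Lp_space M p" and v: "v \<in> Lp_space M p" and p: "1 \<le> p"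
  shows "u + v \<in> Lp_space M p" "Lp_norm M p (u + v) \<le> Lp_norm M p u + Lp_norm M p v"
proof -
  \<comment> \<open>Strict upper bounds \<open>a\<close> and \<open>b\<close> are positive even if a
    norm is 0; at the end they are moved down to the norms.\<close>
  have *: "Lp_int M p (u + v) \<le> ennreal ((a + b) powr p)"
    if a: "Lp_norm M p u < a" and b: "Lp_norm M p v < b" for a b
  proof -
    have ab: "0 < a" "0 < b" using a b Lp_norm_nonneg[of M p u] Lp_norm_nonneg[of M p v] by auto
    define A where "A = (a + b) powr p * (a / (a + b)) / a powr p"
    define B where "B = (a + b) powr p * (b / (a + b)) / b powr p"
    have A: "0 \<le> A" "A * a powr p = (a + b) powr p * (a / (a + b))" using ab by (simp_all add: A_def)
    have B: "0 \<le> B" "B * b powr p = (a + b) powr p * (b / (a + b))" using ab by (simp_all add: B_def)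
    have AB: "A * a powr p + B * b powr p = (a + b) powr p"
      unfolding A(2) B(2) using ab by (simp add: distrib_left[symmetric] add_divide_distrib[symmetric])
    have mu: "(\<lambda>s. ennreal (norm (u s) powr p)) \<in> borel_measurable (completion M)"
      and mv: "(\<lambda>s. ennreal (norm (v s) powr p)) \<in> borel_measurable (completion M)"
      using u v by (intro measurable_powr_norm(2); simp add: Lp_space_iff)+
    have "Lp_int M p (u + v) \<le> (\<integral>\<^sup>+ s. ennreal A * ennreal (norm (u s) powr p) + ennreal B * ennreal (norm (v s) powr p) \<partial>(completion M))"
      unfolding Lp_int_def
    proof (rule nn_integral_mono)
      fix s
      have "norm ((u + v) s) powr p \<le> (norm (u s) + norm (v s)) powr p"
        using p norm_triangle_ineq[of "u s" "v s"] by (intro powr_mono2) auto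
      also have "\<dots> \<le> (a + b) powr p * (a / (a + b) * (norm (u s) / a) powr p + b / (a + b) * (norm (v s) / b) powr p)"
        using ab p by (intro convex_powr_sum) auto
      also have "\<dots> = A * norm (u s) powr p + B * norm (v s) powr p"
        by (simp add: A_def B_def powr_divide distrib_left)
      finally have "ennreal (norm ((u + v) s) powr p) \<le> ennreal (A * norm (u s) powr p + B * norm (v s) powr p)"
        by (rule ennreal_leI)
      also have "\<dots> = ennreal A * ennreal (norm (u s) powr p) + ennreal B * ennreal (norm (v s) powr p)"
        using A(1) B(1) by (subst ennreal_plus) (simp_all add: ennreal_mult'')
      finally show "ennreal (norm ((u + v) s) powr p) \<le> ennreal A * ennreal (norm (u s) powr p) + ennreal B * ennreal (norm (v s) powr p)" .
    qed
    also have "\<dots> = ennreal A * Lp_int M p u + ennreal B * Lp_int M p v"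
      unfolding Lp_int_def nn_integral_cmult[OF mu, symmetric] nn_integral_cmult[OF mv, symmetric]
      using mu mv by (intro nn_integral_add borel_measurable_times_ennreal) simp_all
    also have "\<dots> = ennreal (A * Lp_norm M p u powr p + B * Lp_norm M p v powr p)"
      using A(1) B(1) p Lp_int_eq[OF u] Lp_int_eq[OF v] by (subst ennreal_plus) (simp_all add: ennreal_mult'')
    also have "\<dots> \<le> ennreal (A * a powr p + B * b powr p)"
      using a b A B p by (intro ennreal_leI add_mono mult_left_mono powr_mono2) (auto simp: Lp_norm_nonneg)
    finally show ?thesis unfolding AB .
  qed
  have "Lp_int M p (u + v) < \<infinity>"
    using *[of "Lp_norm M p u + 1" "Lp_norm M p v + 1"] by (simp add: le_less_trans)
  then show "u + v \<in> Lp_space M p"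
    using strongly_measurable_add[of M u v] u v by (simp add: Lp_space_iff plus_fun_def)
  show "Lp_norm M p (u + v) \<le> Lp_norm M p u + Lp_norm M p v"
  proof (rule field_le_epsilon)
    fix e :: real assume e: "0 < e"
    have "Lp_norm M p (u + v) \<le> (Lp_norm M p u + e / 2) + (Lp_norm M p v + e / 2)"
      using e p by (intro Lp_norm_leI *) (auto simp: Lp_norm_nonneg add_nonneg_nonneg)
    then show "Lp_norm M p (u + v) \<le> Lp_norm M p u + Lp_norm M p v + e" by simp
  qed
qed

lemma Lp_scale:
  fixes u :: "'s \<Rightarrow> 'x::real_normed_vector"
  assumes u: "u \<in> Lp_space M p" and p: "0 < p"
  shows "c *\<^sub>R u \<in> Lp_space M p" "Lp_norm M p (c *\<^sub>R u) = \<bar>c\<bar> * Lp_norm M p u"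
proof -
  have I: "Lp_int M p (c *\<^sub>R u) = ennreal (\<bar>c\<bar> powr p) * Lp_int M p u"
    unfolding Lp_int_def using u
    by (subst nn_integral_cmult[symmetric])
       (auto simp: Lp_space_iff measurable_powr_norm scaleR_fun_def powr_mult ennreal_mult)
  have "strongly_measurable M (\<lambda>s. c *\<^sub>R u s)"
    using u by (intro strongly_measurable_compose1[where f = "\<lambda>x. c *\<^sub>R x"] continuous_intros)
               (auto simp: Lp_space_iff)
  then show "c *\<^sub>R u \<in> Lp_space M p"
    using u I by (simp add: Lp_space_iff scaleR_fun_def ennreal_mult_less_top)
  have "Lp_int M p (c *\<^sub>R u) = ennreal ((\<bar>c\<bar> * Lp_norm M p u) powr p)"
    unfolding I Lp_int_eq[OF u p] by (simp add: powr_mult ennreal_mult)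
  then show "Lp_norm M p (c *\<^sub>R u) = \<bar>c\<bar> * Lp_norm M p u"
    using p unfolding Lp_norm_eq[of M p "c *\<^sub>R u"] by (simp add: powr_powr Lp_norm_nonneg)
qed

lemma seminormed_Lp:
  assumes "1 \<le> p"
  shows "seminormed (Lp_space M p :: ('s \<Rightarrow> 'x::real_normed_vector) set) (Lp_norm M p)"
proof
  have "(0 :: 's \<Rightarrow> 'x) \<in> Lp_space M p"
    using assms by (auto simp: Lp_space_iff Lp_int_def strongly_measurable_def zero_fun_def intro!: exI[of _ "\<lambda>_ _. 0"])
  then show "subspace (Lp_space M p :: ('s \<Rightarrow> 'x) set)"
    using assms by (auto simp: subspace_def Lp_add Lp_scale)
qed (use assms in \<open>auto simp: Lp_norm_nonneg Lp_add Lp_scale\<close>)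

lemma seminormed_UNIV: "seminormed (UNIV :: 'x::real_normed_vector set) norm"
  by standard (auto simp: norm_triangle_ineq)

section \<open>Hoelder's inequality with several factors\<close>

lemma Lp_norm_fun:
  assumes "u \<in> Lp_space M p"
  shows "(\<lambda>s. norm (u s)) \<in> Lp_space M p" "Lp_norm M p (\<lambda>s. norm (u s)) = Lp_norm M p u"
  using assms strongly_measurable_norm[of M u] by (auto simp: Lp_space_iff Lp_int_def Lp_norm_eq)

text \<open>Each factor is normalised and the weighted mean inequality applied pointwise. A factor
  of norm 0 vanishes almost everywhere and makes both sides 0; this includes weight 0, because
  \<open>0 powr 0 = 0\<close>.\<close>

lemma Lp_holder:
  fixes a :: "'i \<Rightarrow> 's \<Rightarrow> real"
  assumes fin: "finite I" and w: "\<And>i. i \<in> I \<Longrightarrow> 0 \<le> w i" "(\<Sum>i\<in>I. w i) = p" and p: "0 < p"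
    and a: "\<And>i. i \<in> I \<Longrightarrow> a i \<in> Lp_space M p" "\<And>i s. i \<in> I \<Longrightarrow> 0 \<le> a i s"
  shows "(\<integral>\<^sup>+ s. ennreal (\<Prod>i\<in>I. a i s powr w i) \<partial>(completion M)) \<le> ennreal (\<Prod>i\<in>I. Lp_norm M p (a i) powr w i)"
proof (cases "\<exists>i\<in>I. Lp_norm M p (a i) = 0")
  case True
  then obtain i where i: "i \<in> I" "Lp_norm M p (a i) = 0" by auto
  have "AE s in completion M. a i s = 0" using Lp_norm_zero_AE[OF a(1)[OF i(1)] p i(2)] .
  then have "AE s in completion M. ennreal (\<Prod>i\<in>I. a i s powr w i) = 0"
  proof eventually_elim
    case (elim s)
    then have "(\<Prod>i\<in>I. a i s powr w i) = 0" using i by (intro prod_zero[OF fin]) auto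
    then show ?case by simp
  qed
  then have "(\<integral>\<^sup>+ s. ennreal (\<Prod>i\<in>I. a i s powr w i) \<partial>(completion M)) = (\<integral>\<^sup>+ s. 0 \<partial>(completion M))"
    by (rule nn_integral_cong_AE)
  then show ?thesis by simp
next
  case False
  define N where "N = (\<lambda>i. Lp_norm M p (a i))"
  have N: "0 < N i" if "i \<in> I" for i
    using False that Lp_norm_nonneg[of M p "a i"] unfolding N_def by force
  have pN: "0 \<le> (\<Prod>i\<in>I. N i powr w i)" by (intro prod_nonneg) auto
  have "(\<integral>\<^sup>+ s. ennreal (\<Prod>i\<in>I. a i s powr w i) \<partial>(completion M))
    \<le> (\<integral>\<^sup>+ s. (\<Sum>i\<in>I. ennreal ((\<Prod>i\<in>I. N i powr w i) * (w i / p) / N i powr p) * ennreal (norm (a i s) powr p)) \<partial>(completion M))"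
  proof (rule nn_integral_mono)
    fix s
    have "(\<Prod>i\<in>I. a i s powr w i) = (\<Prod>i\<in>I. N i powr w i) * (\<Prod>i\<in>I. (a i s / N i) powr w i)"
      unfolding prod.distrib[symmetric] using N a
      by (intro prod.cong refl) (auto simp: powr_divide less_imp_neq[OF N, symmetric])
    also have "\<dots> \<le> (\<Prod>i\<in>I. N i powr w i) * (\<Sum>i\<in>I. w i / p * (a i s / N i) powr p)"
      using w a N p by (intro mult_left_mono weighted_arith_geom_mean[OF fin] pN) (auto simp: less_imp_le)
    also have "\<dots> = (\<Sum>i\<in>I. (\<Prod>i\<in>I. N i powr w i) * (w i / p) / N i powr p * norm (a i s) powr p)"
      unfolding sum_distrib_left using a N
      by (intro sum.cong refl) (auto simp: powr_divide less_imp_le mult_ac)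
    finally have "ennreal (\<Prod>i\<in>I. a i s powr w i)
      \<le> ennreal (\<Sum>i\<in>I. (\<Prod>i\<in>I. N i powr w i) * (w i / p) / N i powr p * norm (a i s) powr p)"
      by (rule ennreal_leI)
    also have "\<dots> = (\<Sum>i\<in>I. ennreal ((\<Prod>i\<in>I. N i powr w i) * (w i / p) / N i powr p * norm (a i s) powr p))"
      using w(1) p pN by (intro sum_ennreal[symmetric] mult_nonneg_nonneg divide_nonneg_nonneg) auto
    also have "\<dots> = (\<Sum>i\<in>I. ennreal ((\<Prod>i\<in>I. N i powr w i) * (w i / p) / N i powr p) * ennreal (norm (a i s) powr p))"
      by (intro sum.cong refl ennreal_mult'') simp
    finally show "ennreal (\<Prod>i\<in>I. a i s powr w i)
      \<le> (\<Sum>i\<in>I. ennreal ((\<Prod>i\<in>I. N i powr w i) * (w i / p) / N i powr p) * ennreal (norm (a i s) powr p))" .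
  qed
  also have "\<dots> = (\<Sum>i\<in>I. ennreal ((\<Prod>i\<in>I. N i powr w i) * (w i / p) / N i powr p) * Lp_int M p (a i))"
  proof -
    have meas: "(\<lambda>s. ennreal (norm (a i s) powr p)) \<in> borel_measurable (completion M)" if "i \<in> I" for i
      using a(1)[OF that] by (intro measurable_powr_norm(2)) (simp add: Lp_space_iff)
    have "(\<integral>\<^sup>+ s. (\<Sum>i\<in>I. ennreal (c i) * ennreal (norm (a i s) powr p)) \<partial>(completion M))
        = (\<Sum>i\<in>I. ennreal (c i) * Lp_int M p (a i))" for c
      unfolding Lp_int_def using meas
      by (subst nn_integral_sum) (auto intro!: sum.cong nn_integral_cmult borel_measurable_times_ennreal)
    then show ?thesis .
  qed
  also have "\<dots> = (\<Sum>i\<in>I. ennreal ((\<Prod>i\<in>I. N i powr w i) * (w i / p)))"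
  proof (rule sum.cong[OF refl])
    fix i assume i: "i \<in> I"
    have "Lp_int M p (a i) = ennreal (N i powr p)" unfolding N_def by (rule Lp_int_eq[OF a(1)[OF i] p])
    then show "ennreal ((\<Prod>i\<in>I. N i powr w i) * (w i / p) / N i powr p) * Lp_int M p (a i)
      = ennreal ((\<Prod>i\<in>I. N i powr w i) * (w i / p))"
      using N[OF i] w(1)[OF i] p pN by (simp add: ennreal_mult[symmetric])
  qed
  also have "\<dots> = ennreal (\<Sum>i\<in>I. (\<Prod>i\<in>I. N i powr w i) * (w i / p))"
    using w p pN by (intro sum_ennreal) auto
  also have "(\<Sum>i\<in>I. (\<Prod>i\<in>I. N i powr w i) * (w i / p)) = (\<Prod>i\<in>I. N i powr w i)"
    using w p by (simp add: sum_distrib_left[symmetric] sum_divide_distrib[symmetric])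
  finally show ?thesis unfolding N_def .
qed

text \<open>The shape in which every derivative is estimated below: \<open>A\<close> measures the
  size of the arguments, \<open>B\<close> the increment, and each direction enters with exponent
  1.\<close>

lemma Lp_holder_slots:
  fixes A B :: "'s \<Rightarrow> real" and vs :: "nat \<Rightarrow> 's \<Rightarrow> 'x::real_normed_vector"
  assumes ab: "0 \<le> a" "0 \<le> b" "a + b + real k = p" and p: "0 < p"
    and A: "A \<in> Lp_space M p" "\<And>s. 0 \<le> A s" and B: "B \<in> Lp_space M p" "\<And>s. 0 \<le> B s"
    and vs: "\<And>i. i < k \<Longrightarrow> vs i \<in> Lp_space M p"
    and H: "H \<in> borel_measurable (completion M)" and K: "0 \<le> K"
    and le: "\<And>s. \<bar>H s\<bar> \<le> K * (A s powr a * B s powr b * (\<Prod>i<k. norm (vs i s)))"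
  shows "integrable (completion M) H"
    "\<bar>\<integral>s. H s \<partial>(completion M)\<bar> \<le> K * (Lp_norm M p A powr a * Lp_norm M p B powr b * (\<Prod>i<k. Lp_norm M p (vs i)))"
proof -
  \<comment> \<open>One family on k + 2 indices: the two functions at 0 and 1, the directions
    shifted by 2.\<close>
  define f where "f = (\<lambda>i. case i of 0 \<Rightarrow> A | Suc 0 \<Rightarrow> B | Suc (Suc i) \<Rightarrow> (\<lambda>s. norm (vs i s)))"
  define w where "w = (\<lambda>i. case i of 0 \<Rightarrow> a | Suc 0 \<Rightarrow> b | Suc (Suc i) \<Rightarrow> (1::real))"
  let ?R = "Lp_norm M p A powr a * Lp_norm M p B powr b * (\<Prod>i<k. Lp_norm M p (vs i))"
  have R0: "0 \<le> ?R" by (intro mult_nonneg_nonneg prod_nonneg) (auto simp: Lp_norm_nonneg)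
  have "(\<integral>\<^sup>+ s. ennreal (\<Prod>i<Suc (Suc k). f i s powr w i) \<partial>(completion M))
      \<le> ennreal (\<Prod>i<Suc (Suc k). Lp_norm M p (f i) powr w i)"
  proof (rule Lp_holder)
    show "(\<Sum>i<Suc (Suc k). w i) = p"
      using ab by (simp only: sum.lessThan_Suc_shift) (simp add: w_def)
  qed (use ab p A B Lp_norm_fun(1)[OF vs] in \<open>auto simp: f_def w_def split: nat.splits\<close>)
  also have "(\<Prod>i<Suc (Suc k). Lp_norm M p (f i) powr w i) = ?R"
    using vs by (simp only: prod.lessThan_Suc_shift) (simp add: f_def w_def Lp_norm_fun Lp_norm_nonneg mult.assoc)
  also have "(\<lambda>s. \<Prod>i<Suc (Suc k). f i s powr w i) = (\<lambda>s. A s powr a * B s powr b * (\<Prod>i<k. norm (vs i s)))"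
    by (simp only: prod.lessThan_Suc_shift) (simp add: f_def w_def fun_eq_iff mult.assoc)
  finally have hol: "(\<integral>\<^sup>+ s. ennreal (A s powr a * B s powr b * (\<Prod>i<k. norm (vs i s))) \<partial>(completion M)) \<le> ennreal ?R" .
  have meas: "(\<lambda>s. ennreal (A s powr a * B s powr b * (\<Prod>i<k. norm (vs i s)))) \<in> borel_measurable (completion M)"
  proof -
    have [measurable]: "A \<in> borel_measurable (completion M)" "B \<in> borel_measurable (completion M)"
      using A B by (auto simp: Lp_space_iff intro: strongly_measurable_imp_measurable)
    have [measurable]: "(\<lambda>s. \<Prod>i<k. norm (vs i s)) \<in> borel_measurable (completion M)"
      using vs by (intro borel_measurable_prod measurable_compose[OF _ borel_measurable_norm])
        (auto simp: Lp_space_iff intro: strongly_measurable_imp_measurable)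
    show ?thesis by measurable
  qed
  have "(\<integral>\<^sup>+ s. ennreal (norm (H s)) \<partial>(completion M))
      \<le> (\<integral>\<^sup>+ s. ennreal K * ennreal (A s powr a * B s powr b * (\<Prod>i<k. norm (vs i s))) \<partial>(completion M))"
    using le K by (intro nn_integral_mono) (auto simp: ennreal_mult'[symmetric] intro!: ennreal_leI)
  also have "\<dots> \<le> ennreal K * ennreal ?R"
    unfolding nn_integral_cmult[OF meas] by (intro mult_left_mono hol) simp
  finally have bd: "(\<integral>\<^sup>+ s. ennreal (norm (H s)) \<partial>(completion M)) \<le> ennreal (K * ?R)"
    using K by (simp add: ennreal_mult'[symmetric])
  show int: "integrable (completion M) H"
    using H bd by (intro integrableI_bounded) (auto intro: le_less_trans)
  have "ennreal (norm (\<integral>s. H s \<partial>(completion M))) \<le> ennreal (K * ?R)"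
    using integral_norm_bound_ennreal[OF int] bd by (rule order_trans)
  then show "\<bar>\<integral>s. H s \<partial>(completion M)\<bar> \<le> K * ?R"
    using K R0 by (simp add: ennreal_le_iff)
qed

subsection \<open>From the Banach space to the Lebesgue--Bochner space\<close>

text \<open>\<open>\<psi>\<close> is the difference of a plateau function and its dilation.\<close>

lemma annular_jet:
  fixes b :: "'x::real_normed_vector \<Rightarrow> real"
  assumes r: "1 < r" and n: "n = horder r" and a: "\<alpha> = r - real n" "0 < \<alpha>" "\<alpha> \<le> 1"
    and b: "bump UNIV norm b" "uniformly_H_smooth UNIV norm r b"
  obtains \<psi> D C \<delta> R R' \<kappa> where "seminormed.jet (UNIV :: 'x set) norm UNIV n \<alpha> C \<psi> D"
    "\<And>x. 0 \<le> \<psi> x" "\<And>x. norm x < \<delta> \<Longrightarrow> \<psi> x = 0" "\<And>x. R' < norm x \<Longrightarrow> \<psi> x = 0"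
    "\<And>x. R \<le> norm x \<Longrightarrow> norm x \<le> 2 * R \<Longrightarrow> \<psi> x = \<kappa>" "0 < \<delta>" "0 < R" "0 < R'" "0 < \<kappa>"
proof -
  interpret X: seminormed "UNIV :: 'x set" norm by (rule seminormed_UNIV)
  obtain x0 R0 where x0: "b x0 \<noteq> 0" and R0: "\<And>x. b x \<noteq> 0 \<Longrightarrow> norm x \<le> R0"
    using b(1) unfolding bump_def by auto
  obtain D M where D: "derivs_upto UNIV norm b n D"
    and M: "\<And>y z. mbound UNIV norm n (\<lambda>vs. D n y vs - D n z vs) (M * norm (y - z) powr \<alpha>)"
    using b(2) unfolding uniformly_H_smooth_def n[symmetric] a(1) by auto
  have R00: "0 \<le> R0" using R0[OF x0] norm_ge_zero[of x0] by linarith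
  \<comment> \<open>Large enough that \<open>b\<close> vanishes outside the ball of radius
    \<open>R\<close> about \<open>x0\<close>.\<close>
  define R where "R = R0 + norm x0 + 1"
  have R: "0 < R" using R00 norm_ge_zero[of x0] unfolding R_def by linarith
  have b0: "b x = 0" if "R \<le> norm (x - x0)" for x
  proof (rule ccontr)
    assume "b x \<noteq> 0"
    then have "norm x \<le> R0" by (rule R0)
    then show False using that norm_triangle_ineq4[of x x0] by (simp add: R_def)
  qed
  obtain C0 where j0: "X.jet (X.nball x0 (2 * R)) n \<alpha> C0 b D"
    by (rule X.jet_ball[OF D _ _ a(2,3), where c = x0 and \<rho> = "2 * R" and M = M]) (use R M in auto)
  \<comment> \<open>The sign makes the bump positive at \<open>x0\<close>, the positive part makes
    it nonnegative everywhere.\<close>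
  define b1 where "b1 = (\<lambda>x. (max 0 (0 + sgn (b x0) * b x)) ^ (n + 2))"
  obtain C1 E1 where "X.jet (X.nball x0 (2 * R)) n \<alpha> C1 b1 E1"
    unfolding b1_def by (rule X.jet_pos_part_power[OF j0])
  then obtain C2 E2 where j2: "X.jet UNIV n \<alpha> C2 b1 E2"
    by (rule X.jet_extend[where \<kappa> = 0]) (use R a b0 in \<open>auto simp: b1_def\<close>)
  have b1: "0 \<le> b1 x" for x by (simp add: b1_def)
  have b1x0: "0 < b1 x0" unfolding b1_def using x0 by (intro zero_less_power) (auto simp: sgn_real_def)
  have b10: "b1 x = 0" if "R \<le> norm (x - x0)" for x using b0[OF that] by (simp add: b1_def)
  define c where "c = b1 x0 / 2"
  define \<kappa> where "\<kappa> = c ^ (n + 2)"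
  have c: "0 < c" using b1x0 by (simp add: c_def)
  then have \<kappa>: "0 < \<kappa>" by (simp add: \<kappa>_def)
  \<comment> \<open>A plateau with a hole: 0 near \<open>x0\<close>, where \<open>b1\<close> is at
    least half of \<open>b1 x0\<close>, and \<kappa> wherever \<open>b1\<close> vanishes.\<close>
  define \<phi> where "\<phi> = (\<lambda>x. (max 0 (c + (-1) * b1 x)) ^ (n + 2))"
  obtain C3 E3 where j3: "X.jet UNIV n \<alpha> C3 \<phi> E3"
    unfolding \<phi>_def by (rule X.jet_pos_part_power[OF j2])
  \<comment> \<open>From the Hoelder estimate at level 0: within this radius \<open>b1\<close>
    differs from \<open>b1 x0\<close> by at most \<open>c\<close>.\<close>
  define \<delta>0 where "\<delta>0 = (c / (C2 + 1)) powr (1 / \<alpha>)"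
  have C2: "0 \<le> C2" by (rule X.jetD(2)[OF j2])
  have \<delta>0: "0 < \<delta>0" using c C2 by (simp add: \<delta>0_def)
  have near: "\<phi> x = 0" if "norm (x - x0) < \<delta>0" for x
  proof -
    have "norm (x - x0) powr \<alpha> \<le> \<delta>0 powr \<alpha>" using that a by (intro powr_mono2) auto
    also have "\<dots> = c / (C2 + 1)" using a c C2 by (simp add: \<delta>0_def powr_powr)
    finally have "(C2 + 1) * norm (x - x0) powr \<alpha> \<le> c" using C2 by (simp add: field_simps)
    moreover have "C2 * norm (x - x0) powr \<alpha> \<le> (C2 + 1) * norm (x - x0) powr \<alpha>"
      by (intro mult_right_mono) auto
    moreover have "\<bar>E2 0 x undefined - E2 0 x0 undefined\<bar> \<le> C2 * norm (x - x0) powr \<alpha> * (\<Prod>i<(0::nat). norm (undefined i :: 'x))"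
      by (rule mboundD[OF X.jetD(6)[OF j2]]) auto
    ultimately have "\<bar>b1 x - b1 x0\<bar> \<le> c" using X.jetD(3)[OF j2] by simp
    then have "c + (-1) * b1 x \<le> 0" unfolding c_def by linarith
    then have "max 0 (c + (-1) * b1 x) = 0" by (rule max_absorb1)
    then show ?thesis by (simp add: \<phi>_def)
  qed
  have far: "\<phi> x = \<kappa>" if "R \<le> norm (x - x0)" for x
    using b10[OF that] c by (simp add: \<phi>_def \<kappa>_def)
  have \<phi>: "0 \<le> \<phi> x" "\<phi> x \<le> \<kappa>" for x
  proof -
    show "0 \<le> \<phi> x" by (simp add: \<phi>_def)
    show "\<phi> x \<le> \<kappa>" unfolding \<phi>_def \<kappa>_def using b1[of x] c by (intro power_mono) auto
  qed
  define \<delta> where "\<delta> = min \<delta>0 R"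
  have \<delta>: "0 < \<delta>" "\<delta> \<le> \<delta>0" "\<delta> \<le> R" using \<delta>0 R by (auto simp: \<delta>_def)
  \<comment> \<open>Dilated by \<open>\<Lambda>\<close>, the hole of the plateau contains the open
    ball of radius 3 R. So for R \<le> norm x \<le> 2 R only the first term of \<open>\<psi>\<close>
    is present, with its full value \<kappa>; beyond \<open>\<Lambda> * R\<close> both terms are
    \<kappa> and cancel.\<close>
  define \<Lambda> where "\<Lambda> = 3 * R / \<delta>"
  have \<Lambda>: "1 \<le> \<Lambda>" "0 < \<Lambda>" "\<Lambda> * \<delta> = 3 * R" using \<delta> R by (auto simp: \<Lambda>_def field_simps)
  define \<psi> where "\<psi> = (\<lambda>x. \<phi> (x0 + x) - \<phi> (x0 + (1 / \<Lambda>) *\<^sub>R x))"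
  obtain C4 E4 where j4: "X.jet UNIV n \<alpha> C4 (\<lambda>x. \<phi> (x0 + x)) E4"
    using jet_pullback[OF seminormed_UNIV seminormed_UNIV j3, of "\<lambda>x. x" 1 x0 UNIV] a by auto
  obtain C5 E5 where j5: "X.jet UNIV n \<alpha> C5 (\<lambda>x. \<phi> (x0 + (1 / \<Lambda>) *\<^sub>R x)) E5"
  proof (rule that)
    show "X.jet UNIV n \<alpha> (C3 * (1 + 1 / \<Lambda>) ^ (n + 1)) (\<lambda>x. \<phi> (x0 + (1 / \<Lambda>) *\<^sub>R x))
        (\<lambda>k x vs. E3 k (x0 + (1 / \<Lambda>) *\<^sub>R x) (\<lambda>i. (1 / \<Lambda>) *\<^sub>R vs i))"
      by (rule jet_pullback[OF seminormed_UNIV seminormed_UNIV j3]) (use a \<Lambda> in \<open>auto simp: algebra_simps\<close>)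
  qed
  have j6: "X.jet UNIV n \<alpha> (C4 + C5) \<psi> (\<lambda>k x vs. E4 k x vs - E5 k x vs)"
    unfolding \<psi>_def by (rule X.jet_diff[OF j4 j5])
  have near': "\<phi> (x0 + x) = 0" if "norm x < \<delta>" for x using near[of "x0 + x"] that \<delta> by simp
  have far': "\<phi> (x0 + x) = \<kappa>" if "R \<le> norm x" for x using far[of "x0 + x"] that by simp
  have sc: "norm ((1 / \<Lambda>) *\<^sub>R x) = norm x / \<Lambda>" for x :: 'x using \<Lambda> by simp
  show ?thesis
  proof (rule that[OF j6])
    \<comment> \<open>From radius R on the first term has its maximum \<kappa>; below R the second
      term vanishes.\<close>
    show "0 \<le> \<psi> x" for x
    proof (cases "R \<le> norm x")
      case True
      then show ?thesis using far'[of x] \<phi>(2)[of "x0 + (1 / \<Lambda>) *\<^sub>R x"] by (simp add: \<psi>_def)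
    next
      case False
      then have "norm x < \<Lambda> * \<delta>" using \<Lambda>(3) R by linarith
      then have "norm x / \<Lambda> < \<delta>" using \<Lambda>(2) by (simp add: field_simps)
      then show ?thesis using near'[of "(1 / \<Lambda>) *\<^sub>R x"] \<phi>(1)[of "x0 + x"] unfolding \<psi>_def sc by simp
    qed
    show "\<psi> x = 0" if "norm x < \<delta>" for x
    proof -
      have "norm x / \<Lambda> \<le> norm x" using \<Lambda> mult_left_mono[of 1 \<Lambda> "norm x"] by (simp add: field_simps)
      then have "norm ((1 / \<Lambda>) *\<^sub>R x) < \<delta>" using that unfolding sc by linarith
      then show ?thesis using near'[OF that] near' unfolding \<psi>_def by simp
    qed
    show "\<psi> x = 0" if "\<Lambda> * R < norm x" for x
    proof -
      have "R \<le> norm ((1 / \<Lambda>) *\<^sub>R x)" using that \<Lambda> unfolding sc by (simp add: field_simps)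
      moreover have "R \<le> norm x" using that \<Lambda> R mult_right_mono[of 1 \<Lambda> R] by linarith
      ultimately show ?thesis using far' unfolding \<psi>_def by simp
    qed
    show "\<psi> x = \<kappa>" if "R \<le> norm x" "norm x \<le> 2 * R" for x
    proof -
      have "norm x < \<Lambda> * \<delta>" using \<Lambda>(3) R that by linarith
      then have "norm ((1 / \<Lambda>) *\<^sub>R x) < \<delta>" using \<Lambda>(2) unfolding sc by (simp add: field_simps)
      then show ?thesis using near' far'[OF that(1)] unfolding \<psi>_def by simp
    qed
    show "0 < \<delta>" "0 < R" "0 < \<Lambda> * R" "0 < \<kappa>" using \<delta> R \<Lambda> \<kappa> by auto
  qed
qed

text \<open>After taking logarithms, j ranges over an interval whose length
  \<open>log 2 (R' / \<delta>)\<close> does not involve d.\<close>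

lemma card_dyadic_scales:
  fixes d \<delta> R' :: real
  assumes "0 < \<delta>" "0 < R'" "0 \<le> d"
  defines "J \<equiv> {j::int. \<delta> \<le> d / 2 powr j \<and> d / 2 powr j \<le> R'}"
  shows "finite J" "real (card J) \<le> \<bar>log 2 (R' / \<delta>)\<bar> + 1"
proof -
  have "finite J \<and> real (card J) \<le> \<bar>log 2 (R' / \<delta>)\<bar> + 1"
  proof (cases "d = 0")
    case True
    then have "J = {}" using assms by auto
    then show ?thesis by simp
  next
    case False
    then have d: "0 < d" using assms by simp
    have sub: "J \<subseteq> {\<lceil>log 2 (d / R')\<rceil>..\<lfloor>log 2 (d / \<delta>)\<rfloor>}"
    proof
      fix j assume "j \<in> J"
      then have "2 powr j \<le> d / \<delta>" "d / R' \<le> 2 powr j" using assms d by (auto simp: J_def field_simps)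
      then have "real_of_int j \<le> log 2 (d / \<delta>)" "log 2 (d / R') \<le> real_of_int j"
        using assms d by (auto simp: le_log_iff log_le_iff)
      then show "j \<in> {\<lceil>log 2 (d / R')\<rceil>..\<lfloor>log 2 (d / \<delta>)\<rfloor>}" by (simp add: le_floor_iff ceiling_le_iff)
    qed
    then have "card J \<le> nat (\<lfloor>log 2 (d / \<delta>)\<rfloor> + 1 - \<lceil>log 2 (d / R')\<rceil>)"
      using card_mono[OF _ sub] by simp
    moreover have "real_of_int (\<lfloor>log 2 (d / \<delta>)\<rfloor> + 1 - \<lceil>log 2 (d / R')\<rceil>) \<le> log 2 (d / \<delta>) - log 2 (d / R') + 1"
      by linarith
    moreover have "log 2 (d / \<delta>) - log 2 (d / R') = log 2 (R' / \<delta>)"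
      using assms d by (simp add: log_divide)
    ultimately have "real (card J) \<le> \<bar>log 2 (R' / \<delta>)\<bar> + 1" by linarith
    then show ?thesis using finite_subset[OF sub] by simp
  qed
  then show "finite J" "real (card J) \<le> \<bar>log 2 (R' / \<delta>)\<bar> + 1" by auto
qed

text \<open>\<open>G\<close> behaves like the jet of the \<open>p\<close>-th power of the norm. For the bump \<open>\<psi>\<close> of the
  preceding lemma \<open>G 0 x = (\<Sum>j. 2 powr (j * p) * \<psi> (x / 2 powr j))\<close>, where \<open>j\<close> ranges over the
  integers and the number of nonzero terms is bounded independently of \<open>x\<close>.\<close>

definition pjet :: "real \<Rightarrow> nat \<Rightarrow> real \<Rightarrow> real \<Rightarrow> real \<Rightarrow>
    (nat \<Rightarrow> 'x::real_normed_vector \<Rightarrow> (nat \<Rightarrow> 'x) \<Rightarrow> real) \<Rightarrow> bool" where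
  "pjet p n \<alpha> K c G \<longleftrightarrow> 0 \<le> K \<and> 0 < c \<and>
     (\<forall>k\<le>n. \<forall>x. slotlin UNIV {..<k} (G k x)) \<and>
     (\<forall>k\<le>n. \<forall>x vs. \<bar>G k x vs\<bar> \<le> K * (norm x powr (p - real k) * (\<Prod>i<k. norm (vs i)))) \<and>
     (\<forall>k\<le>n. \<forall>x y vs. \<bar>G k x vs - G k y vs\<bar>
        \<le> K * ((norm x + norm y) powr (p - real k - \<alpha>) * norm (x - y) powr \<alpha> * (\<Prod>i<k. norm (vs i)))) \<and>
     (\<forall>k<n. \<forall>x h vs. \<bar>G k (x + h) vs - G k x vs - G (Suc k) x (vs(k := h))\<bar>
        \<le> K * ((norm x + norm h) powr (p - real k - 1 - \<alpha>) * norm h powr (1 + \<alpha>) * (\<Prod>i<k. norm (vs i)))) \<and>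
     (\<forall>x vs. c * norm x powr p \<le> G 0 x vs)"

text \<open>The k-th derivative of the term at scale 2^i carries the factor 2^(i (p - k)). At an
  active scale 2^i is at most norm x / \<delta>, so nonnegative powers of 2^i are bounded by powers
  of norm x. Negative powers do not occur because n + \<alpha> \<le> p.\<close>

lemma pjet_exists:
  fixes \<psi> :: "'x::real_normed_vector \<Rightarrow> real"
  assumes j: "seminormed.jet (UNIV :: 'x set) norm UNIV n \<alpha> C \<psi> D"
    and \<alpha>: "0 < \<alpha>" and p: "real n + \<alpha> \<le> p"
    and \<psi>: "\<And>x. 0 \<le> \<psi> x" "\<And>x. norm x < \<delta> \<Longrightarrow> \<psi> x = 0" "\<And>x. R' < norm x \<Longrightarrow> \<psi> x = 0"
    "\<And>x. R \<le> norm x \<Longrightarrow> norm x \<le> 2 * R \<Longrightarrow> \<psi> x = \<kappa>" and pos: "0 < \<delta>" "0 < R" "0 < R'" "0 < \<kappa>"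
  obtains K c and G :: "nat \<Rightarrow> 'x \<Rightarrow> (nat \<Rightarrow> 'x) \<Rightarrow> real" where "pjet p n \<alpha> K c G"
proof -
  interpret X: seminormed "UNIV :: 'x set" norm by (rule seminormed_UNIV)
  have C: "0 \<le> C" by (rule X.jetD(2)[OF j])
  define T where "T = (\<lambda>(i::int) k x vs. (2 powr i) powr (p - real k) * D k ((1 / 2 powr i) *\<^sub>R x) vs)"
  \<comment> \<open>The active scales: those whose terms can be nonzero at x.\<close>
  define J where "J = (\<lambda>x::'x. {i::int. \<delta> \<le> norm x / 2 powr i \<and> norm x / 2 powr i \<le> R'})"
  define L where "L = \<bar>log 2 (R' / \<delta>)\<bar> + 1"
  have L: "0 \<le> L" by (simp add: L_def)
  have J: "finite (J x)" "real (card (J x)) \<le> L" for x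
    using card_dyadic_scales[OF pos(1,3), of "norm x"] by (auto simp: J_def L_def)
  define G where "G = (\<lambda>k x vs. \<Sum>i\<in>J x. T i k x vs)"
  have D0: "D 0 x vs = \<psi> x" for x vs by (rule X.jetD(3)[OF j]) simp
  \<comment> \<open>The region on which the hypotheses make \<open>\<psi>\<close> vanish is open, so
    all derivatives vanish there too.\<close>
  have Dzero: "D k x vs = 0" if "k \<le> n" "norm x < \<delta> \<or> R' < norm x" for k x vs
  proof (cases k)
    case 0
    then show ?thesis using that \<psi> D0 by auto
  next
    case (Suc i)
    have op1: "\<forall>\<^sub>F t in nhds 0. norm (x + t *\<^sub>R h) < \<delta>" if "norm x < \<delta>" for x h :: 'x
      using X.eventually_line_nball[of x h 0 \<delta>] that by simp
    have op2: "\<forall>\<^sub>F t in nhds 0. R' < norm (x + t *\<^sub>R h)" if "R' < norm x" for x h :: 'x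
      using X.eventually_line_outside[of x h 0 R'] that by simp
    have "D (Suc i) x vs = 0"
      by (rule X.jet_const_on[OF j, of "{x. norm x < \<delta> \<or> R' < norm x}" 0])
         (use that Suc \<psi> in \<open>auto elim!: eventually_mono[OF op1] eventually_mono[OF op2]\<close>)
    then show ?thesis using Suc by simp
  qed
  have Tzero: "T i k x vs = 0" if "k \<le> n" "i \<notin> J x" for i k x vs
  proof -
    have "norm ((1 / 2 powr i) *\<^sub>R x) < \<delta> \<or> R' < norm ((1 / 2 powr i) *\<^sub>R x)"
      using that(2) by (auto simp: J_def)
    then show ?thesis unfolding T_def using Dzero[OF that(1)] by simp
  qed
  have Gsup: "G k x vs = (\<Sum>i\<in>I. T i k x vs)" if "k \<le> n" "finite I" "J x \<subseteq> I" for k x vs I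
    unfolding G_def using that Tzero by (intro sum.mono_neutral_left) auto
  \<comment> \<open>Dominates \<open>(1 / \<delta>) powr e\<close> for every exponent e between 0
    and p, whether \<delta> is above or below 1.\<close>
  define q where "q = (1 + 1 / \<delta>) powr p"
  have q0: "0 \<le> q" by (simp add: q_def)
  have tpow: "(2 powr i) powr e \<le> q * d powr e"
    if "i \<in> J x" "norm x \<le> d" "0 \<le> e" "e \<le> p" for i x d e
  proof -
    have "2 powr i \<le> norm x / \<delta>" using that(1) pos by (auto simp: J_def field_simps)
    also have "\<dots> \<le> d / \<delta>" using that pos by (simp add: divide_right_mono)
    finally have "(2 powr i) powr e \<le> (1 / \<delta> * d) powr e" using that by (intro powr_mono2) auto
    also have "\<dots> = (1 / \<delta>) powr e * d powr e" by (rule powr_mult)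
    also have "\<dots> \<le> q * d powr e"
    proof (rule mult_right_mono)
      have "(1 / \<delta>) powr e \<le> (1 + 1 / \<delta>) powr e" using that pos by (intro powr_mono2) auto
      also have "\<dots> \<le> q" unfolding q_def using that pos by (intro powr_mono) auto
      finally show "(1 / \<delta>) powr e \<le> q" .
    qed simp
    finally show ?thesis .
  qed
  \<comment> \<open>Differences are summed over the active scales of two points, of which there are
    at most \<open>2 * L\<close>.\<close>
  define K where "K = 2 * L * (q * C)"
  have K: "0 \<le> K" using L q0 C by (simp add: K_def)
  have sum_bound: "\<bar>\<Sum>i\<in>J x \<union> J y. f i\<bar> \<le> K * B"
    if f: "\<And>i. i \<in> J x \<union> J y \<Longrightarrow> \<bar>f i\<bar> \<le> q * C * B" and B: "0 \<le> B" for f x y B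
  proof -
    have "\<bar>\<Sum>i\<in>J x \<union> J y. f i\<bar> \<le> (\<Sum>i\<in>J x \<union> J y. q * C * B)"
      by (intro order_trans[OF sum_abs] sum_mono f)
    also have "\<dots> = real (card (J x \<union> J y)) * (q * C * B)" by simp
    also have "\<dots> \<le> (2 * L) * (q * C * B)"
    proof (rule mult_right_mono)
      have "card (J x \<union> J y) \<le> card (J x) + card (J y)" by (rule card_Un_le)
      then show "real (card (J x \<union> J y)) \<le> 2 * L" using J(2)[of x] J(2)[of y] by linarith
      show "0 \<le> q * C * B" using q0 C B by simp
    qed
    finally show ?thesis by (simp add: K_def mult_ac)
  qed
  have sl: "slotlin UNIV {..<k} (D k x)" if "k \<le> n" for k x using X.jetD(4)[OF j that] by simp
  have pk: "0 \<le> p - real k - \<alpha>" "p - real k \<le> p" "p - real k - \<alpha> \<le> p" if "k \<le> n" for k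
    using that p \<alpha> by auto
  have pn0: "0 \<le> (\<Prod>i<k. norm (vs i))" for k and vs :: "nat \<Rightarrow> 'x" by (intro prod_nonneg) auto
  \<comment> \<open>The lower bound comes from a single scale 2^i \<ge> norm x / (2 R), whose term
    is \<kappa> times the p-th power of 2^i.\<close>
  define c where "c = \<kappa> / (2 * R) powr p"
  have "pjet p n \<alpha> K c G"
    unfolding pjet_def
  proof (intro conjI allI impI)
    show "0 \<le> K" by fact
    show "0 < c" using pos by (simp add: c_def)
    fix k x assume k: "k \<le> n"
    show "slotlin UNIV {..<k} (G k x)"
      unfolding G_def T_def by (intro slotlin_sum slotlin_cmult sl k)
    fix vs :: "nat \<Rightarrow> 'x"
    have "\<bar>\<Sum>i\<in>J x \<union> J x. T i k x vs\<bar> \<le> K * (norm x powr (p - real k) * (\<Prod>i<k. norm (vs i)))"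
    proof (rule sum_bound)
      fix i assume i: "i \<in> J x \<union> J x"
      have "\<bar>D k ((1 / 2 powr i) *\<^sub>R x) vs\<bar> \<le> C * (\<Prod>i<k. norm (vs i))"
        by (rule mboundD[OF X.jetD(5)[OF j k]]) auto
      moreover have "(2 powr i) powr (p - real k) \<le> q * norm x powr (p - real k)"
        using i k pk[OF k] \<alpha> by (intro tpow[of i x]) auto
      ultimately have "\<bar>T i k x vs\<bar> \<le> (q * norm x powr (p - real k)) * (C * (\<Prod>i<k. norm (vs i)))"
        unfolding T_def abs_mult using q0 by (intro mult_mono) auto
      then show "\<bar>T i k x vs\<bar> \<le> q * C * (norm x powr (p - real k) * (\<Prod>i<k. norm (vs i)))"
        by (simp add: mult_ac)
    qed (use pn0 in auto)
    then show "\<bar>G k x vs\<bar> \<le> K * (norm x powr (p - real k) * (\<Prod>i<k. norm (vs i)))" by (simp add: G_def)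
    fix y
    let ?B = "(norm x + norm y) powr (p - real k - \<alpha>) * norm (x - y) powr \<alpha> * (\<Prod>i<k. norm (vs i))"
    have "\<bar>\<Sum>i\<in>J x \<union> J y. T i k x vs - T i k y vs\<bar> \<le> K * ?B"
    proof (rule sum_bound)
      fix i assume i: "i \<in> J x \<union> J y"
      let ?t = "2 powr i"
      have "(1 / ?t) *\<^sub>R x - (1 / ?t) *\<^sub>R y = (1 / ?t) *\<^sub>R (x - y)" by (simp add: algebra_simps)
      then have "norm ((1 / ?t) *\<^sub>R x - (1 / ?t) *\<^sub>R y) = norm (x - y) / ?t" by simp
      then have e: "norm ((1 / ?t) *\<^sub>R x - (1 / ?t) *\<^sub>R y) powr \<alpha> = norm (x - y) powr \<alpha> / ?t powr \<alpha>"
        by (simp add: powr_divide)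
      have "\<bar>D k ((1 / ?t) *\<^sub>R x) vs - D k ((1 / ?t) *\<^sub>R y) vs\<bar> \<le> C * norm ((1 / ?t) *\<^sub>R x - (1 / ?t) *\<^sub>R y) powr \<alpha> * (\<Prod>i<k. norm (vs i))"
        by (rule mboundD[OF X.jetD(6)[OF j k]]) auto
      then have "\<bar>T i k x vs - T i k y vs\<bar> \<le> ?t powr (p - real k) * (C * (norm (x - y) powr \<alpha> / ?t powr \<alpha>) * (\<Prod>i<k. norm (vs i)))"
        unfolding T_def right_diff_distrib[symmetric] abs_mult e abs_of_nonneg[OF powr_ge_zero]
        by (intro mult_left_mono) auto
      also have "\<dots> = ?t powr (p - real k - \<alpha>) * (C * norm (x - y) powr \<alpha> * (\<Prod>i<k. norm (vs i)))"
        by (simp add: powr_diff)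
      also have "\<dots> \<le> (q * (norm x + norm y) powr (p - real k - \<alpha>)) * (C * norm (x - y) powr \<alpha> * (\<Prod>i<k. norm (vs i)))"
      proof (rule mult_right_mono)
        show "?t powr (p - real k - \<alpha>) \<le> q * (norm x + norm y) powr (p - real k - \<alpha>)"
          using i pk[OF k] tpow[of i x "norm x + norm y"] tpow[of i y "norm x + norm y"] by auto
      qed (use C pn0 in auto)
      finally show "\<bar>T i k x vs - T i k y vs\<bar> \<le> q * C * ?B" by (simp add: mult_ac)
    qed (use pn0 in auto)
    moreover have "G k x vs - G k y vs = (\<Sum>i\<in>J x \<union> J y. T i k x vs - T i k y vs)"
      using Gsup[OF k, of "J x \<union> J y"] J by (simp add: sum_subtractf)
    ultimately show "\<bar>G k x vs - G k y vs\<bar> \<le> K * ?B" by simp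
  next
    fix k and x h :: 'x and vs :: "nat \<Rightarrow> 'x" assume k: "k < n"
    let ?B = "(norm x + norm h) powr (p - real k - 1 - \<alpha>) * norm h powr (1 + \<alpha>) * (\<Prod>i<k. norm (vs i))"
    have "\<bar>\<Sum>i\<in>J (x + h) \<union> J x. T i k (x + h) vs - T i k x vs - T i (Suc k) x (vs(k := h))\<bar> \<le> K * ?B"
    proof (rule sum_bound)
      fix i assume i: "i \<in> J (x + h) \<union> J x"
      define t where "t = 2 powr (real_of_int i)"
      have t: "0 < t" by (simp add: t_def)
      define y where "y = (1 / t) *\<^sub>R x"
      define g where "g = (1 / t) *\<^sub>R h"
      have hg: "h = t *\<^sub>R g" "norm g = norm h / t" using t by (auto simp: g_def)
      \<comment> \<open>Writing h as t g supplies the factor t by which the scalings of levels k and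
        k + 1 differ, so the remainder at this scale is a multiple of a Taylor remainder of
        \<open>D\<close>.\<close>
      have "D (Suc k) y ((vs(k := 0))(k := t *\<^sub>R g)) = t * D (Suc k) y ((vs(k := 0))(k := g))"
        by (rule slotlin_scale[OF sl]) (use k in auto)
      then have lin: "D (Suc k) y (vs(k := h)) = t * D (Suc k) y (vs(k := g))" using hg(1) by simp
      have "T i k (x + h) vs - T i k x vs - T i (Suc k) x (vs(k := h))
          = t powr (p - real k) * (D k (y + g) vs - D k y vs - D (Suc k) y (vs(k := g)))"
      proof -
        have "t powr (p - real (Suc k)) * t = t powr (p - real k)"
          using t powr_add[of t "p - real (Suc k)" 1] by simp
        then show ?thesis
          unfolding T_def t_def[symmetric] y_def[symmetric] lin scaleR_add_right g_def[symmetric]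
          by (simp add: right_diff_distrib mult.assoc[symmetric])
      qed
      also have "\<bar>\<dots>\<bar> \<le> t powr (p - real k) * (C * norm g powr \<alpha> * norm g * (\<Prod>i<k. norm (vs i)))"
        unfolding abs_mult abs_of_nonneg[OF powr_ge_zero]
        using X.jet_taylor[OF j k, of g vs y] \<alpha> by (intro mult_left_mono) auto
      also have "\<dots> = t powr (p - real k - 1 - \<alpha>) * (C * norm h powr (1 + \<alpha>) * (\<Prod>i<k. norm (vs i)))"
      proof -
        have "norm h powr (1 + \<alpha>) = norm h powr \<alpha> * norm h"
          by (simp add: powr_add)
        moreover have "t powr (p - real k - 1 - \<alpha>) = t powr (p - real k) / (t * t powr \<alpha>)"
          using t by (simp add: powr_diff)
        ultimately show ?thesis unfolding hg(2) by (simp add: powr_divide mult_ac)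
      qed
      also have "\<dots> \<le> (q * (norm x + norm h) powr (p - real k - 1 - \<alpha>)) * (C * norm h powr (1 + \<alpha>) * (\<Prod>i<k. norm (vs i)))"
      proof (rule mult_right_mono)
        have e: "0 \<le> p - real k - 1 - \<alpha>" "p - real k - 1 - \<alpha> \<le> p" using k p \<alpha> by auto
        show "t powr (p - real k - 1 - \<alpha>) \<le> q * (norm x + norm h) powr (p - real k - 1 - \<alpha>)"
          unfolding t_def
          using i tpow[OF _ _ e, of i "x + h" "norm x + norm h"] tpow[OF _ _ e, of i x "norm x + norm h"]
            norm_triangle_ineq[of x h] by auto
      qed (use C pn0 in auto)
      finally show "\<bar>T i k (x + h) vs - T i k x vs - T i (Suc k) x (vs(k := h))\<bar> \<le> q * C * ?B"
        by (simp add: mult_ac)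
    qed (use pn0 in auto)
    moreover have "G k (x + h) vs - G k x vs - G (Suc k) x (vs(k := h))
        = (\<Sum>i\<in>J (x + h) \<union> J x. T i k (x + h) vs - T i k x vs - T i (Suc k) x (vs(k := h)))"
      using Gsup[of k "J (x + h) \<union> J x"] Gsup[of "Suc k" "J (x + h) \<union> J x"] J k by (simp add: sum_subtractf)
    ultimately show "\<bar>G k (x + h) vs - G k x vs - G (Suc k) x (vs(k := h))\<bar> \<le> K * ?B" by simp
  next
    fix x and vs :: "nat \<Rightarrow> 'x"
    have T0: "0 \<le> T i 0 x vs" for i unfolding T_def D0 using \<psi>(1) by simp
    show "c * norm x powr p \<le> G 0 x vs"
    proof (cases "x = 0")
      case True
      then show ?thesis using T0 by (simp add: G_def sum_nonneg)
    next
      case False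
      \<comment> \<open>The largest i with \<open>2 powr i \<le> norm x / R\<close>; then x / 2^i
        lies in the annulus on which \<open>\<psi>\<close> equals \<kappa>.\<close>
      define i where "i = \<lfloor>log 2 (norm x / R)\<rfloor>"
      define t where "t = 2 powr (real_of_int i)"
      have xR: "0 < norm x / R" using False pos by simp
      have "t \<le> 2 powr (log 2 (norm x / R))" unfolding t_def i_def by (intro powr_mono) auto
      then have t1: "t \<le> norm x / R" using xR by simp
      have "2 powr (log 2 (norm x / R)) \<le> 2 powr (real_of_int i + 1)" unfolding i_def by (intro powr_mono) linarith+
      then have t2: "norm x / R \<le> 2 * t" using xR by (simp add: t_def powr_add)
      have t: "0 < t" by (simp add: t_def)
      have "R \<le> norm ((1 / t) *\<^sub>R x)" "norm ((1 / t) *\<^sub>R x) \<le> 2 * R"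
        using t1 t2 t pos by (simp_all add: field_simps)
      then have "T i 0 x vs = t powr p * \<kappa>" unfolding T_def D0 t_def[symmetric] using \<psi>(4) by simp
      moreover have "(norm x / (2 * R)) powr p \<le> t powr p"
        using t2 pos p \<alpha> by (intro powr_mono2) (auto simp: field_simps)
      ultimately have le: "c * norm x powr p \<le> T i 0 x vs"
        using pos mult_right_mono[of "(norm x / (2 * R)) powr p" "t powr p" \<kappa>]
        by (simp add: c_def powr_divide mult.commute)
      moreover have "0 < c * norm x powr p" using False pos by (simp add: c_def)
      \<comment> \<open>A positive term forces its scale to be active.\<close>
      ultimately have "i \<in> J x" using Tzero[of 0 i x vs] by force
      then have "T i 0 x vs \<le> G 0 x vs"
        unfolding G_def using T0 J(1) by (intro member_le_sum) auto
      then show ?thesis using le by simp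
    qed
  qed
  then show ?thesis by (rule that)
qed

section \<open>Continuity and measurability of the integrands\<close>

lemma pjetD:
  assumes "pjet p n \<alpha> K c G"
  shows "0 \<le> K" "0 < c" "k \<le> n \<Longrightarrow> slotlin UNIV {..<k} (G k x)"
    "k \<le> n \<Longrightarrow> \<bar>G k x vs\<bar> \<le> K * (norm x powr (p - real k) * (\<Prod>i<k. norm (vs i)))"
    "k \<le> n \<Longrightarrow> \<bar>G k x vs - G k y vs\<bar>
        \<le> K * ((norm x + norm y) powr (p - real k - \<alpha>) * norm (x - y) powr \<alpha> * (\<Prod>i<k. norm (vs i)))"
    "k < n \<Longrightarrow> \<bar>G k (x + h) vs - G k x vs - G (Suc k) x (vs(k := h))\<bar>
        \<le> K * ((norm x + norm h) powr (p - real k - 1 - \<alpha>) * norm h powr (1 + \<alpha>) * (\<Prod>i<k. norm (vs i)))"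
    "c * norm x powr p \<le> G 0 x vs"
  using assms unfolding pjet_def by (simp_all only:)

text \<open>The slots are moved to their limits one at a time. The error of one move is
  \<open>T\<close> with a null sequence in that slot and convergent entries elsewhere, so it tends
  to 0.\<close>

lemma slotlin_bounded_tendsto:
  fixes v :: "nat \<Rightarrow> nat \<Rightarrow> 'x::real_normed_vector"
  assumes T: "slotlin UNIV {..<k} T" and C: "\<And>vs. \<bar>T vs\<bar> \<le> C * (\<Prod>i<k. norm (vs i))"
    and lim: "\<And>i. i < k \<Longrightarrow> (\<lambda>j. v j i) \<longlonglongrightarrow> w i"
  shows "(\<lambda>j. T (v j)) \<longlonglongrightarrow> T w"
proof -
  have "m \<le> k \<Longrightarrow> (\<lambda>j. T (\<lambda>i. if i < m then v j i else w i)) \<longlonglongrightarrow> T w" for m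
  proof (induction m)
    case 0
    then show ?case by simp
  next
    case (Suc m)
    define W where "W = (\<lambda>j i. if i < m then v j i else w i)"
    have eq: "T ((W j)(m := 1 *\<^sub>R v j m + (-1) *\<^sub>R w m)) = 1 * T ((W j)(m := v j m)) + (-1) * T ((W j)(m := w m))" for j
      by (rule slotlin_lin[OF T]) (use Suc.prems in auto)
    have upd: "(W j)(m := v j m) = (\<lambda>i. if i < Suc m then v j i else w i)" "(W j)(m := w m) = W j" for j
      by (auto simp: W_def fun_eq_iff)
    have "(\<lambda>j. \<Prod>i<k. norm (((W j)(m := v j m - w m)) i)) \<longlonglongrightarrow> (\<Prod>i<k. if i = m then 0 else norm (w i))"
    proof (rule tendsto_prod)
      fix i assume i: "i \<in> {..<k}"
      have "(\<lambda>j. v j i - w i) \<longlonglongrightarrow> 0" using lim[of i] i by (simp add: LIM_zero)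
      then show "(\<lambda>j. norm (((W j)(m := v j m - w m)) i)) \<longlonglongrightarrow> (if i = m then 0 else norm (w i))"
        using i lim[of i] by (cases "i < m") (auto simp: W_def tendsto_norm_zero tendsto_norm)
    qed
    moreover have "(\<Prod>i<k. if i = m then 0 else norm (w i)) = 0"
      using Suc.prems by (intro prod_zero) auto
    ultimately have "(\<lambda>j. C * (\<Prod>i<k. norm (((W j)(m := v j m - w m)) i))) \<longlonglongrightarrow> 0"
      using tendsto_mult_right_zero by fastforce
    then have "(\<lambda>j. T ((W j)(m := v j m - w m))) \<longlonglongrightarrow> 0"
      by (rule Lim_null_comparison[rotated]) (intro always_eventually allI, simp only: real_norm_def C)
    moreover have "T ((W j)(m := v j m - w m)) = T ((W j)(m := v j m)) - T (W j)" for j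
      using eq[of j] upd(2)[of j] by simp
    ultimately have "(\<lambda>j. (T ((W j)(m := v j m)) - T (W j)) + T (W j)) \<longlonglongrightarrow> 0 + T w"
      using Suc by (intro tendsto_add) (auto simp: W_def)
    then show ?case by (simp add: upd(1))
  qed
  from this[of k] have "(\<lambda>j. T (\<lambda>i. if i < k then v j i else w i)) \<longlonglongrightarrow> T w" by simp
  moreover have "T (\<lambda>i. if i < k then v j i else w i) = T (v j)" for j
    by (rule slotlin_cong[OF T]) simp
  ultimately show ?thesis by simp
qed

text \<open>Joint continuity in the point and the directions is the condition under which
  \<open>strongly_measurable_compose\<close> applies to the integrands.\<close>

lemma pjet_tendsto:
  fixes G :: "nat \<Rightarrow> 'x::real_normed_vector \<Rightarrow> (nat \<Rightarrow> 'x) \<Rightarrow> real"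
  assumes G: "pjet p n \<alpha> K c G" and k: "k \<le> n" and \<alpha>: "0 < \<alpha>" and p: "real n + \<alpha> \<le> p"
    and x: "x \<longlonglongrightarrow> y" and v: "\<And>i. i < k \<Longrightarrow> (\<lambda>j. v j i) \<longlonglongrightarrow> w i"
  shows "(\<lambda>j. G k (x j) (v j)) \<longlonglongrightarrow> G k y w"
proof -
  let ?e = "p - real k - \<alpha>"
  have e: "0 \<le> ?e" using k p by simp
  \<comment> \<open>The summand 1 keeps the base away from 0, where \<open>powr\<close> is
    discontinuous if the exponent is 0.\<close>
  have "(\<lambda>j. K * ((1 + norm (x j) + norm y) powr ?e * norm (x j - y) powr \<alpha> * (\<Prod>i<k. norm (v j i))))
      \<longlonglongrightarrow> K * ((1 + norm y + norm y) powr ?e * 0 * (\<Prod>i<k. norm (w i)))"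
  proof (intro tendsto_mult tendsto_const tendsto_prod tendsto_norm)
    have "1 + norm y + norm y \<noteq> 0" using norm_ge_zero[of y] by linarith
    then show "(\<lambda>j. (1 + norm (x j) + norm y) powr ?e) \<longlonglongrightarrow> (1 + norm y + norm y) powr ?e"
      by (intro tendsto_powr tendsto_add tendsto_const tendsto_norm x)
    have "(\<lambda>j. norm (x j - y)) \<longlonglongrightarrow> 0" using x by (simp add: LIM_zero tendsto_norm_zero)
    then show "(\<lambda>j. norm (x j - y) powr \<alpha>) \<longlonglongrightarrow> 0"
      by (rule tendsto_zero_powrI) (use \<alpha> in auto)
    show "(\<lambda>j. v j i) \<longlonglongrightarrow> w i" if "i \<in> {..<k}" for i using v that by simp
  qed
  then have "(\<lambda>j. K * ((1 + norm (x j) + norm y) powr ?e * norm (x j - y) powr \<alpha> * (\<Prod>i<k. norm (v j i)))) \<longlonglongrightarrow> 0"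
    by simp
  then have "(\<lambda>j. G k (x j) (v j) - G k y (v j)) \<longlonglongrightarrow> 0"
  proof (rule Lim_null_comparison[rotated], intro always_eventually allI)
    fix j
    have "\<bar>G k (x j) (v j) - G k y (v j)\<bar>
      \<le> K * ((norm (x j) + norm y) powr ?e * norm (x j - y) powr \<alpha> * (\<Prod>i<k. norm (v j i)))"
      by (rule pjetD(5)[OF G k])
    also have "\<dots> \<le> K * ((1 + norm (x j) + norm y) powr ?e * norm (x j - y) powr \<alpha> * (\<Prod>i<k. norm (v j i)))"
      using e pjetD(1)[OF G] by (intro mult_left_mono mult_right_mono powr_mono2 prod_nonneg) auto
    finally show "norm (G k (x j) (v j) - G k y (v j))
      \<le> K * ((1 + norm (x j) + norm y) powr ?e * norm (x j - y) powr \<alpha> * (\<Prod>i<k. norm (v j i)))" by simp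
  qed
  moreover have "(\<lambda>j. G k y (v j)) \<longlonglongrightarrow> G k y w"
    by (rule slotlin_bounded_tendsto[OF pjetD(3)[OF G k], where C = "K * norm y powr (p - real k)"])
       (use pjetD(4)[OF G k] v in \<open>auto simp: mult.assoc\<close>)
  ultimately have "(\<lambda>j. (G k (x j) (v j) - G k y (v j)) + G k y (v j)) \<longlonglongrightarrow> 0 + G k y w"
    by (rule tendsto_add)
  then show ?thesis by simp
qed

lemma pjet_measurable:
  fixes G :: "nat \<Rightarrow> 'x::real_normed_vector \<Rightarrow> (nat \<Rightarrow> 'x) \<Rightarrow> real"
  assumes G: "pjet p n \<alpha> K c G" and k: "k \<le> n" and \<alpha>: "0 < \<alpha>" and p: "real n + \<alpha> \<le> p"
    and u: "u \<in> Lp_space M q" and vs: "\<And>i. i < k \<Longrightarrow> vs i \<in> Lp_space M q"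
  shows "(\<lambda>s. G k (u s) (\<lambda>i. vs i s)) \<in> borel_measurable (completion M)"
proof -
  define w where "w = (\<lambda>i. case i of 0 \<Rightarrow> u | Suc i \<Rightarrow> vs i)"
  define \<Phi> where "\<Phi> = (\<lambda>a. G k (a 0) (\<lambda>i. a (Suc i)))"
  have "strongly_measurable M (\<lambda>s. \<Phi> (\<lambda>i. w i s))"
  proof (rule strongly_measurable_compose[where m = "Suc k" and \<Phi> = \<Phi> and w = w])
    show "strongly_measurable M (w i)" if "i < Suc k" for i
      using that u vs by (cases i) (auto simp: w_def Lp_space_iff)
    fix a :: "nat \<Rightarrow> nat \<Rightarrow> 'x" and b
    assume "\<And>i. i < Suc k \<Longrightarrow> (\<lambda>j. a j i) \<longlonglongrightarrow> b i"
    then show "(\<lambda>j. \<Phi> (a j)) \<longlonglongrightarrow> \<Phi> b"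
      unfolding \<Phi>_def by (intro pjet_tendsto[OF G k \<alpha> p]) auto
  qed
  then have "strongly_measurable M (\<lambda>s. G k (u s) (\<lambda>i. vs i s))" by (simp add: \<Phi>_def w_def)
  then show ?thesis by (rule strongly_measurable_imp_measurable)
qed

lemma DERIV_of_remainder:
  fixes f :: "real \<Rightarrow> real"
  assumes "0 < \<alpha>" and Q: "\<And>t. \<bar>t\<bar> \<le> 1 \<Longrightarrow> \<bar>f t - f 0 - t * L\<bar> \<le> Q * \<bar>t\<bar> powr (1 + \<alpha>)"
  shows "(f has_real_derivative L) (at 0)"
proof -
  have "((\<lambda>t. (f t - f 0) / t - L) \<longlongrightarrow> 0) (at 0)"
  proof (rule Lim_null_comparison)
    have "((\<lambda>t::real. \<bar>t\<bar>) \<longlongrightarrow> 0) (at 0)" by (simp add: tendsto_rabs_zero)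
    then have "((\<lambda>t::real. \<bar>t\<bar> powr \<alpha>) \<longlongrightarrow> 0) (at 0)"
      by (rule tendsto_zero_powrI) (use assms in auto)
    then show "((\<lambda>t::real. Q * \<bar>t\<bar> powr \<alpha>) \<longlongrightarrow> 0) (at 0)" by (rule tendsto_mult_right_zero)
    have "\<forall>\<^sub>F t in at (0::real). t \<noteq> 0 \<and> \<bar>t\<bar> \<le> 1"
      unfolding eventually_at by (intro exI[of _ 1]) auto
    then show "\<forall>\<^sub>F t in at 0. norm ((f t - f 0) / t - L) \<le> Q * \<bar>t\<bar> powr \<alpha>"
    proof eventually_elim
      case (elim t)
      have "(f t - f 0) / t - L = (f t - f 0 - t * L) / t" using elim by (simp add: field_simps)
      then have "norm ((f t - f 0) / t - L) = \<bar>f t - f 0 - t * L\<bar> / \<bar>t\<bar>" by simp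
      also have "\<dots> \<le> Q * \<bar>t\<bar> powr (1 + \<alpha>) / \<bar>t\<bar>" using Q elim by (intro divide_right_mono) auto
      also have "\<dots> = Q * \<bar>t\<bar> powr \<alpha>" using elim by (simp add: powr_add)
      finally show ?case .
    qed
  qed
  then have "((\<lambda>t. (f t - f 0) / t) \<longlongrightarrow> L) (at 0)" by (rule LIM_zero_cancel)
  then show ?thesis by (simp add: DERIV_def)
qed

text \<open>The integral of a superposition operator; level 0 is the functional on the
  Lebesgue-Bochner space, the higher levels are its candidate derivatives.\<close>

definition nemytskii :: "'s measure \<Rightarrow> (nat \<Rightarrow> 'x \<Rightarrow> (nat \<Rightarrow> 'x) \<Rightarrow> real) \<Rightarrow>
    nat \<Rightarrow> ('s \<Rightarrow> 'x) \<Rightarrow> (nat \<Rightarrow> 's \<Rightarrow> 'x) \<Rightarrow> real" where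
  "nemytskii M G k u vs = (\<integral>s. G k (u s) (\<lambda>i. vs i s) \<partial>(completion M))"

section \<open>The integral functional and its derivatives\<close>

context
  fixes M :: "'s measure" and G :: "nat \<Rightarrow> 'x::real_normed_vector \<Rightarrow> (nat \<Rightarrow> 'x) \<Rightarrow> real"
    and p \<alpha> K c :: real and n :: nat
  assumes G: "pjet p n \<alpha> K c G" and \<alpha>: "0 < \<alpha>" and p: "real n + \<alpha> \<le> p" "1 \<le> p"
begin

interpretation L: seminormed "Lp_space M p :: ('s \<Rightarrow> 'x) set" "Lp_norm M p"
  by (rule seminormed_Lp[OF p(2)])

lemma nemytskii_bound:
  assumes k: "k \<le> n" and u: "u \<in> Lp_space M p" and vs: "\<And>i. i < k \<Longrightarrow> vs i \<in> Lp_space M p"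
  shows "integrable (completion M) (\<lambda>s. G k (u s) (\<lambda>i. vs i s))"
    "\<bar>nemytskii M G k u vs\<bar> \<le> K * (Lp_norm M p u powr (p - real k) * (\<Prod>i<k. Lp_norm M p (vs i)))"
proof -
  \<comment> \<open>Splits the single power of norm u into the two exponents that
    \<open>Lp_holder_slots\<close> takes.\<close>
  have sp: "x powr (p - real k) = x powr (p - real k - \<alpha>) * x powr \<alpha>" for x :: real
    by (simp add: powr_add[symmetric])
  note * = Lp_holder_slots[where a = "p - real k - \<alpha>" and b = \<alpha> and k = k and A = "\<lambda>s. norm (u s)" and B = "\<lambda>s. norm (u s)"
      and vs = vs and K = K and H = "\<lambda>s. G k (u s) (\<lambda>i. vs i s)" and M = M and p = p]
  have le: "\<bar>G k (u s) (\<lambda>i. vs i s)\<bar>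
      \<le> K * (norm (u s) powr (p - real k - \<alpha>) * norm (u s) powr \<alpha> * (\<Prod>i<k. norm (vs i s)))" for s
    using pjetD(4)[OF G k, of "u s" "\<lambda>i. vs i s"] unfolding sp .
  show "integrable (completion M) (\<lambda>s. G k (u s) (\<lambda>i. vs i s))"
    by (rule *(1)) (use k p \<alpha> u vs le pjetD(1)[OF G] in \<open>auto simp: Lp_norm_fun intro: pjet_measurable[OF G k \<alpha> p(1)]\<close>)
  have "\<bar>\<integral>s. G k (u s) (\<lambda>i. vs i s) \<partial>(completion M)\<bar> \<le> K * (Lp_norm M p (\<lambda>s. norm (u s)) powr (p - real k - \<alpha>)
      * Lp_norm M p (\<lambda>s. norm (u s)) powr \<alpha> * (\<Prod>i<k. Lp_norm M p (vs i)))"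
    by (rule *(2)) (use k p \<alpha> u vs le pjetD(1)[OF G] in \<open>auto simp: Lp_norm_fun intro: pjet_measurable[OF G k \<alpha> p(1)]\<close>)
  then show "\<bar>nemytskii M G k u vs\<bar> \<le> K * (Lp_norm M p u powr (p - real k) * (\<Prod>i<k. Lp_norm M p (vs i)))"
    unfolding nemytskii_def Lp_norm_fun(2)[OF u] sp .
qed

lemma Lp_norm_sum_fun:
  assumes u: "(u :: 's \<Rightarrow> 'x) \<in> Lp_space M p" and v: "(v :: 's \<Rightarrow> 'x) \<in> Lp_space M p"
  shows "(\<lambda>s. norm (u s) + norm (v s)) \<in> Lp_space M p"
    "Lp_norm M p (\<lambda>s. norm (u s) + norm (v s)) \<le> Lp_norm M p u + Lp_norm M p v"
  using Lp_add[OF Lp_norm_fun(1)[OF u] Lp_norm_fun(1)[OF v] p(2)] u v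
  by (simp_all add: plus_fun_def Lp_norm_fun(2))

text \<open>Hoelder's inequality with exponent p - k - \<alpha> for the size, \<alpha> for the
  increment and 1 for each of the k directions.\<close>

lemma nemytskii_holder:
  assumes k: "k \<le> n" and u: "u \<in> Lp_space M p" and v: "v \<in> Lp_space M p"
    and vs: "\<And>i. i < k \<Longrightarrow> vs i \<in> Lp_space M p"
  shows "\<bar>nemytskii M G k u vs - nemytskii M G k v vs\<bar> \<le> K * ((Lp_norm M p u + Lp_norm M p v) powr (p - real k - \<alpha>)
      * Lp_norm M p (u - v) powr \<alpha> * (\<Prod>i<k. Lp_norm M p (vs i)))"
proof -
  note A = Lp_norm_sum_fun[OF u v]
  have uv: "u - v \<in> Lp_space M p" using u v by blast
  have "\<bar>\<integral>s. G k (u s) (\<lambda>i. vs i s) - G k (v s) (\<lambda>i. vs i s) \<partial>(completion M)\<bar>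
      \<le> K * (Lp_norm M p (\<lambda>s. norm (u s) + norm (v s)) powr (p - real k - \<alpha>)
        * Lp_norm M p (\<lambda>s. norm ((u - v) s)) powr \<alpha> * (\<Prod>i<k. Lp_norm M p (vs i)))"
  proof (rule Lp_holder_slots(2))
    show "(\<lambda>s. G k (u s) (\<lambda>i. vs i s) - G k (v s) (\<lambda>i. vs i s)) \<in> borel_measurable (completion M)"
      using u v vs by (intro borel_measurable_diff pjet_measurable[OF G k \<alpha> p(1)]) auto
    show "\<bar>G k (u s) (\<lambda>i. vs i s) - G k (v s) (\<lambda>i. vs i s)\<bar>
      \<le> K * ((norm (u s) + norm (v s)) powr (p - real k - \<alpha>) * norm ((u - v) s) powr \<alpha> * (\<Prod>i<k. norm (vs i s)))" for s
      using pjetD(5)[OF G k, of "u s" "\<lambda>i. vs i s" "v s"] by simp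
  qed (use k p \<alpha> A vs Lp_norm_fun(1)[OF uv] pjetD(1)[OF G] in auto)
  also have "\<dots> \<le> K * ((Lp_norm M p u + Lp_norm M p v) powr (p - real k - \<alpha>)
      * Lp_norm M p (u - v) powr \<alpha> * (\<Prod>i<k. Lp_norm M p (vs i)))"
    unfolding Lp_norm_fun(2)[OF uv] using A(2) k p pjetD(1)[OF G]
    by (intro mult_left_mono mult_right_mono powr_mono2 prod_nonneg) (auto simp: Lp_norm_nonneg)
  also have "(\<integral>s. G k (u s) (\<lambda>i. vs i s) - G k (v s) (\<lambda>i. vs i s) \<partial>(completion M)) = nemytskii M G k u vs - nemytskii M G k v vs"
    unfolding nemytskii_def using u v vs by (intro Bochner_Integration.integral_diff nemytskii_bound k) auto
  finally show ?thesis .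
qed

text \<open>Hoelder's inequality with exponent p - k - 1 - \<alpha> for the size, 1 + \<alpha> for
  the increment and 1 for each direction; the first exponent is nonnegative since k < n.\<close>

lemma nemytskii_taylor:
  assumes k: "k < n" and u: "u \<in> Lp_space M p" and h: "h \<in> Lp_space M p"
    and vs: "\<And>i. i < k \<Longrightarrow> vs i \<in> Lp_space M p"
  shows "\<bar>nemytskii M G k (u + h) vs - nemytskii M G k u vs - nemytskii M G (Suc k) u (vs(k := h))\<bar>
    \<le> K * ((Lp_norm M p u + Lp_norm M p h) powr (p - real k - 1 - \<alpha>)
      * Lp_norm M p h powr (1 + \<alpha>) * (\<Prod>i<k. Lp_norm M p (vs i)))"
proof -
  note A = Lp_norm_sum_fun[OF u h]
  have uh: "u + h \<in> Lp_space M p" using u h by blast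
  have upd: "(\<lambda>i. (vs(k := h)) i s) = (\<lambda>i. vs i s)(k := h s)" for s by auto
  have vs': "i < Suc k \<Longrightarrow> (vs(k := h)) i \<in> Lp_space M p" for i using vs h by (auto simp: less_Suc_eq)
  let ?H = "\<lambda>s. G k ((u + h) s) (\<lambda>i. vs i s) - G k (u s) (\<lambda>i. vs i s) - G (Suc k) (u s) (\<lambda>i. (vs(k := h)) i s)"
  have "\<bar>\<integral>s. ?H s \<partial>(completion M)\<bar>
      \<le> K * (Lp_norm M p (\<lambda>s. norm (u s) + norm (h s)) powr (p - real k - 1 - \<alpha>)
        * Lp_norm M p (\<lambda>s. norm (h s)) powr (1 + \<alpha>) * (\<Prod>i<k. Lp_norm M p (vs i)))"
  proof (rule Lp_holder_slots(2))
    show "?H \<in> borel_measurable (completion M)"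
    proof (intro borel_measurable_diff)
      show "(\<lambda>s. G k ((u + h) s) (\<lambda>i. vs i s)) \<in> borel_measurable (completion M)"
        by (rule pjet_measurable[OF G _ \<alpha> p(1) uh vs]) (use k in auto)
      show "(\<lambda>s. G k (u s) (\<lambda>i. vs i s)) \<in> borel_measurable (completion M)"
        by (rule pjet_measurable[OF G _ \<alpha> p(1) u vs]) (use k in auto)
      show "(\<lambda>s. G (Suc k) (u s) (\<lambda>i. (vs(k := h)) i s)) \<in> borel_measurable (completion M)"
        by (rule pjet_measurable[OF G _ \<alpha> p(1) u vs']) (use k in auto)
    qed
    show "\<bar>?H s\<bar> \<le> K * ((norm (u s) + norm (h s)) powr (p - real k - 1 - \<alpha>) * norm (h s) powr (1 + \<alpha>)
        * (\<Prod>i<k. norm (vs i s)))" for s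
      using pjetD(6)[OF G k, of "u s" "h s" "\<lambda>i. vs i s"] unfolding upd by simp
  qed (use k p \<alpha> A vs h pjetD(1)[OF G] in \<open>auto intro: Lp_norm_fun(1)\<close>)
  also have "\<dots> \<le> K * ((Lp_norm M p u + Lp_norm M p h) powr (p - real k - 1 - \<alpha>)
      * Lp_norm M p h powr (1 + \<alpha>) * (\<Prod>i<k. Lp_norm M p (vs i)))"
    unfolding Lp_norm_fun(2)[OF h] using A(2) k p pjetD(1)[OF G]
    by (intro mult_left_mono mult_right_mono powr_mono2 prod_nonneg) (auto simp: Lp_norm_nonneg)
  also have "(\<integral>s. ?H s \<partial>(completion M)) = nemytskii M G k (u + h) vs - nemytskii M G k u vs - nemytskii M G (Suc k) u (vs(k := h))"
  proof -
    have i1: "integrable (completion M) (\<lambda>s. G k ((u + h) s) (\<lambda>i. vs i s))"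
      by (rule nemytskii_bound(1)[OF _ uh vs]) (use k in auto)
    have i2: "integrable (completion M) (\<lambda>s. G k (u s) (\<lambda>i. vs i s))"
      by (rule nemytskii_bound(1)[OF _ u vs]) (use k in auto)
    have i3: "integrable (completion M) (\<lambda>s. G (Suc k) (u s) (\<lambda>i. (vs(k := h)) i s))"
      by (rule nemytskii_bound(1)[OF _ u vs']) (use k in auto)
    show ?thesis
      unfolding nemytskii_def
      using Bochner_Integration.integral_diff[OF Bochner_Integration.integrable_diff[OF i1 i2] i3]
        Bochner_Integration.integral_diff[OF i1 i2] by simp
  qed
  finally show ?thesis .
qed

lemma nemytskii_slotlin:
  assumes k: "k \<le> n" and u: "u \<in> Lp_space M p"
  shows "slotlin (Lp_space M p) {..<k} (nemytskii M G k u)"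
proof (rule slotlinI)
  note sl = pjetD(3)[OF G k]
  fix vs ws :: "nat \<Rightarrow> 's \<Rightarrow> 'x" assume *: "\<And>i. i \<in> {..<k} \<Longrightarrow> vs i = ws i"
  have "G k (u s) (\<lambda>i. vs i s) = G k (u s) (\<lambda>i. ws i s)" for s
    by (rule slotlin_cong[OF sl]) (simp add: *)
  then show "nemytskii M G k u vs = nemytskii M G k u ws" by (simp add: nemytskii_def)
next
  note sl = pjetD(3)[OF G k]
  fix vs :: "nat \<Rightarrow> 's \<Rightarrow> 'x" and i a b and v w :: "'s \<Rightarrow> 'x"
  assume i: "i \<in> {..<k}" and vs: "\<And>j. j \<in> {..<k} \<Longrightarrow> vs j \<in> Lp_space M p"
    and v: "v \<in> Lp_space M p" and w: "w \<in> Lp_space M p"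
  have upd: "(\<lambda>j. (vs(i := z)) j s) = (\<lambda>j. vs j s)(i := z s)" for z s by auto
  have int: "integrable (completion M) (\<lambda>s. G k (u s) ((\<lambda>j. vs j s)(i := z s)))" if "z \<in> Lp_space M p" for z
    unfolding upd[symmetric] by (rule nemytskii_bound(1)[OF k u]) (use vs that in auto)
  have "G k (u s) ((\<lambda>j. vs j s)(i := (a *\<^sub>R v + b *\<^sub>R w) s))
      = a * G k (u s) ((\<lambda>j. vs j s)(i := v s)) + b * G k (u s) ((\<lambda>j. vs j s)(i := w s))" for s
    using slotlin_lin[OF sl i, where vs = "\<lambda>j. vs j s" and u = "v s" and w = "w s" and a = a and b = b]
    by (simp add: scaleR_fun_def)
  then show "nemytskii M G k u (vs(i := a *\<^sub>R v + b *\<^sub>R w)) = a * nemytskii M G k u (vs(i := v)) + b * nemytskii M G k u (vs(i := w))"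
    unfolding nemytskii_def upd using int[OF v] int[OF w] by simp
qed

text \<open>The estimates contain powers of the norms of the arguments, so a ball is what makes a
  single constant available.\<close>

lemma nemytskii_jet:
  assumes \<rho>: "0 < \<rho>"
  obtains C where "L.jet (L.nball 0 \<rho>) n \<alpha> C (\<lambda>u. nemytskii M G 0 u undefined) (nemytskii M G)"
proof -
  \<comment> \<open>Bounds \<open>K * d powr e\<close> for all d up to \<open>2 * \<rho>\<close> and
    all e between 0 and p at once; a base of at least 1 gives monotonicity in the exponent.\<close>
  define C where "C = K * (1 + 2 * \<rho>) powr p"
  have K: "0 \<le> K" by (rule pjetD(1)[OF G])
  have C: "0 \<le> C" using K by (simp add: C_def)
  have le: "K * d powr e \<le> C" if "0 \<le> d" "d \<le> 2 * \<rho>" "0 \<le> e" "e \<le> p" for d e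
  proof -
    have "d powr e \<le> (1 + 2 * \<rho>) powr e" using that by (intro powr_mono2) auto
    also have "\<dots> \<le> (1 + 2 * \<rho>) powr p" using that \<rho> by (intro powr_mono) auto
    finally show ?thesis unfolding C_def using K by (rule mult_left_mono)
  qed
  have ball: "x \<in> L.nball 0 \<rho> \<longleftrightarrow> x \<in> Lp_space M p \<and> Lp_norm M p x < \<rho>" for x :: "'s \<Rightarrow> 'x" by (simp add: L.nball_def)
  have "L.jet (L.nball 0 \<rho>) n \<alpha> C (\<lambda>u. nemytskii M G 0 u undefined) (nemytskii M G)"
    unfolding L.jet_def
  proof (intro conjI ballI allI impI)
    show "L.nball 0 \<rho> \<subseteq> Lp_space M p" by (auto simp: ball)
    show "0 \<le> C" by (rule C)
    show "nemytskii M G 0 x vs = nemytskii M G 0 x undefined" if "x \<in> Lp_space M p" for x vs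
      using slotlin_cong[OF nemytskii_slotlin[of 0 x], of vs undefined] that by simp
    fix k x assume k: "k \<le> n" and x: "x \<in> L.nball 0 \<rho>"
    then have xL: "x \<in> Lp_space M p" "Lp_norm M p x < \<rho>" by (auto simp: ball)
    have e: "0 \<le> p - real k - \<alpha>" "p - real k - \<alpha> \<le> p" "0 \<le> p - real k" "p - real k \<le> p" using k p \<alpha> by auto
    show "slotlin (Lp_space M p) {..<k} (nemytskii M G k x)" by (rule nemytskii_slotlin[OF k xL(1)])
    show "mbound (Lp_space M p) (Lp_norm M p) k (nemytskii M G k x) C"
      unfolding mbound_def
    proof (intro allI impI)
      fix vs :: "nat \<Rightarrow> 's \<Rightarrow> 'x" assume vs: "\<forall>i<k. vs i \<in> Lp_space M p"
      have "\<bar>nemytskii M G k x vs\<bar> \<le> K * (Lp_norm M p x powr (p - real k) * (\<Prod>i<k. Lp_norm M p (vs i)))"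
        using vs by (intro nemytskii_bound(2)[OF k xL(1)]) auto
      also have "\<dots> \<le> C * (\<Prod>i<k. Lp_norm M p (vs i))"
        unfolding mult.assoc[symmetric] using xL e \<rho>
        by (intro mult_right_mono le prod_nonneg) (auto simp: Lp_norm_nonneg)
      finally show "\<bar>nemytskii M G k x vs\<bar> \<le> C * (\<Prod>i<k. Lp_norm M p (vs i))" .
    qed
    fix y assume y: "y \<in> L.nball 0 \<rho>"
    then have yL: "y \<in> Lp_space M p" "Lp_norm M p y < \<rho>" by (auto simp: ball)
    show "mbound (Lp_space M p) (Lp_norm M p) k (\<lambda>vs. nemytskii M G k x vs - nemytskii M G k y vs) (C * Lp_norm M p (x - y) powr \<alpha>)"
      unfolding mbound_def
    proof (intro allI impI)
      fix vs :: "nat \<Rightarrow> 's \<Rightarrow> 'x" assume vs: "\<forall>i<k. vs i \<in> Lp_space M p"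
      have "\<bar>nemytskii M G k x vs - nemytskii M G k y vs\<bar> \<le> K * ((Lp_norm M p x + Lp_norm M p y) powr (p - real k - \<alpha>)
          * Lp_norm M p (x - y) powr \<alpha> * (\<Prod>i<k. Lp_norm M p (vs i)))"
        using vs by (intro nemytskii_holder[OF k xL(1) yL(1)]) auto
      also have "\<dots> \<le> C * Lp_norm M p (x - y) powr \<alpha> * (\<Prod>i<k. Lp_norm M p (vs i))"
        unfolding mult.assoc[symmetric] using xL yL e
        by (intro mult_right_mono le prod_nonneg) (auto simp: Lp_norm_nonneg)
      finally show "\<bar>nemytskii M G k x vs - nemytskii M G k y vs\<bar> \<le> C * Lp_norm M p (x - y) powr \<alpha> * (\<Prod>i<k. Lp_norm M p (vs i))" .
    qed
  next
    fix k x and vs :: "nat \<Rightarrow> 's \<Rightarrow> 'x" and h :: "'s \<Rightarrow> 'x"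
    assume k: "k < n" and x: "x \<in> L.nball 0 \<rho>" and h: "h \<in> Lp_space M p" and vs: "\<forall>i<k. vs i \<in> Lp_space M p"
    then have xL: "x \<in> Lp_space M p" by (auto simp: ball)
    have e: "0 \<le> p - real k - 1 - \<alpha>" using k p \<alpha> by auto
    let ?Nx = "Lp_norm M p x" and ?Nh = "Lp_norm M p h" and ?P = "\<Prod>i<k. Lp_norm M p (vs i)"
    have P: "0 \<le> ?P" by (intro prod_nonneg) (auto simp: Lp_norm_nonneg)
    show "((\<lambda>t. nemytskii M G k (x + t *\<^sub>R h) vs) has_real_derivative nemytskii M G (Suc k) x (vs(k := h))) (at 0)"
    proof (rule DERIV_of_remainder[OF \<alpha>])
      fix t :: real assume t: "\<bar>t\<bar> \<le> 1"
      have th: "t *\<^sub>R h \<in> Lp_space M p" using h by blast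
      have Nth: "Lp_norm M p (t *\<^sub>R h) = \<bar>t\<bar> * ?Nh" by (rule L.scale[OF h])
      have "nemytskii M G (Suc k) x ((vs(k := 0))(k := t *\<^sub>R h)) = t * nemytskii M G (Suc k) x ((vs(k := 0))(k := h))"
        by (rule slotlin_scale[OF nemytskii_slotlin]) (use k h vs xL in \<open>auto simp: less_Suc_eq\<close>)
      then have lin: "nemytskii M G (Suc k) x (vs(k := t *\<^sub>R h)) = t * nemytskii M G (Suc k) x (vs(k := h))" by simp
      have "\<bar>nemytskii M G k (x + t *\<^sub>R h) vs - nemytskii M G k x vs - nemytskii M G (Suc k) x (vs(k := t *\<^sub>R h))\<bar>
        \<le> K * ((?Nx + Lp_norm M p (t *\<^sub>R h)) powr (p - real k - 1 - \<alpha>) * Lp_norm M p (t *\<^sub>R h) powr (1 + \<alpha>) * ?P)"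
        using vs by (intro nemytskii_taylor[OF k xL th]) auto
      also have "\<dots> \<le> K * ((?Nx + ?Nh) powr (p - real k - 1 - \<alpha>) * (\<bar>t\<bar> * ?Nh) powr (1 + \<alpha>) * ?P)"
        unfolding Nth using e K P t mult_right_mono[OF t Lp_norm_nonneg[of M p h]]
        by (intro mult_left_mono mult_right_mono powr_mono2) (auto simp: Lp_norm_nonneg)
      also have "\<dots> = K * ((?Nx + ?Nh) powr (p - real k - 1 - \<alpha>) * ?Nh powr (1 + \<alpha>) * ?P) * \<bar>t\<bar> powr (1 + \<alpha>)"
        by (simp add: powr_mult)
      finally show "\<bar>nemytskii M G k (x + t *\<^sub>R h) vs - nemytskii M G k (x + 0 *\<^sub>R h) vs - t * nemytskii M G (Suc k) x (vs(k := h))\<bar>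
        \<le> K * ((?Nx + ?Nh) powr (p - real k - 1 - \<alpha>) * ?Nh powr (1 + \<alpha>) * ?P) * \<bar>t\<bar> powr (1 + \<alpha>)"
        unfolding lin by simp
    qed
  qed
  then show ?thesis by (rule that)
qed

lemma nemytskii_lower:
  assumes u: "u \<in> Lp_space M p"
  shows "c * Lp_norm M p u powr p \<le> nemytskii M G 0 u vs"
proof -
  have p0: "0 < p" using p by simp
  have int: "integrable (completion M) (\<lambda>s. norm (u s) powr p)"
    using u measurable_powr_norm(1)[of M u p]
    by (intro integrableI_bounded) (auto simp: Lp_space_iff Lp_int_def)
  have "Lp_norm M p u powr p = (\<integral>s. norm (u s) powr p \<partial>(completion M))"
  proof -
    have "(\<integral>s. norm (u s) powr p \<partial>(completion M)) = enn2real (Lp_int M p u)"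
      unfolding Lp_int_def by (rule integral_eq_nn_integral) (use int in auto)
    then show ?thesis using Lp_int_eq[OF u p0] by simp
  qed
  then have "c * Lp_norm M p u powr p = (\<integral>s. c * norm (u s) powr p \<partial>(completion M))" by simp
  also have "\<dots> \<le> nemytskii M G 0 u vs"
    unfolding nemytskii_def using int u pjetD(7)[OF G]
    by (intro integral_mono nemytskii_bound(1)) auto
  finally show ?thesis .
qed

theorem Lp_uniformly_smooth_bump:
  assumes n: "n = horder r" and r: "\<alpha> = r - real n"
  shows "\<exists>g :: ('s \<Rightarrow> 'x) \<Rightarrow> real. bump (Lp_space M p) (Lp_norm M p) g
    \<and> uniformly_H_smooth (Lp_space M p) (Lp_norm M p) r g"
proof -
  have c: "0 < c" by (rule pjetD(2)[OF G])
  \<comment> \<open>Twice the radius at which the lower bound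
    \<open>c * Lp_norm M p u powr p\<close> reaches 1. Outside half of the ball the functional is
    thus at least 1 and the cut-off is 0.\<close>
  define \<rho> where "\<rho> = 2 * (1 / c) powr (1 / p)"
  have \<rho>: "0 < \<rho>" using c by (simp add: \<rho>_def)
  obtain C where j: "L.jet (L.nball 0 \<rho>) n \<alpha> C (\<lambda>u. nemytskii M G 0 u undefined) (nemytskii M G)"
    using nemytskii_jet[OF \<rho>] .
  define g where "g = (\<lambda>u. (max 0 (1 + (-1) * nemytskii M G 0 u undefined)) ^ (n + 2))"
  obtain C1 E1 where j1: "L.jet (L.nball 0 \<rho>) n \<alpha> C1 g E1"
    unfolding g_def by (rule L.jet_pos_part_power[OF j])
  have g0: "g u = 0" if u: "u \<in> Lp_space M p" "\<rho> / 2 \<le> Lp_norm M p u" for u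
  proof -
    have "c * ((1 / c) powr (1 / p)) powr p \<le> c * Lp_norm M p u powr p"
      using u c p by (intro mult_left_mono powr_mono2) (auto simp: \<rho>_def)
    moreover have "c * ((1 / c) powr (1 / p)) powr p = 1" using c p by (simp add: powr_powr)
    ultimately have "1 \<le> nemytskii M G 0 u undefined" using nemytskii_lower[OF u(1), of undefined] by linarith
    then have "max 0 (1 + (-1) * nemytskii M G 0 u undefined) = 0" by (intro max_absorb1) simp
    then show ?thesis by (simp add: g_def)
  qed
  obtain C2 E2 where j2: "L.jet (Lp_space M p) n \<alpha> C2 g E2"
    by (rule L.jet_extend[OF j1 _ \<rho> \<alpha>, where \<kappa> = 0]) (use g0 in auto)
  have "uniformly_H_smooth (Lp_space M p) (Lp_norm M p) r g"
    by (rule L.jet_imp_uniformly_H_smooth[OF j2]) (use n r \<alpha> in auto)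
  moreover have "bump (Lp_space M p) (Lp_norm M p) g"
    unfolding bump_def
  proof (intro conjI)
    have "\<bar>nemytskii M G 0 0 undefined\<bar> \<le> K * (Lp_norm M p (0 :: 's \<Rightarrow> 'x) powr (p - real 0) * (\<Prod>i<(0::nat). Lp_norm M p (undefined i :: 's \<Rightarrow> 'x)))"
      by (rule nemytskii_bound(2)) auto
    then have "nemytskii M G 0 0 undefined = 0" by simp
    then have "g 0 \<noteq> 0" by (simp add: g_def)
    then show "\<exists>x\<in>Lp_space M p. g x \<noteq> 0" by blast
    show "\<exists>R. \<forall>x\<in>Lp_space M p. g x \<noteq> 0 \<longrightarrow> Lp_norm M p x \<le> R"
      using g0 by (intro exI[of _ "\<rho> / 2"]) force
  qed
  ultimately show ?thesis by blast
qed

end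

subsection \<open>Disjoint sets of positive measure\<close>

lemma sum_fun_apply: "(\<Sum>a\<in>A. f a) x = (\<Sum>a\<in>A. f a x)"
  by (induction A rule: infinite_finite_induct) auto

text \<open>The n + 1 rows, cut to n coordinates, lie in the span of n unit vectors. Linear
  dependence is a property of a set of vectors, so the case of two equal rows is treated
  apart.\<close>

lemma homogeneous_system_nontrivial:
  fixes c :: "nat \<Rightarrow> nat \<Rightarrow> real"
  shows "\<exists>d. (\<exists>i<Suc n. d i \<noteq> 0) \<and> (\<forall>j<n. (\<Sum>i<Suc n. d i * c i j) = 0)"
proof -
  define v where "v = (\<lambda>i j. if j < n then c i j else 0)"
  define e :: "nat \<Rightarrow> nat \<Rightarrow> real" where "e = (\<lambda>j k. if k = j then 1 else 0)"
  show ?thesis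
  proof (cases "inj_on v {..<Suc n}")
    case False
    then obtain i i' where i: "i < Suc n" "i' < Suc n" "i \<noteq> i'" "v i = v i'" by (auto simp: inj_on_def)
    define d where "d = (\<lambda>k. if k = i then 1 else if k = i' then -1 else 0 :: real)"
    have "(\<Sum>k<Suc n. d k * c k j) = 0" if "j < n" for j
    proof -
      have "c i j = c i' j" using fun_cong[OF i(4), of j] that by (simp add: v_def)
      moreover have "(\<Sum>k<Suc n. d k * c k j) = (\<Sum>k\<in>{i, i'}. d k * c k j)"
        using i by (intro sum.mono_neutral_right) (auto simp: d_def)
      ultimately show ?thesis using i(3) by (simp add: d_def)
    qed
    moreover have "d i \<noteq> 0" by (simp add: d_def)
    ultimately show ?thesis using i(1) by blast
  next
    case True
    let ?S = "v ` {..<Suc n}" and ?T = "e ` {..<n}"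
    have "?S \<subseteq> span ?T"
    proof
      fix w assume "w \<in> ?S"
      then obtain i where w: "w = v i" by auto
      have "v i = (\<Sum>j<n. c i j *\<^sub>R e j)"
      proof
        fix k
        have "(\<Sum>j<n. c i j *\<^sub>R e j) k = (\<Sum>j<n. if j = k then c i j else 0)"
          unfolding sum_fun_apply by (intro sum.cong) (auto simp: scaleR_fun_def e_def)
        then show "v i k = (\<Sum>j<n. c i j *\<^sub>R e j) k" by (simp add: v_def)
      qed
      show "w \<in> span ?T" unfolding w \<open>v i = _\<close> by (intro span_sum span_scale span_base imageI)
    qed
    moreover have "card ?S = Suc n" using card_image[OF True] by simp
    moreover have "card ?T \<le> n" using card_image_le[of "{..<n}" e] by simp
    ultimately have "dependent ?S"
      using independent_span_bound[of ?T ?S] by fastforce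
    then obtain u where u: "\<exists>w\<in>?S. u w \<noteq> 0" "(\<Sum>w\<in>?S. u w *\<^sub>R w) = 0"
      using dependent_finite[of ?S] by auto
    have "(\<Sum>i<Suc n. u (v i) *\<^sub>R v i) = 0"
      using u(2) sum.reindex[OF True, of "\<lambda>w. u w *\<^sub>R w"] by (simp add: o_def del: sum.lessThan_Suc)
    then have "(\<Sum>i<Suc n. u (v i) *\<^sub>R v i) j = 0" for j by (simp del: sum.lessThan_Suc)
    then have "(\<Sum>i<Suc n. u (v i) * v i j) = 0" for j
      unfolding sum_fun_apply by (simp add: scaleR_fun_def del: sum.lessThan_Suc)
    moreover have "(\<Sum>i<Suc n. u (v i) * v i j) = (\<Sum>i<Suc n. u (v i) * c i j)" if "j < n" for j
    proof -
      have "v i j = c i j" for i using that by (simp add: v_def)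
      then show ?thesis by (simp only:)
    qed
    ultimately have "\<forall>j<n. (\<Sum>i<Suc n. u (v i) * c i j) = 0" by metis
    moreover have "\<exists>i<Suc n. u (v i) \<noteq> 0" using u(1) by (simp only: bex_simps image_iff lessThan_iff) blast
    ultimately show ?thesis by (intro exI[of _ "\<lambda>i. u (v i)"] conjI)
  qed
qed

text \<open>A working notion of finite dimension of the scalar space over \<open>B\<close>. It
  passes to subsets and to unions, which is what the splitting of sets relies on.\<close>

definition Lp_fin_dim_on :: "'s measure \<Rightarrow> real \<Rightarrow> 's set \<Rightarrow> bool" where
  "Lp_fin_dim_on M p B \<longleftrightarrow> (\<exists>n (e :: nat \<Rightarrow> 's \<Rightarrow> real). \<forall>f\<in>Lp_space M p.
     \<exists>c. AE s in M. s \<in> B \<longrightarrow> f s = (\<Sum>i<n. c i * e i s))"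

lemma Lp_fin_dim_on_subset:
  assumes "Lp_fin_dim_on M p B" "A \<subseteq> B"
  shows "Lp_fin_dim_on M p A"
proof -
  obtain n and e :: "nat \<Rightarrow> 'a \<Rightarrow> real"
    where e: "\<And>f. f \<in> Lp_space M p \<Longrightarrow> \<exists>c. AE s in M. s \<in> B \<longrightarrow> f s = (\<Sum>i<n. c i * e i s)"
    using assms(1) unfolding Lp_fin_dim_on_def by blast
  have "\<exists>c. AE s in M. s \<in> A \<longrightarrow> f s = (\<Sum>i<n. c i * e i s)" if f: "f \<in> Lp_space M p" for f
  proof -
    obtain c where "AE s in M. s \<in> B \<longrightarrow> f s = (\<Sum>i<n. c i * e i s)" using e[OF f] by blast
    then have "AE s in M. s \<in> A \<longrightarrow> f s = (\<Sum>i<n. c i * e i s)"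
      by eventually_elim (use assms(2) in auto)
    then show ?thesis by blast
  qed
  then show ?thesis unfolding Lp_fin_dim_on_def by blast
qed

lemma sum_lessThan_add:
  fixes f :: "nat \<Rightarrow> 'a::comm_monoid_add"
  shows "(\<Sum>i<m + n. f i) = (\<Sum>i<m. f i) + (\<Sum>i<n. f (m + i))"
  by (induction n) (auto simp: add.assoc)

lemma Lp_fin_dim_on_Un:
  assumes "Lp_fin_dim_on M p A" "Lp_fin_dim_on M p B"
  shows "Lp_fin_dim_on M p (A \<union> B)"
proof -
  obtain m and d :: "nat \<Rightarrow> 'a \<Rightarrow> real"
    where d: "\<And>f. f \<in> Lp_space M p \<Longrightarrow> \<exists>c. AE s in M. s \<in> A \<longrightarrow> f s = (\<Sum>i<m. c i * d i s)"
    using assms(1) unfolding Lp_fin_dim_on_def by blast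
  obtain n and e :: "nat \<Rightarrow> 'a \<Rightarrow> real"
    where e: "\<And>f. f \<in> Lp_space M p \<Longrightarrow> \<exists>c. AE s in M. s \<in> B \<longrightarrow> f s = (\<Sum>i<n. c i * e i s)"
    using assms(2) unfolding Lp_fin_dim_on_def by blast
  \<comment> \<open>The first family is cut to \<open>A\<close>, the second to the complement of
    \<open>A\<close>, so that they do not interfere on the overlap.\<close>
  define h where "h = (\<lambda>i s. if i < m then (if s \<in> A then d i s else 0) else (if s \<in> A then 0 else e (i - m) s))"
  have "\<exists>c. AE s in M. s \<in> A \<union> B \<longrightarrow> f s = (\<Sum>i<m + n. c i * h i s)" if f: "f \<in> Lp_space M p" for f
  proof -
    obtain c1 where c1: "AE s in M. s \<in> A \<longrightarrow> f s = (\<Sum>i<m. c1 i * d i s)" using d[OF f] by blast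
    obtain c2 where c2: "AE s in M. s \<in> B \<longrightarrow> f s = (\<Sum>i<n. c2 i * e i s)" using e[OF f] by blast
    define c where "c = (\<lambda>i. if i < m then c1 i else c2 (i - m))"
    have "AE s in M. s \<in> A \<union> B \<longrightarrow> f s = (\<Sum>i<m + n. c i * h i s)"
      using c1 c2
    proof eventually_elim
      case (elim s)
      then show ?case by (cases "s \<in> A") (auto simp: sum_lessThan_add c_def h_def)
    qed
    then show ?thesis by blast
  qed
  then show ?thesis unfolding Lp_fin_dim_on_def by blast
qed

text \<open>Were n functions enough, n + 1 independent functions would satisfy a nontrivial relation
  almost everywhere by \<open>homogeneous_system_nontrivial\<close>.\<close>

lemma Lp_infinite_dim_space:
  assumes "Lp_infinite_dim M p"
  shows "\<not> Lp_fin_dim_on M p (space M)"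
proof
  assume "Lp_fin_dim_on M p (space M)"
  then obtain n and e :: "nat \<Rightarrow> 'a \<Rightarrow> real"
    where e: "\<And>f. f \<in> Lp_space M p \<Longrightarrow> \<exists>c. AE s in M. s \<in> space M \<longrightarrow> f s = (\<Sum>i<n. c i * e i s)"
    unfolding Lp_fin_dim_on_def by blast
  obtain f :: "nat \<Rightarrow> 'a \<Rightarrow> real" where f: "\<And>i. i < Suc n \<Longrightarrow> f i \<in> Lp_space M p"
    "\<And>c. Lp_norm M p (\<lambda>s. \<Sum>i<Suc n. c i * f i s) = 0 \<Longrightarrow> \<forall>i<Suc n. c i = 0"
    using assms unfolding Lp_infinite_dim_def by blast
  have "\<forall>i<Suc n. \<exists>c. AE s in M. s \<in> space M \<longrightarrow> f i s = (\<Sum>j<n. c j * e j s)"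
    using e f(1) by blast
  then obtain c where c: "\<And>i. i < Suc n \<Longrightarrow> AE s in M. s \<in> space M \<longrightarrow> f i s = (\<Sum>j<n. c i j * e j s)"
    by metis
  obtain d where d: "\<exists>i<Suc n. d i \<noteq> 0" "\<And>j. j < n \<Longrightarrow> (\<Sum>i<Suc n. d i * c i j) = 0"
    using homogeneous_system_nontrivial[of n c] by blast
  have "AE s in M. \<forall>i\<in>{..<Suc n}. s \<in> space M \<longrightarrow> f i s = (\<Sum>j<n. c i j * e j s)"
    using c by (intro AE_finite_allI) auto
  then have "AE s in M. ennreal (norm (\<Sum>i<Suc n. d i * f i s) powr p) = 0"
    using AE_space
  proof eventually_elim
    case (elim s)
    have "(\<Sum>i<Suc n. d i * f i s) = (\<Sum>i<Suc n. \<Sum>j<n. d i * c i j * e j s)"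
      using elim by (intro sum.cong refl) (simp add: sum_distrib_left mult.assoc)
    also have "\<dots> = (\<Sum>j<n. (\<Sum>i<Suc n. d i * c i j) * e j s)"
      unfolding sum_distrib_right by (rule sum.swap)
    also have "\<dots> = 0" by (intro sum.neutral ballI) (simp only: lessThan_iff d(2) mult_zero_left)
    finally show ?case by simp
  qed
  then have "(\<integral>\<^sup>+ s. ennreal (norm (\<Sum>i<Suc n. d i * f i s) powr p) \<partial>M) = (\<integral>\<^sup>+ s. 0 \<partial>M)"
    by (rule nn_integral_cong_AE)
  then have "Lp_norm M p (\<lambda>s. \<Sum>i<Suc n. d i * f i s) = 0" unfolding Lp_norm_def by simp
  then show False using f(2) d(1) by blast
qed

section \<open>Splitting off sets of finite positive measure\<close>

lemma Lp_measurable_version: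
  fixes f :: "'s \<Rightarrow> real"
  assumes "f \<in> Lp_space M p"
  obtains f' where "f' \<in> borel_measurable M" "AE s in M. f s = f' s"
proof -
  have "f \<in> borel_measurable (completion M)"
    using assms by (intro strongly_measurable_imp_measurable) (simp add: Lp_space_iff)
  from completion_ex_borel_measurable_real[OF this] that show ?thesis by blast
qed

text \<open>Chebyshev's inequality. It supplies sets of finite measure although the measure need not
  be sigma-finite.\<close>

lemma emeasure_level_set_finite:
  fixes f f' :: "'s \<Rightarrow> real"
  assumes f: "f \<in> Lp_space M p" and [measurable]: "f' \<in> borel_measurable M" and eq: "AE s in M. f s = f' s"
    and \<epsilon>: "0 < \<epsilon>" and p: "0 < p"
  shows "emeasure M {s \<in> space M. \<epsilon> < \<bar>f' s\<bar>} < \<infinity>"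
proof -
  let ?A = "{s \<in> space M. \<epsilon> < \<bar>f' s\<bar>}"
  have "ennreal (\<epsilon> powr p) * emeasure M ?A = (\<integral>\<^sup>+ s. ennreal (\<epsilon> powr p) * indicator ?A s \<partial>M)"
    by (subst nn_integral_cmult_indicator) auto
  also have "\<dots> \<le> (\<integral>\<^sup>+ s. ennreal (norm (f' s) powr p) \<partial>M)"
    using \<epsilon> p by (intro nn_integral_mono) (auto simp: indicator_def intro!: ennreal_leI powr_mono2)
  also have "\<dots> = (\<integral>\<^sup>+ s. ennreal (norm (f s) powr p) \<partial>M)"
    using eq by (intro nn_integral_cong_AE) (auto elim!: eventually_mono)
  also have "\<dots> < \<infinity>" using f by (simp add: Lp_space_def)
  finally have *: "ennreal (\<epsilon> powr p) * emeasure M ?A < \<infinity>" .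
  show ?thesis
  proof (rule ccontr)
    assume "\<not> ?thesis"
    then have "emeasure M ?A = \<infinity>" by (simp add: less_top[symmetric])
    then show False using * \<epsilon> by (simp add: ennreal_mult_top)
  qed
qed

lemma null_countable_cover:
  assumes "\<And>m::nat. emeasure M (A m) = 0" "\<And>m. A m \<in> sets M" "B \<subseteq> (\<Union>m. A m)"
  shows "AE s in M. s \<notin> B"
proof -
  have "(\<Union>m. A m) \<in> null_sets M" using assms by (intro null_sets_UN) (auto simp: null_sets_def)
  from AE_not_in[OF this] show ?thesis by eventually_elim (use assms in auto)
qed

text \<open>Since the dimension is not even 0, some f in the space is not almost everywhere 0 on
  \<open>B\<close>. Countably many level sets of f exhaust the places where it is nonzero, so one of
  them has positive measure.\<close>

lemma exists_finite_measure_subset: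
  assumes B: "B \<in> sets M" "\<not> Lp_fin_dim_on M p B" and p: "0 < p"
  obtains A where "A \<in> sets M" "A \<subseteq> B" "0 < emeasure M A" "emeasure M A < \<infinity>"
proof -
  have "\<not> (\<forall>f\<in>Lp_space M p. \<exists>c :: nat \<Rightarrow> real. AE s in M. s \<in> B \<longrightarrow> f s = (\<Sum>i<(0::nat). c i * (0 :: nat \<Rightarrow> 'a \<Rightarrow> real) i s))"
    using B(2) unfolding Lp_fin_dim_on_def by blast
  then obtain f :: "'a \<Rightarrow> real" where f: "f \<in> Lp_space M p" "\<not> (AE s in M. s \<in> B \<longrightarrow> f s = 0)" by auto
  obtain f' where f'[measurable]: "f' \<in> borel_measurable M" and eq: "AE s in M. f s = f' s"
    using Lp_measurable_version[OF f(1)] .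
  define A where "A = (\<lambda>m::nat. {s \<in> space M. 1 / real (Suc m) < \<bar>f' s\<bar>} \<inter> B)"
  have Am: "A m \<in> sets M" for m using B(1) unfolding A_def by measurable
  have Af: "emeasure M (A m) < \<infinity>" for m
  proof -
    have "emeasure M (A m) \<le> emeasure M {s \<in> space M. 1 / real (Suc m) < \<bar>f' s\<bar>}"
      unfolding A_def by (intro emeasure_mono) auto
    also have "\<dots> < \<infinity>" by (rule emeasure_level_set_finite[OF f(1) f' eq _ p]) simp
    finally show ?thesis .
  qed
  have "\<exists>m. 0 < emeasure M (A m)"
  proof (rule ccontr)
    assume "\<not> ?thesis"
    then have "AE s in M. s \<notin> {s \<in> space M. f' s \<noteq> 0} \<inter> B"
    proof (intro null_countable_cover[OF _ Am])
      show "{s \<in> space M. f' s \<noteq> 0} \<inter> B \<subseteq> (\<Union>m. A m)"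
      proof
        fix s assume s: "s \<in> {s \<in> space M. f' s \<noteq> 0} \<inter> B"
        then obtain m where "1 / real (Suc m) < \<bar>f' s\<bar>" using nat_approx_posE[of "\<bar>f' s\<bar>"] by auto
        then show "s \<in> (\<Union>m. A m)" using s by (auto simp: A_def)
      qed
    qed (auto simp: zero_less_iff_neq_zero)
    then have "AE s in M. s \<in> B \<longrightarrow> f s = 0" using eq AE_space by eventually_elim auto
    then show False using f(2) by blast
  qed
  then obtain m where "0 < emeasure M (A m)" ..
  then show ?thesis using that[of "A m"] Am Af by (auto simp: A_def)
qed

text \<open>Otherwise, for every t, the part of \<open>A\<close> where f \<le> t or the part where f
  > t is null. Let c be the supremum of the t of the first kind: then the parts where f < c and
  where f > c are both null, so f = c almost everywhere on \<open>A\<close>.\<close>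

lemma exists_level_split:
  fixes f :: "'s \<Rightarrow> real"
  assumes A: "A \<in> sets M" "0 < emeasure M A" and f[measurable]: "f \<in> borel_measurable M"
    and nc: "\<And>c. \<not> (AE s in M. s \<in> A \<longrightarrow> f s = c)"
  obtains t where "0 < emeasure M ({s \<in> space M. f s \<le> t} \<inter> A)" "0 < emeasure M ({s \<in> space M. t < f s} \<inter> A)"
proof (rule ccontr)
  assume "\<not> thesis"
  then have dich: "emeasure M ({s \<in> space M. f s \<le> t} \<inter> A) = 0 \<or> emeasure M ({s \<in> space M. t < f s} \<inter> A) = 0" for t
    using that[of t] by (auto simp: zero_less_iff_neq_zero)
  have m1: "{s \<in> space M. f s \<le> t} \<inter> A \<in> sets M" for t using A(1) by measurable
  have m2: "{s \<in> space M. t < f s} \<inter> A \<in> sets M" for t using A(1) by measurable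
  have AM: "A \<subseteq> space M" using A(1) sets.sets_into_space by blast
  have notnull: "\<not> (AE s in M. s \<notin> A)" using A AE_iff_null_sets[OF A(1)] by auto
  define T where "T = {t. emeasure M ({s \<in> space M. f s \<le> t} \<inter> A) = 0}"
  have down: "t \<in> T" if "t' \<in> T" "t \<le> t'" for t t'
  proof -
    have "emeasure M ({s \<in> space M. f s \<le> t} \<inter> A) \<le> emeasure M ({s \<in> space M. f s \<le> t'} \<inter> A)"
    proof (rule emeasure_mono[OF _ m1])
      show "{s \<in> space M. f s \<le> t} \<inter> A \<subseteq> {s \<in> space M. f s \<le> t'} \<inter> A"
        using \<open>t \<le> t'\<close> by (auto intro: order_trans)
    qed
    also have "\<dots> = 0" using \<open>t' \<in> T\<close> unfolding T_def by blast
    finally show ?thesis unfolding T_def by simp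
  qed
  have "T \<noteq> {}"
  proof
    assume "T = {}"
    then have "emeasure M ({s \<in> space M. - real m < f s} \<inter> A) = 0" for m using dich[of "- real m"] by (auto simp: T_def)
    then have "AE s in M. s \<notin> A"
    proof (rule null_countable_cover[OF _ m2])
      show "A \<subseteq> (\<Union>m. {s \<in> space M. - real m < f s} \<inter> A)"
      proof
        fix s assume s: "s \<in> A"
        obtain m where "- f s < real m" using reals_Archimedean2 by blast
        then show "s \<in> (\<Union>m. {s \<in> space M. - real m < f s} \<inter> A)" using s AM by (auto intro!: exI[of _ m])
      qed
    qed
    then show False using notnull by blast
  qed
  have "\<exists>b. \<forall>t\<in>T. t \<le> b"
  proof (rule ccontr)
    assume "\<not> ?thesis"
    then have "real m \<in> T" for m using down by (meson linear)
    then have "emeasure M ({s \<in> space M. f s \<le> real m} \<inter> A) = 0" for m by (auto simp: T_def)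
    then have "AE s in M. s \<notin> A"
    proof (rule null_countable_cover[OF _ m1])
      show "A \<subseteq> (\<Union>m. {s \<in> space M. f s \<le> real m} \<inter> A)"
      proof
        fix s assume s: "s \<in> A"
        obtain m where "f s \<le> real m" using real_arch_simple by blast
        then show "s \<in> (\<Union>m. {s \<in> space M. f s \<le> real m} \<inter> A)" using s AM by (auto intro!: exI[of _ m])
      qed
    qed
    then show False using notnull by blast
  qed
  then have bdd: "bdd_above T" by (auto simp: bdd_above_def)
  define c where "c = Sup T"
  have "AE s in M. s \<notin> {s \<in> space M. c < f s} \<inter> A"
  proof (rule null_countable_cover)
    fix m :: nat
    have "c + 1 / real (Suc m) \<notin> T" using cSup_upper[OF _ bdd] unfolding c_def by fastforce
    then show "emeasure M ({s \<in> space M. c + 1 / real (Suc m) < f s} \<inter> A) = 0"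
      using dich[of "c + 1 / real (Suc m)"] unfolding T_def by blast
    show "{s \<in> space M. c + 1 / real (Suc m) < f s} \<inter> A \<in> sets M" by (rule m2)
  next
    show "{s \<in> space M. c < f s} \<inter> A \<subseteq> (\<Union>m. {s \<in> space M. c + 1 / real (Suc m) < f s} \<inter> A)"
    proof
      fix s assume s: "s \<in> {s \<in> space M. c < f s} \<inter> A"
      then obtain m where "1 / real (Suc m) < f s - c" using nat_approx_posE[of "f s - c"] by auto
      then show "s \<in> (\<Union>m. {s \<in> space M. c + 1 / real (Suc m) < f s} \<inter> A)" using s by (auto intro!: exI[of _ m])
    qed
  qed
  moreover have "AE s in M. s \<notin> {s \<in> space M. f s < c} \<inter> A"
  proof (rule null_countable_cover)
    fix m :: nat
    obtain t where "t \<in> T" "c - 1 / real (Suc m) < t"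
      using less_cSup_iff[OF \<open>T \<noteq> {}\<close> bdd, of "c - 1 / real (Suc m)"] unfolding c_def by auto
    then have "c - 1 / real (Suc m) \<in> T" using down by simp
    then show "emeasure M ({s \<in> space M. f s \<le> c - 1 / real (Suc m)} \<inter> A) = 0" by (simp add: T_def)
    show "{s \<in> space M. f s \<le> c - 1 / real (Suc m)} \<inter> A \<in> sets M" by (rule m1)
  next
    show "{s \<in> space M. f s < c} \<inter> A \<subseteq> (\<Union>m. {s \<in> space M. f s \<le> c - 1 / real (Suc m)} \<inter> A)"
    proof
      fix s assume s: "s \<in> {s \<in> space M. f s < c} \<inter> A"
      then obtain m where "1 / real (Suc m) < c - f s" using nat_approx_posE[of "c - f s"] by auto
      then show "s \<in> (\<Union>m. {s \<in> space M. f s \<le> c - 1 / real (Suc m)} \<inter> A)" using s by (auto intro!: exI[of _ m])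
    qed
  qed
  ultimately have "AE s in M. s \<in> A \<longrightarrow> f s = c" using AE_space by eventually_elim force
  then show False using nc by blast
qed

text \<open>If removing \<open>A\<close> leaves a finite-dimensional rest, then \<open>A\<close>
  itself is infinite-dimensional. It then carries a nonconstant function, a level of which cuts it
  into two parts of positive measure. One part is infinite-dimensional, and the other can be
  removed.\<close>

lemma exists_removable_subset:
  assumes B: "B \<in> sets M" "\<not> Lp_fin_dim_on M p B" and p: "0 < p"
  shows "\<exists>A\<in>sets M. A \<subseteq> B \<and> 0 < emeasure M A \<and> emeasure M A < \<infinity> \<and> \<not> Lp_fin_dim_on M p (B - A)"
proof -
  obtain A where A: "A \<in> sets M" "A \<subseteq> B" "0 < emeasure M A" "emeasure M A < \<infinity>"
    using exists_finite_measure_subset[OF B p] .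
  show ?thesis
  proof (cases "Lp_fin_dim_on M p (B - A)")
    case False
    then show ?thesis using A by blast
  next
    case True
    have "A \<union> (B - A) = B" using A by auto
    then have nA: "\<not> Lp_fin_dim_on M p A" using Lp_fin_dim_on_Un[of M p A "B - A"] True B(2) by auto
    \<comment> \<open>If every function were constant on \<open>A\<close>, the constant 1 would span
      them there.\<close>
    have "\<not> (\<forall>f\<in>Lp_space M p. \<exists>c :: nat \<Rightarrow> real. AE s in M. s \<in> A \<longrightarrow> f s = (\<Sum>i<(1::nat). c i * 1))"
    proof
      assume *: "\<forall>f\<in>Lp_space M p. \<exists>c :: nat \<Rightarrow> real. AE s in M. s \<in> A \<longrightarrow> f s = (\<Sum>i<(1::nat). c i * 1)"
      have "Lp_fin_dim_on M p A"
        unfolding Lp_fin_dim_on_def by (rule exI[of _ 1], rule exI[of _ "\<lambda>_ _. 1"]) (rule *)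
      then show False using nA by blast
    qed
    then obtain f :: "'a \<Rightarrow> real" where f: "f \<in> Lp_space M p"
      "\<And>c :: nat \<Rightarrow> real. \<not> (AE s in M. s \<in> A \<longrightarrow> f s = (\<Sum>i<(1::nat). c i * 1))" by blast
    obtain f' where f'[measurable]: "f' \<in> borel_measurable M" and eq: "AE s in M. f s = f' s"
      using Lp_measurable_version[OF f(1)] .
    have nc: "\<not> (AE s in M. s \<in> A \<longrightarrow> f' s = c)" for c
    proof
      assume "AE s in M. s \<in> A \<longrightarrow> f' s = c"
      then have "AE s in M. s \<in> A \<longrightarrow> f s = (\<Sum>i<(1::nat). (\<lambda>_. c) i * 1)" using eq by eventually_elim auto
      with f(2)[of "\<lambda>_. c"] show False by (rule notE)
    qed
    obtain t where t: "0 < emeasure M ({s \<in> space M. f' s \<le> t} \<inter> A)" "0 < emeasure M ({s \<in> space M. t < f' s} \<inter> A)"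
      using exists_level_split[OF A(1,3) f' nc] .
    let ?A1 = "{s \<in> space M. f' s \<le> t} \<inter> A" and ?A2 = "{s \<in> space M. t < f' s} \<inter> A"
    have "{s \<in> space M. f' s \<le> t} \<in> sets M" "{s \<in> space M. t < f' s} \<in> sets M" by measurable
    then have m: "?A1 \<in> sets M" "?A2 \<in> sets M" using A(1) by blast+
    have fin: "emeasure M ?A1 < \<infinity>" "emeasure M ?A2 < \<infinity>"
      using emeasure_mono[of ?A1 A M] emeasure_mono[of ?A2 A M] A(1,4) by (auto intro: le_less_trans)
    have "?A1 \<union> ?A2 = A" using sets.sets_into_space[OF A(1)] by (auto simp: not_le[symmetric])
    then have "\<not> Lp_fin_dim_on M p ?A1 \<or> \<not> Lp_fin_dim_on M p ?A2"
      using Lp_fin_dim_on_Un[of M p ?A1 ?A2] nA by auto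
    then show ?thesis
    proof
      assume "\<not> Lp_fin_dim_on M p ?A1"
      moreover have "?A1 \<subseteq> B - ?A2" using A by auto
      ultimately have "\<not> Lp_fin_dim_on M p (B - ?A2)" using Lp_fin_dim_on_subset by blast
      then show ?thesis using m fin t A by (intro bexI[of _ ?A2]) auto
    next
      assume "\<not> Lp_fin_dim_on M p ?A2"
      moreover have "?A2 \<subseteq> B - ?A1" using A by auto
      ultimately have "\<not> Lp_fin_dim_on M p (B - ?A1)" using Lp_fin_dim_on_subset by blast
      then show ?thesis using m fin t A by (intro bexI[of _ ?A1]) auto
    qed
  qed
qed

lemma Lp_infinite_dim_disjoint_sets:
  assumes "Lp_infinite_dim M p" "0 < p"
  shows "\<exists>A :: nat \<Rightarrow> 's set. disjoint_family A \<and>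
    (\<forall>k. A k \<in> sets M \<and> 0 < emeasure M (A k) \<and> emeasure M (A k) < \<infinity>)"
proof -
  have "\<forall>B. \<exists>A. B \<in> sets M \<and> \<not> Lp_fin_dim_on M p B \<longrightarrow>
      A \<in> sets M \<and> A \<subseteq> B \<and> 0 < emeasure M A \<and> emeasure M A < \<infinity> \<and> \<not> Lp_fin_dim_on M p (B - A)"
    using exists_removable_subset[OF _ _ assms(2)] by blast
  then obtain F where F: "\<And>B. B \<in> sets M \<Longrightarrow> \<not> Lp_fin_dim_on M p B \<Longrightarrow>
      F B \<in> sets M \<and> F B \<subseteq> B \<and> 0 < emeasure M (F B) \<and> emeasure M (F B) < \<infinity> \<and> \<not> Lp_fin_dim_on M p (B - F B)"
    by metis
  \<comment> \<open>The sets that remain: each piece is removed before the next is chosen, so later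
    pieces are disjoint from it.\<close>
  define B where "B = (\<lambda>k. ((\<lambda>B. B - F B) ^^ k) (space M))"
  have B0: "B 0 = space M" and BS: "B (Suc k) = B k - F (B k)" for k by (auto simp: B_def)
  have B: "B k \<in> sets M \<and> \<not> Lp_fin_dim_on M p (B k)" for k
  proof (induction k)
    case 0
    then show ?case using Lp_infinite_dim_space[OF assms(1)] by (simp add: B0)
  next
    case (Suc k)
    then show ?case using F[of "B k"] by (auto simp: BS)
  qed
  have mono: "B (k + i) \<subseteq> B k" for k i by (induction i) (auto simp: BS)
  have dis: "F (B i) \<inter> F (B k) = {}" if "i < k" for i k
  proof -
    have "F (B k) \<subseteq> B k" using F B by blast
    also have "B k \<subseteq> B (Suc i)" using mono[of "Suc i" "k - Suc i"] that by simp
    finally show ?thesis by (auto simp: BS)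
  qed
  have "disjoint_family (\<lambda>k. F (B k))"
    unfolding disjoint_family_on_def using dis by (metis inf_commute linorder_neqE_nat)
  then show ?thesis using F B by (intro exI[of _ "\<lambda>k. F (B k)"]) blast
qed

subsection \<open>From the Lebesgue--Bochner space to the Banach space\<close>

locale disjoint_copies =
  fixes M :: "'s measure" and A :: "nat \<Rightarrow> 's set" and p :: real
  assumes disj: "disjoint_family A" and A_sets: "A k \<in> sets M"
    and A_pos: "0 < emeasure M (A k)" and A_fin: "emeasure M (A k) < \<infinity>" and p: "1 \<le> p"
begin

text \<open>The factor normalises the indicator of \<open>A k\<close>, which makes the embedding
  isometric.\<close>

definition emb :: "nat \<Rightarrow> 'x::real_normed_vector \<Rightarrow> 's \<Rightarrow> 'x" where
  "emb k x = (\<lambda>s. if s \<in> A k then (1 / measure M (A k) powr (1 / p)) *\<^sub>R x else 0)"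

text \<open>The sum of \<open>emb j (x j)\<close> over j in \<open>I\<close>, taken pointwise. At
  each point at most one term is nonzero, so an infinite \<open>I\<close> raises no question of
  convergence.\<close>

definition glue :: "(nat \<Rightarrow> 'x::real_normed_vector) \<Rightarrow> nat set \<Rightarrow> 's \<Rightarrow> 'x" where
  "glue x I s = (if \<exists>j\<in>I. s \<in> A j then emb (THE j. s \<in> A j) (x (THE j. s \<in> A j)) s else 0)"

lemma p0: "0 < p" using p by simp

lemma measure_pos: "0 < measure M (A k)"
  using A_pos[of k] A_fin[of k] by (simp add: measure_def enn2real_positive_iff)

lemma A_unique: "s \<in> A j \<Longrightarrow> s \<in> A k \<Longrightarrow> j = k"
  using disj by (auto simp: disjoint_family_on_def)

lemma the_index: "s \<in> A j \<Longrightarrow> (THE j. s \<in> A j) = j"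
  using A_unique by blast

lemma glue_in: "s \<in> A j \<Longrightarrow> glue x I s = (if j \<in> I then emb j (x j) s else 0)"
  using A_unique by (auto simp: glue_def the_index)

lemma glue_out: "(\<And>j. s \<notin> A j) \<Longrightarrow> glue x I s = 0"
  by (simp add: glue_def)

lemma emb_out: "s \<notin> A k \<Longrightarrow> emb k x s = 0"
  by (simp add: emb_def)

lemma emb_linear: "emb k (a *\<^sub>R x + b *\<^sub>R y) = a *\<^sub>R emb k x + b *\<^sub>R emb k y"
  by (auto simp: emb_def fun_eq_iff scaleR_fun_def algebra_simps)

lemma emb_zero: "emb k 0 = 0"
  by (auto simp: emb_def fun_eq_iff)

lemma simple_emb: "simple_function M (emb k x)"
  unfolding emb_def using A_sets by (intro simple_function_If_set) auto

lemma glue_lessThan: "glue x {..<k} = (\<Sum>j<k. emb j (x j))"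
proof
  fix s
  show "glue x {..<k} s = (\<Sum>j<k. emb j (x j)) s"
  proof (cases "\<exists>j. s \<in> A j")
    case True
    then obtain j where j: "s \<in> A j" by blast
    have "(\<Sum>i<k. emb i (x i) s) = (\<Sum>i<k. if i = j then emb j (x j) s else 0)"
      using A_unique[OF j] by (intro sum.cong refl) (auto intro: emb_out)
    then show ?thesis by (simp add: sum_fun_apply glue_in[OF j])
  next
    case False
    then show ?thesis by (simp add: sum_fun_apply glue_out emb_out)
  qed
qed

lemma strongly_measurable_glue: "strongly_measurable M (glue x I)"
proof -
  have sf: "simple_function M (\<lambda>s. \<Sum>j<k. if j \<in> I then emb j (x j) s else 0)" for k
  proof (intro simple_function_sum)
    show "simple_function M (\<lambda>s. if j \<in> I then emb j (x j) s else 0)" for j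
      by (cases "j \<in> I") (simp_all add: simple_emb)
  qed
  have "(\<lambda>k. \<Sum>j<k. if j \<in> I then emb j (x j) s else 0) \<longlonglongrightarrow> glue x I s" for s
  proof (cases "\<exists>j. s \<in> A j")
    case True
    then obtain j where j: "s \<in> A j" by blast
    have "(\<Sum>i<k. if i \<in> I then emb i (x i) s else 0) = glue x I s" if "k \<ge> Suc j" for k
    proof -
      have "(\<Sum>i<k. if i \<in> I then emb i (x i) s else 0) = (\<Sum>i<k. if i = j then (if j \<in> I then emb j (x j) s else 0) else 0)"
        using A_unique[OF j] by (intro sum.cong refl) (auto intro: emb_out)
      then show ?thesis using that by (simp add: glue_in[OF j])
    qed
    then show ?thesis by (intro tendsto_eventually) (auto simp: eventually_sequentially)
  next
    case False
    then show ?thesis by (simp add: glue_out emb_out cong: if_cong)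
  qed
  then show ?thesis
    unfolding strongly_measurable_def
    using sf by (intro exI[of _ "\<lambda>k s. \<Sum>j<k. if j \<in> I then emb j (x j) s else 0"]) auto
qed

lemma norm_emb_powr:
  "ennreal (norm (emb k x s) powr p) = ennreal (norm x powr p / measure M (A k)) * indicator (A k) s"
proof (cases "s \<in> A k")
  case True
  have "norm (emb k x s) powr p = (norm x / measure M (A k) powr (1 / p)) powr p"
    using True measure_pos[of k] by (simp add: emb_def)
  also have "\<dots> = norm x powr p / measure M (A k)"
    using measure_pos[of k] p0 by (simp add: powr_divide powr_powr)
  finally show ?thesis using True by simp
qed (simp add: emb_def)

text \<open>Disjoint supports make the p-th power of the norm additive, also over infinitely many
  pieces.\<close>

lemma Lp_int_glue:
  "Lp_int M p (glue x I) = (\<Sum>j. if j \<in> I then ennreal (norm (x j) powr p) else 0)"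
proof -
  define c where "c = (\<lambda>j. if j \<in> I then ennreal (norm (x j) powr p / measure M (A j)) else 0)"
  have eq: "ennreal (norm (glue x I s) powr p) = (\<Sum>j. c j * indicator (A j) s)" for s
  proof (cases "\<exists>j. s \<in> A j")
    case True
    then obtain j where j: "s \<in> A j" by blast
    have "c i * indicator (A i) s = (if i = j then c j else 0)" for i
      using j A_unique[OF j, of i] by (cases "i = j") (auto simp: indicator_def)
    then have "(\<Sum>i. c i * indicator (A i) s) = c j"
      using sums_unique[OF sums_single[of j "\<lambda>_. c j"]] by simp
    then show ?thesis using j norm_emb_powr[of j "x j" s] by (auto simp: glue_in[OF j] c_def)
  next
    case False
    then show ?thesis by (simp add: glue_out)
  qed
  have "Lp_int M p (glue x I) = (\<integral>\<^sup>+ s. (\<Sum>j. c j * indicator (A j) s) \<partial>M)"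
    unfolding Lp_int_def eq nn_integral_completion ..
  also have "\<dots> = (\<Sum>j. \<integral>\<^sup>+ s. c j * indicator (A j) s \<partial>M)"
    using A_sets by (intro nn_integral_suminf) auto
  also have "\<dots> = (\<Sum>j. if j \<in> I then ennreal (norm (x j) powr p) else 0)"
  proof (intro suminf_cong)
    fix j
    have "emeasure M (A j) = ennreal (measure M (A j))"
      using A_fin[of j] by (intro emeasure_eq_ennreal_measure) auto
    then show "(\<integral>\<^sup>+ s. c j * indicator (A j) s \<partial>M) = (if j \<in> I then ennreal (norm (x j) powr p) else 0)"
      using A_sets measure_pos[of j]
      by (simp add: nn_integral_cmult_indicator c_def ennreal_mult[symmetric] less_imp_le)
  qed
  finally show ?thesis .
qed

lemma Lp_norm_powr:
  assumes "u \<in> Lp_space M p"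
  shows "Lp_norm M p u powr p = enn2real (Lp_int M p u)"
  by (simp add: Lp_int_eq[OF assms p0])

lemma glue_finite:
  assumes "finite I"
  shows "glue x I \<in> Lp_space M p" "Lp_norm M p (glue x I) powr p = (\<Sum>j\<in>I. norm (x j) powr p)"
proof -
  have I: "Lp_int M p (glue x I) = ennreal (\<Sum>j\<in>I. norm (x j) powr p)"
  proof -
    have "Lp_int M p (glue x I) = (\<Sum>j\<in>I. if j \<in> I then ennreal (norm (x j) powr p) else 0)"
      unfolding Lp_int_glue by (rule suminf_finite[OF assms]) simp
    also have "\<dots> = (\<Sum>j\<in>I. ennreal (norm (x j) powr p))" by simp
    also have "\<dots> = ennreal (\<Sum>j\<in>I. norm (x j) powr p)" by (rule sum_ennreal) simp
    finally show ?thesis .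
  qed
  then show L: "glue x I \<in> Lp_space M p" by (simp add: Lp_space_iff strongly_measurable_glue)
  show "Lp_norm M p (glue x I) powr p = (\<Sum>j\<in>I. norm (x j) powr p)"
    unfolding Lp_norm_powr[OF L] I by (simp add: sum_nonneg)
qed

lemma emb_eq_glue: "emb k x = glue (\<lambda>_. x) {k}"
proof
  fix s
  show "emb k x s = glue (\<lambda>_. x) {k} s"
  proof (cases "\<exists>j. s \<in> A j")
    case True
    then obtain j where j: "s \<in> A j" by blast
    show ?thesis
      using A_unique[OF j, of k] emb_out[of s k x] by (cases "j = k") (auto simp: glue_in[OF j])
  next
    case False
    then show ?thesis by (simp add: glue_out emb_out)
  qed
qed

lemma emb_Lp: "emb k x \<in> Lp_space M p" "Lp_norm M p (emb k x) = norm x"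
proof -
  show "emb k x \<in> Lp_space M p" unfolding emb_eq_glue by (rule glue_finite) simp
  have "Lp_norm M p (emb k x) powr p = norm x powr p"
    unfolding emb_eq_glue using glue_finite(2)[of "{k}" "\<lambda>_. x"] by simp
  then have "(Lp_norm M p (emb k x) powr p) powr (1 / p) = (norm x powr p) powr (1 / p)" by simp
  then show "Lp_norm M p (emb k x) = norm x" using p0 by (simp add: powr_powr Lp_norm_nonneg)
qed

text \<open>For \<open>k = 0\<close> this places the limit of the walk in the space; for large k the
  tail formula shows that the walk converges to it.\<close>

lemma glue_summable:
  assumes S: "summable (\<lambda>j. norm (x j) powr p)"
  shows "glue x {k..} \<in> Lp_space M p" "Lp_norm M p (glue x {k..}) powr p = (\<Sum>j. norm (x (j + k)) powr p)"
proof -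
  let ?h = "\<lambda>j. if j \<in> {k..} then norm (x j) powr p else 0"
  have sh: "summable ?h" by (rule summable_comparison_test'[OF S, of 0]) auto
  have "Lp_int M p (glue x {k..}) = (\<Sum>j. ennreal (?h j))"
    unfolding Lp_int_glue by (intro suminf_cong) auto
  also have "\<dots> = ennreal (suminf ?h)" by (rule suminf_ennreal2[OF _ sh]) simp
  also have "suminf ?h = (\<Sum>j. norm (x (j + k)) powr p)"
    using suminf_split_initial_segment[OF sh, of k] by simp
  finally have I: "Lp_int M p (glue x {k..}) = ennreal (\<Sum>j. norm (x (j + k)) powr p)" .
  then show L: "glue x {k..} \<in> Lp_space M p" by (simp add: Lp_space_iff strongly_measurable_glue)
  have "0 \<le> (\<Sum>j. norm (x (j + k)) powr p)"
    using S summable_iff_shift[of "\<lambda>j. norm (x j) powr p" k] by (intro suminf_nonneg) auto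
  then show "Lp_norm M p (glue x {k..}) powr p = (\<Sum>j. norm (x (j + k)) powr p)"
    unfolding Lp_norm_powr[OF L] I by simp
qed

lemma glue_split: "glue x {0..} - glue x {..<k} = glue x {k..}"
proof
  fix s
  show "(glue x {0..} - glue x {..<k}) s = glue x {k..} s"
    by (cases "\<exists>j. s \<in> A j") (auto simp: glue_in glue_out)
qed

end

text \<open>The norms in \<open>S\<close> may be unbounded and their supremum need not be attained;
  hence the truncation at 1 and the factor 2.\<close>

lemma exists_almost_maximal:
  fixes S :: "'x::real_normed_vector set"
  assumes "0 \<in> S"
  shows "\<exists>x\<in>S. \<forall>y\<in>S. min 1 (norm y) \<le> 2 * norm x"
proof -
  define T where "T = (\<lambda>y. min 1 (norm y)) ` S"
  have bdd: "bdd_above T" unfolding T_def by (intro bdd_aboveI[of _ 1]) auto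
  have ne: "T \<noteq> {}" using assms by (auto simp: T_def)
  show ?thesis
  proof (cases "Sup T \<le> 0")
    case True
    have "min 1 (norm y) \<le> 2 * norm (0 :: 'x)" if "y \<in> S" for y
    proof -
      have "min 1 (norm y) \<le> Sup T" using that by (intro cSup_upper bdd) (auto simp: T_def)
      then have "min 1 (norm y) \<le> 0" using True by linarith
      then show ?thesis by (simp only: norm_zero mult_zero_right)
    qed
    then show ?thesis using assms by blast
  next
    case False
    then have "Sup T / 2 < Sup T" by simp
    then obtain t where "t \<in> T" "Sup T / 2 < t" using less_cSup_iff[OF ne bdd] by blast
    then obtain x where x: "x \<in> S" "Sup T / 2 < min 1 (norm x)" unfolding T_def by blast
    have "min 1 (norm y) \<le> 2 * norm x" if "y \<in> S" for y
    proof -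
      have "min 1 (norm y) \<le> Sup T" using that by (intro cSup_upper bdd) (auto simp: T_def)
      then show ?thesis using x(2) by linarith
    qed
    then show ?thesis using x(1) by blast
  qed
qed

theorem smooth_bump_of_Lp:
  fixes M :: "'s measure" and g :: "('s \<Rightarrow> 'x::real_normed_vector) \<Rightarrow> real"
  assumes p: "1 \<le> p" and inf: "Lp_infinite_dim M p" and n: "n = horder r"
    and \<alpha>: "\<alpha> = r - real n" "0 < \<alpha>" "\<alpha> \<le> 1"
    and g: "bump (Lp_space M p) (Lp_norm M p) g" "H_smooth (Lp_space M p) (Lp_norm M p) r g"
  shows "\<exists>f :: 'x \<Rightarrow> real. bump UNIV norm f \<and> uniformly_H_smooth UNIV norm r f"
proof -
  have "0 < p" using p by simp
  obtain A :: "nat \<Rightarrow> 's set" where "disjoint_family A"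
    "\<forall>k. A k \<in> sets M \<and> 0 < emeasure M (A k) \<and> emeasure M (A k) < \<infinity>"
    using Lp_infinite_dim_disjoint_sets[OF inf \<open>0 < p\<close>] by blast
  then interpret disjoint_copies M A p using p by unfold_locales blast+
  interpret L: seminormed "Lp_space M p :: ('s \<Rightarrow> 'x) set" "Lp_norm M p"
    by (rule seminormed_Lp[OF p])
  interpret X: seminormed "UNIV :: 'x set" norm by (rule seminormed_UNIV)
  obtain u0 R where u0: "u0 \<in> Lp_space M p" "g u0 \<noteq> 0" and R: "\<And>u. u \<in> Lp_space M p \<Longrightarrow> g u \<noteq> 0 \<Longrightarrow> Lp_norm M p u \<le> R"
    using g(1) unfolding bump_def by auto
  define \<sigma> where "\<sigma> = sgn (g u0)"
  \<comment> \<open>\<open>\<sigma> * g\<close> starts at 4 \<epsilon>. The allowed decreases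
    \<epsilon> / 2^k add up to 2 \<epsilon>, so it stays positive along the walk.\<close>
  define \<epsilon> where "\<epsilon> = \<sigma> * g u0 / 4"
  have \<epsilon>: "0 < \<epsilon>" using u0(2) by (auto simp: \<epsilon>_def \<sigma>_def sgn_real_def)
  define S where "S = (\<lambda>k u. {y::'x. \<sigma> * g u - \<epsilon> / 2 ^ k \<le> \<sigma> * g (u + emb k y)})"
  have "0 \<in> S k u" for k u using \<epsilon> by (simp add: S_def emb_zero)
  then have "\<forall>k u. \<exists>x\<in>S k u. \<forall>y\<in>S k u. min 1 (norm y) \<le> 2 * norm x"
    using exists_almost_maximal by blast
  then obtain pick where pick: "\<And>k u. pick k u \<in> S k u"
    "\<And>k u y. y \<in> S k u \<Longrightarrow> min 1 (norm y) \<le> 2 * norm (pick k u)"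
    by metis
  define u where "u = rec_nat u0 (\<lambda>k u. u + emb k (pick k u))"
  define x where "x = (\<lambda>k. pick k (u k))"
  have u_0: "u 0 = u0" and u_Suc: "u (Suc k) = u k + emb k (x k)" for k by (simp_all add: u_def x_def)
  have u_sum: "u k = u0 + glue x {..<k}" for k
    unfolding glue_lessThan by (induction k) (simp_all add: u_0 u_Suc add.assoc)
  have uL: "u k \<in> Lp_space M p" for k
    unfolding u_sum using u0(1) by (intro L.V_closed glue_finite(1)) auto
  \<comment> \<open>The right side is what remains of 4 \<epsilon> after spending \<epsilon>,
    \<epsilon> / 2, ..., \<epsilon> / 2^(k - 1).\<close>
  have gu: "\<sigma> * g (u k) \<ge> 2 * \<epsilon> + 2 * \<epsilon> / 2 ^ k" for k
  proof (induction k)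
    case 0
    then show ?case by (simp add: u_0 \<epsilon>_def)
  next
    case (Suc k)
    have "\<sigma> * g (u k) - \<epsilon> / 2 ^ k \<le> \<sigma> * g (u (Suc k))"
      using pick(1)[of k "u k"] by (simp add: S_def u_Suc x_def)
    moreover have "2 * \<epsilon> / 2 ^ Suc k = 2 * \<epsilon> / 2 ^ k - \<epsilon> / 2 ^ k" by (simp add: field_simps)
    ultimately show ?case using Suc by linarith
  qed
  have uR: "Lp_norm M p (u k) \<le> R" for k
  proof (rule R[OF uL])
    have "0 < 2 * \<epsilon> + 2 * \<epsilon> / 2 ^ k" using \<epsilon> by (simp add: add_pos_pos)
    then show "g (u k) \<noteq> 0" using gu[of k] by auto
  qed
  \<comment> \<open>The moves have disjoint supports, so the radius R of the support of
    \<open>g\<close> controls the sum of their p-th powers.\<close>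
  have sumb: "(\<Sum>j<k. norm (x j) powr p) \<le> (R + Lp_norm M p u0) powr p" for k
  proof -
    have "glue x {..<k} = u k + (- u0)" unfolding u_sum by simp
    then have "Lp_norm M p (glue x {..<k}) \<le> Lp_norm M p (u k) + Lp_norm M p u0"
      using L.triangle[OF uL[of k], of "- u0"] u0(1) by (simp add: L.N_minus)
    then have "Lp_norm M p (glue x {..<k}) \<le> R + Lp_norm M p u0" using uR[of k] by linarith
    then have "Lp_norm M p (glue x {..<k}) powr p \<le> (R + Lp_norm M p u0) powr p"
      using \<open>0 < p\<close> by (intro powr_mono2) (auto simp: Lp_norm_nonneg)
    then show ?thesis by (simp add: glue_finite(2))
  qed
  have sx: "summable (\<lambda>j. norm (x j) powr p)"
    by (rule summableI_nonneg_bounded[OF _ sumb]) simp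
  \<comment> \<open>The limit of the walk, written down directly as a function on the disjoint
    sets.\<close>
  define w where "w = u0 + glue x {0..}"
  have wL: "w \<in> Lp_space M p" unfolding w_def using u0(1) glue_summable(1)[OF sx, of 0] by (intro L.V_closed) auto
  obtain D where D: "derivs_upto (Lp_space M p) (Lp_norm M p) g n D"
    and H: "\<And>x. x \<in> Lp_space M p \<Longrightarrow> \<exists>\<delta>>0. \<exists>C. \<forall>y\<in>Lp_space M p. \<forall>z\<in>Lp_space M p. Lp_norm M p (y - x) < \<delta> \<longrightarrow>
       Lp_norm M p (z - x) < \<delta> \<longrightarrow> mbound (Lp_space M p) (Lp_norm M p) n (\<lambda>vs. D n y vs - D n z vs) (C * Lp_norm M p (y - z) powr \<alpha>)"
    using g(2) unfolding H_smooth_def n[symmetric] \<alpha>(1)[symmetric] by blast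
  obtain \<delta> C where \<delta>: "0 < \<delta>" and HC: "\<And>y z. y \<in> Lp_space M p \<Longrightarrow> z \<in> Lp_space M p \<Longrightarrow> Lp_norm M p (y - w) < \<delta> \<Longrightarrow>
       Lp_norm M p (z - w) < \<delta> \<Longrightarrow> mbound (Lp_space M p) (Lp_norm M p) n (\<lambda>vs. D n y vs - D n z vs) (C * Lp_norm M p (y - z) powr \<alpha>)"
    using H[OF wL] by blast
  \<comment> \<open>At most 1 because of the truncation in the choice of moves; \<delta> / 4 is half
    the radius of the ball to which \<open>g\<close> is restricted below.\<close>
  define \<eta> where "\<eta> = min 1 (\<delta> / 4)"
  have \<eta>: "0 < \<eta>" using \<delta> by (simp add: \<eta>_def)
  obtain k1 where k1: "\<And>k. k1 \<le> k \<Longrightarrow> norm (\<Sum>j. norm (x (j + k)) powr p) < (\<delta> / 2) powr p"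
    using suminf_exist_split[OF _ sx, of "(\<delta> / 2) powr p"] \<delta> by auto
  have "(\<lambda>j. norm (x j) powr p) \<longlonglongrightarrow> 0" by (rule summable_LIMSEQ_zero[OF sx])
  then have "\<forall>\<^sub>F j in sequentially. norm (x j) powr p < (\<eta> / 2) powr p"
    using \<eta> by (intro order_tendstoD(2)[where y = 0]) auto
  then obtain k2 where k2: "\<And>k. k2 \<le> k \<Longrightarrow> norm (x k) powr p < (\<eta> / 2) powr p"
    unfolding eventually_sequentially by blast
  \<comment> \<open>A late index: the k-th move is short and \<open>u k\<close> is so close to
    \<open>w\<close> that the ball of radius \<delta> / 2 about it lies in the ball with the Hoelder
    bound.\<close>
  define k where "k = max k1 k2"
  have xk: "norm (x k) < \<eta> / 2"
  proof (rule ccontr)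
    assume "\<not> ?thesis"
    then have "(\<eta> / 2) powr p \<le> norm (x k) powr p" using \<eta> \<open>0 < p\<close> by (intro powr_mono2) auto
    then show False using k2[of k] by (simp add: k_def)
  qed
  have wk: "Lp_norm M p (u k - w) < \<delta> / 2"
  proof (rule ccontr)
    assume "\<not> ?thesis"
    moreover have "w - u k = glue x {k..}" using glue_split[of x k] by (simp add: w_def u_sum)
    then have "Lp_norm M p (u k - w) = Lp_norm M p (glue x {k..})" using L.N_commute[OF uL[of k] wL] by simp
    ultimately have "(\<delta> / 2) powr p \<le> Lp_norm M p (glue x {k..}) powr p" using \<delta> \<open>0 < p\<close> by (intro powr_mono2) auto
    then show False using k1[of k] unfolding glue_summable(2)[OF sx] by (simp add: k_def)
  qed
  have ball: "y \<in> L.nball (u k) (\<delta> / 2) \<Longrightarrow> y \<in> Lp_space M p \<and> Lp_norm M p (y - w) < \<delta>" for y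
    using L.N_triangle3[of y "u k" w] uL[of k] wL wk by (auto simp: L.nball_def)
  obtain C1 where j1: "L.jet (L.nball (u k) (\<delta> / 2)) n \<alpha> C1 g D"
    by (rule L.jet_ball[OF D uL[of k] _ \<alpha>(2,3), where \<rho> = "\<delta> / 2" and M = C])
       (use \<delta> ball HC in auto)
  have inball: "u k + emb k y \<in> L.nball (u k) (\<delta> / 2)" if "y \<in> X.nball 0 (\<delta> / 2)" for y :: 'x
    using that uL[of k] emb_Lp[of k y] by (simp add: L.nball_def X.nball_def)
  have j2: "X.jet (X.nball 0 (\<delta> / 2)) n \<alpha> (C1 * (1 + 1) ^ (n + 1)) (\<lambda>y. g (u k + emb k y))
      (\<lambda>j y vs. D j (u k + emb k y) (\<lambda>i. emb k (vs i)))"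
    by (rule jet_pullback[OF seminormed_Lp[OF p] seminormed_UNIV j1])
       (use emb_linear emb_Lp \<alpha> uL[of k] inball in auto)
  \<comment> \<open>The base of the power in \<open>f\<close> is positive exactly when the move y
    costs less than \<epsilon> / 2^k; at y = 0 it is \<epsilon> / 2^k.\<close>
  define a where "a = \<epsilon> / 2 ^ k - \<sigma> * g (u k)"
  define f where "f = (\<lambda>y::'x. (max 0 (a + \<sigma> * g (u k + emb k y))) ^ (n + 2))"
  obtain C3 E3 where j3: "X.jet (X.nball 0 (\<delta> / 2)) n \<alpha> C3 f E3"
    unfolding f_def by (rule X.jet_pos_part_power[OF j2])
  have f0: "f y = 0" if "\<delta> / 4 \<le> norm y" for y
  proof -
    \<comment> \<open>An admissible y would satisfy \<open>min 1 (norm y) < \<eta>\<close>, because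
      the chosen move is almost maximal and short; this contradicts norm y \<ge> \<delta> /
      4.\<close>
    have "y \<notin> S k (u k)"
    proof
      assume "y \<in> S k (u k)"
      then have "min 1 (norm y) \<le> 2 * norm (x k)" using pick(2) by (simp add: x_def)
      then have "min 1 (norm y) < \<eta>" using xk by linarith
      then show False using that unfolding \<eta>_def by linarith
    qed
    then have "max 0 (a + \<sigma> * g (u k + emb k y)) = 0" by (simp add: S_def a_def)
    then show ?thesis by (simp add: f_def)
  qed
  obtain C4 E4 where j4: "X.jet UNIV n \<alpha> C4 f E4"
    by (rule X.jet_extend[OF j3 _ _ \<alpha>(2), where \<kappa> = 0]) (use \<delta> f0 in auto)
  have "uniformly_H_smooth UNIV norm r f"
    by (rule X.jet_imp_uniformly_H_smooth[OF j4]) (use n \<alpha> in auto)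
  moreover have "f 0 \<noteq> 0" using \<epsilon> by (simp add: f_def a_def emb_zero)
  then have "bump UNIV norm f"
    unfolding bump_def using f0 by (meson UNIV_I linear)
  ultimately show ?thesis by blast
qed

theorem theorem2p5:
  fixes M :: "'s measure" and p r :: real
  assumes "1 < r" and "r \<le> p" and "Lp_infinite_dim M p"
  shows "((\<exists>g :: 'x::banach \<Rightarrow> real. bump UNIV norm g \<and> uniformly_H_smooth UNIV norm r g)
          \<longleftrightarrow> (\<exists>g :: ('s \<Rightarrow> 'x) \<Rightarrow> real. bump (Lp_space M p) (Lp_norm M p) g
                 \<and> uniformly_H_smooth (Lp_space M p) (Lp_norm M p) r g))
       \<and> ((\<exists>g :: ('s \<Rightarrow> 'x) \<Rightarrow> real. bump (Lp_space M p) (Lp_norm M p) g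
                 \<and> uniformly_H_smooth (Lp_space M p) (Lp_norm M p) r g)
          \<longleftrightarrow> (\<exists>g :: ('s \<Rightarrow> 'x) \<Rightarrow> real. bump (Lp_space M p) (Lp_norm M p) g
                 \<and> H_smooth (Lp_space M p) (Lp_norm M p) r g))"
proof -
  define n where "n = horder r"
  define \<alpha> where "\<alpha> = r - real n"
  have "1 \<le> \<lceil>r\<rceil> - 1" using assms(1) by linarith
  \<comment> \<open>\<open>horder r\<close> is the largest integer strictly below r, so \<alpha>
    lies in (0, 1] and equals 1 for integral r. The preceding line ensures that \<open>nat\<close>
    truncates nothing.\<close>
  then have "real n = real_of_int \<lceil>r\<rceil> - 1" by (simp add: n_def horder_def)
  then have \<alpha>: "0 < \<alpha>" "\<alpha> \<le> 1" unfolding \<alpha>_def by linarith+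
  have p: "1 \<le> p" "real n + \<alpha> \<le> p" using assms by (auto simp: \<alpha>_def)
  have "\<exists>g :: ('s \<Rightarrow> 'x) \<Rightarrow> real. bump (Lp_space M p) (Lp_norm M p) g
      \<and> uniformly_H_smooth (Lp_space M p) (Lp_norm M p) r g"
    if b: "bump UNIV norm b" "uniformly_H_smooth UNIV norm r b" for b :: "'x \<Rightarrow> real"
  proof -
    obtain \<psi> :: "'x \<Rightarrow> real" and D C \<delta> R R' \<kappa> where \<psi>: "seminormed.jet (UNIV :: 'x set) norm UNIV n \<alpha> C \<psi> D"
      "\<And>x. 0 \<le> \<psi> x" "\<And>x. norm x < \<delta> \<Longrightarrow> \<psi> x = 0" "\<And>x. R' < norm x \<Longrightarrow> \<psi> x = 0"
      "\<And>x. R \<le> norm x \<Longrightarrow> norm x \<le> 2 * R \<Longrightarrow> \<psi> x = \<kappa>" "0 < \<delta>" "0 < R" "0 < R'" "0 < \<kappa>"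
      by (rule annular_jet[OF assms(1) n_def \<alpha>_def \<alpha> b]) (rule that)
    have "\<exists>K c (G :: nat \<Rightarrow> 'x \<Rightarrow> (nat \<Rightarrow> 'x) \<Rightarrow> real). pjet p n \<alpha> K c G"
      by (rule pjet_exists[OF \<psi>(1) \<alpha>(1) p(2) \<psi>(2-)]) blast+
    then obtain K c and G :: "nat \<Rightarrow> 'x \<Rightarrow> (nat \<Rightarrow> 'x) \<Rightarrow> real" where "pjet p n \<alpha> K c G"
      by blast
    from Lp_uniformly_smooth_bump[OF this \<alpha>(1) p(2,1) n_def \<alpha>_def] show ?thesis .
  qed
  moreover have "H_smooth (Lp_space M p) (Lp_norm M p) r g"
    if u: "uniformly_H_smooth (Lp_space M p) (Lp_norm M p) r g" for g :: "('s \<Rightarrow> 'x) \<Rightarrow> real"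
  proof -
    obtain D C where "derivs_upto (Lp_space M p) (Lp_norm M p) g (horder r) D"
      "\<forall>y\<in>Lp_space M p. \<forall>z\<in>Lp_space M p. mbound (Lp_space M p) (Lp_norm M p) (horder r)
        (\<lambda>vs. D (horder r) y vs - D (horder r) z vs) (C * Lp_norm M p (y - z) powr (r - real (horder r)))"
      using u unfolding uniformly_H_smooth_def by blast
    then show ?thesis
      unfolding H_smooth_def by (intro exI[of _ D] conjI ballI exI[of _ "1::real"] exI[of _ C]) auto
  qed
  moreover have "\<exists>f :: 'x \<Rightarrow> real. bump UNIV norm f \<and> uniformly_H_smooth UNIV norm r f"
    if "bump (Lp_space M p) (Lp_norm M p) g" "H_smooth (Lp_space M p) (Lp_norm M p) r g"
    for g :: "('s \<Rightarrow> 'x) \<Rightarrow> real"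
    using smooth_bump_of_Lp[OF p(1) assms(3) n_def \<alpha>_def \<alpha> that] .
  ultimately show ?thesis by blast
qed

end
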